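(* Suppose $G$ is a transitive permutation group of degree $n$, and let $(G_1,\dots,G_m)$ be a tower type for $G$. Let $n_i$ be the degree of $G_i$, and suppose for each $i$ there exist constants $a_i,b_i>0$ and a function $C_i:=C_i(d)$ such that for every number field $k$ of degree $d$ and every $X\ge1$, $$\#\mathcal{F}_{n_i,k}(X;G_i)\le C_i(d)\,X^{a_i}\,|\mathrm{Disc}(k)|^{-b_i}.$$ Suppose also that $b_i\ge a_i+\frac12$ for each $i\le m-1$, and that $b_i\ge a_i+\frac12+\frac1{2n_i}$ for each $i\le m-1$ such that $a_i<a_{i+1}<a_i+\frac1{2n_i}$. Then $$\#\mathcal{F}_{n,k}(X;G)\le 2^{m-1}\prod_{i=1}^{m-1}b_i\cdot\prod_{i=1}^mC_i(d_i)\cdot X^{\max\{a_1,\dots,a_m\}}\,|\mathrm{Disc}(k)|^{-b_m-\beta}$$ for every number field $k$ of degree $d$ and every $X\ge1$, where $d_i=d\prod_{j=i+1}^mn_j$ and $$\beta:=\frac12\sum_{i=0}^{m-2}\ \prod_{j=m-i}^{m}n_j=\frac{n_m+n_{m-1}n_m+\dots+n_2\cdots n_m}{2}.$$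
   Context: For a transitive permutation group $G$ of degree $n$ and a number field $k$, $$\mathcal{F}_{n,k}(X;G):=\{K/k : [K:k]=n,\ \mathrm{Gal}(\widetilde K/k)\simeq G,\ |\mathrm{Disc}(K)|\le X\},$$ where extensions are taken inside a fixed algebraic closure, $\widetilde K$ is the normal closure of $K$ over $k$, $\mathrm{Gal}(\widetilde K/k)$ is regarded as a permutation group via its action on the $n$ embeddings $K\hookrightarrow\mathbb{C}$ lifting a fixed embedding of $k$ (and $\simeq$ is permutation isomorphism), and $\mathrm{Disc}(K)$ is the absolute discriminant of $K$ over $\mathbb{Q}$. Tower type: let $G$ act transitively on a set $\Omega$, and let $\Omega=:\Delta_0,\Delta_1,\dots,\Delta_m=\{\Omega\}$ be a sequence of systems of blocks for $G$ that is nested in the sense that each block of $\Delta_i$ has the same size and is the union of at least two blocks from $\Delta_{i-1}$. For $i\ge1$ and $B\in\Delta_i$, write $B=\bigcup_{j=1}^{n_i}B_j$ with $B_j\in\Delta_{i-1}$; the stabilizer of $B$ acts transitively on $\{B_1,\dots,B_{n_i}\}$, and $G_i$ denotes the resulting permutation group of degree $n_i$ (independent of $B$ up to isomorphism). The sequence $(G_1,\dots,G_m)$ is a tower type for $G$. Equivalently, for every $G$-extension $K/k$ there exist extensions $F_0/F_1/\dots/F_m$ with $F_0=K$ and $F_m=k$ such that $F_{i-1}/F_i$ is a $G_i$-extension. *)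

theory Defs
  imports
    "HOL-Algebra.Algebra"
    "HOL-Library.Disjoint_Sets"
    "Jordan_Normal_Form.VS_Connect"
begin

section \<open>Permutation groups and tower types\<close>

abbreviation group_of_perms :: "'a set \<Rightarrow> ('a \<Rightarrow> 'a) set \<Rightarrow> ('a \<Rightarrow> 'a) monoid" where
  "group_of_perms \<Omega> G \<equiv> BijGroup \<Omega>\<lparr>carrier := G\<rparr>"

definition perm_group :: "'a set \<Rightarrow> ('a \<Rightarrow> 'a) set \<Rightarrow> bool" where
  "perm_group \<Omega> G \<longleftrightarrow> finite \<Omega> \<and> subgroup G (BijGroup \<Omega>)"

definition transitive_perm_group :: "'a set \<Rightarrow> ('a \<Rightarrow> 'a) set \<Rightarrow> bool" where
  "transitive_perm_group \<Omega> G \<longleftrightarrow>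
     perm_group \<Omega> G \<and> \<Omega> \<noteq> {} \<and> transitive_action (group_of_perms \<Omega> G) \<Omega> (\<lambda>g. g)"

definition perm_isomorphic ::
  "'a set \<Rightarrow> ('a \<Rightarrow> 'a) set \<Rightarrow> 'b set \<Rightarrow> ('b \<Rightarrow> 'b) set \<Rightarrow> bool" where
  "perm_isomorphic \<Omega> G \<Omega>' G' \<longleftrightarrow>
     (\<exists>\<phi> \<psi>. bij_betw \<phi> \<Omega> \<Omega>' \<and> \<psi> \<in> iso (group_of_perms \<Omega> G) (group_of_perms \<Omega>' G') \<and>
            (\<forall>g\<in>G. \<forall>x\<in>\<Omega>. \<phi> (g x) = \<psi> g (\<phi> x)))"

definition block_system :: "'a set \<Rightarrow> ('a \<Rightarrow> 'a) set \<Rightarrow> 'a set set \<Rightarrow> bool" where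
  "block_system \<Omega> G \<Delta> \<longleftrightarrow> partition_on \<Omega> \<Delta> \<and> (\<forall>g\<in>G. \<forall>B\<in>\<Delta>. g ` B \<in> \<Delta>)"

definition subblocks :: "(nat \<Rightarrow> 'a set set) \<Rightarrow> nat \<Rightarrow> 'a set \<Rightarrow> 'a set set" where
  "subblocks \<Delta> i B = {B' \<in> \<Delta> (i - 1). B' \<subseteq> B}"

text \<open>The equality \<open>\<Delta> 0 = \<Omega>\<close> of the usual definition identifies the points of \<open>\<Omega>\<close>
  with the singleton blocks.\<close>

definition nested_block_systems ::
  "'a set \<Rightarrow> ('a \<Rightarrow> 'a) set \<Rightarrow> nat \<Rightarrow> (nat \<Rightarrow> 'a set set) \<Rightarrow> bool" where
  "nested_block_systems \<Omega> G m \<Delta> \<longleftrightarrow>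
     \<Delta> 0 = (\<lambda>x. {x}) ` \<Omega> \<and> \<Delta> m = {\<Omega>} \<and>
     (\<forall>i\<le>m. block_system \<Omega> G (\<Delta> i)) \<and>
     (\<forall>i\<in>{1..m}. (\<forall>B\<in>\<Delta> i. \<forall>B'\<in>\<Delta> i. card B = card B') \<and>
        (\<forall>B\<in>\<Delta> i. B = \<Union>(subblocks \<Delta> i B) \<and> 2 \<le> card (subblocks \<Delta> i B)))"

text \<open>The permutation group that the setwise stabilizer of \<open>B\<close> in \<open>G\<close> induces on a set
  \<open>D\<close> of blocks contained in \<open>B\<close>.\<close>

definition induced_perm_group ::
  "('a \<Rightarrow> 'a) set \<Rightarrow> 'a set \<Rightarrow> 'a set set \<Rightarrow> ('a set \<Rightarrow> 'a set) set" where
  "induced_perm_group G B D = (\<lambda>g. \<lambda>B'\<in>D. g ` B') ` {g \<in> G. g ` B = B}"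

text \<open>\<open>(H 1, \<dots>, H m)\<close>, with \<open>H i\<close> acting on \<open>S i\<close>, is a tower type for \<open>G\<close>; only the
  indices \<open>1, \<dots>, m\<close> matter.\<close>

definition tower_type ::
  "'a set \<Rightarrow> ('a \<Rightarrow> 'a) set \<Rightarrow> nat \<Rightarrow> (nat \<Rightarrow> 'b set) \<Rightarrow> (nat \<Rightarrow> ('b \<Rightarrow> 'b) set) \<Rightarrow> bool" where
  "tower_type \<Omega> G m S H \<longleftrightarrow>
     (\<exists>\<Delta>. nested_block_systems \<Omega> G m \<Delta> \<and>
        (\<forall>i\<in>{1..m}. perm_group (S i) (H i) \<and>
           (\<forall>B\<in>\<Delta> i. perm_isomorphic
              (subblocks \<Delta> i B) (induced_perm_group G B (subblocks \<Delta> i B)) (S i) (H i))))"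


section \<open>Number fields inside the complex numbers\<close>

abbreviation complex_ring :: "complex ring" where
  "complex_ring \<equiv> class_ring"

abbreviation degree_eq :: "complex set \<Rightarrow> complex set \<Rightarrow> nat \<Rightarrow> bool" where
  "degree_eq k K n \<equiv> ring.dimension complex_ring n k K"

definition number_field :: "complex set \<Rightarrow> bool" where
  "number_field k \<longleftrightarrow> subfield k complex_ring \<and> ring.finite_dimension complex_ring \<rat> k"

definition embeddings :: "complex set \<Rightarrow> complex set \<Rightarrow> (complex \<Rightarrow> complex) set" where
  "embeddings k K =
     {\<tau> \<in> Ring.ring_hom (complex_ring\<lparr>carrier := K\<rparr>) complex_ring \<inter> extensional K. \<forall>x\<in>k. \<tau> x = x}"

text \<open>The normal closure is the compositum of all conjugates of \<open>K\<close> over \<open>k\<close>.\<close>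

definition normal_closure :: "complex set \<Rightarrow> complex set \<Rightarrow> complex set" where
  "normal_closure k K = generate_field complex_ring (\<Union>\<tau>\<in>embeddings k K. \<tau> ` K)"

definition Gal :: "complex set \<Rightarrow> complex set \<Rightarrow> (complex \<Rightarrow> complex) set" where
  "Gal k L =
     {\<sigma> \<in> ring_iso (complex_ring\<lparr>carrier := L\<rparr>) (complex_ring\<lparr>carrier := L\<rparr>) \<inter> extensional L.
        \<forall>x\<in>k. \<sigma> x = x}"

text \<open>The Galois group of the normal closure, as a group of permutations of the embeddings.\<close>

definition Gal_perm_group ::
  "complex set \<Rightarrow> complex set \<Rightarrow> ((complex \<Rightarrow> complex) \<Rightarrow> complex \<Rightarrow> complex) set" where
  "Gal_perm_group k K =
     (\<lambda>\<sigma>. \<lambda>\<tau>\<in>embeddings k K. compose K \<sigma> \<tau>) ` Gal k (normal_closure k K)"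

definition ring_of_integers :: "complex set \<Rightarrow> complex set" where
  "ring_of_integers K = {x \<in> K. algebraic_int x}"

definition integral_basis :: "complex set \<Rightarrow> complex list \<Rightarrow> bool" where
  "integral_basis K ws \<longleftrightarrow> set ws \<subseteq> ring_of_integers K \<and>
     (\<forall>x\<in>ring_of_integers K. \<exists>!cs :: int list.
        length cs = length ws \<and> x = (\<Sum>i<length ws. of_int (cs ! i) * ws ! i))"

definition field_trace :: "complex set \<Rightarrow> complex \<Rightarrow> complex" where
  "field_trace K x = (\<Sum>\<tau>\<in>embeddings \<rat> K. \<tau> x)"

definition basis_disc :: "complex set \<Rightarrow> complex list \<Rightarrow> complex" where
  "basis_disc K ws =
     det (mat (length ws) (length ws) (\<lambda>(i, j). field_trace K (ws ! i * ws ! j)))"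

text \<open>The choice of the integral basis is immaterial: a change of basis multiplies the
  determinant by the square of a unit of \<open>\<int>\<close>. The value is a rational integer.\<close>

definition Disc :: "complex set \<Rightarrow> complex" where
  "Disc K = basis_disc K (SOME ws. integral_basis K ws)"

abbreviation abs_Disc :: "complex set \<Rightarrow> real" where
  "abs_Disc K \<equiv> cmod (Disc K)"

text \<open>The set of extensions \<open>K/k\<close> in \<open>\<complex>\<close> of degree \<open>n\<close> whose Galois group is permutation
  isomorphic to \<open>G\<close> (acting on \<open>\<Omega>\<close>), with absolute discriminant at most \<open>x\<close>. Every finite
  extension of \<open>k\<close> in \<open>\<complex>\<close> lies in the algebraic closure of \<open>k\<close> in \<open>\<complex>\<close>.\<close>

definition G_extensions ::
  "nat \<Rightarrow> complex set \<Rightarrow> real \<Rightarrow> 'a set \<Rightarrow> ('a \<Rightarrow> 'a) set \<Rightarrow> complex set set" where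
  "G_extensions n k x \<Omega> G =
     {K. subfield K complex_ring \<and> k \<subseteq> K \<and> degree_eq k K n \<and>
         perm_isomorphic (embeddings k K) (Gal_perm_group k K) \<Omega> G \<and>
         abs_Disc K \<le> x}"

text \<open>\<open>card\<close> is \<open>0\<close> on infinite sets, so a bound on the size has to include finiteness.\<close>

definition size_le :: "'a set \<Rightarrow> real \<Rightarrow> bool" where
  "size_le A r \<longleftrightarrow> finite A \<and> real (card A) \<le> r"

end

theory Submission
  imports Defs "Jordan_Normal_Form.Char_Poly" "HOL-Computational_Algebra.Fundamental_Theorem_Algebra"
begin

text \<open>By Galois theory, the chain of blocks containing the inclusion of \<open>K\<close> yields a tower
  \<open>K = F 0 \<supseteq> \<dots> \<supseteq> F m = k\<close> in which \<open>F (i - 1)\<close> is an extension of \<open>F i\<close> with group \<open>H i\<close>. One counts such towers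
  by induction, splitting off the top step: as \<open>\<bar>Disc (F l)\<bar> ^ ns l \<le> \<bar>Disc (F (l - 1))\<bar>\<close>, the field \<open>F l\<close> has
  discriminant at most \<open>X powr (1 / ns l)\<close>, and the sum of \<open>\<bar>Disc (F l)\<bar> powr (- b l)\<close> over the possible
  \<open>F l\<close> is estimated by partial summation, starting from \<open>\<bar>Disc k\<bar> ^ [F l : k] \<le> \<bar>Disc (F l)\<bar>\<close>.

  The inequality \<open>\<bar>Disc F\<bar> ^ [K : F] \<le> \<bar>Disc K\<bar>\<close> is proved without ideals. The trace form of \<open>K\<close> twisted by a
  polynomial \<open>f\<close> over \<open>F\<close> has determinant \<open>Disc K\<close> times the norm of \<open>f\<close>, and the norm from \<open>K\<close> is the
  \<open>[K : F]\<close>-th power of the norm from \<open>F\<close>. If the coefficients of \<open>f\<close> are a dual integral basis of \<open>F\<close>,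
  then both determinants have integer coefficients, and Dedekind's Prague theorem shows that the one for
  \<open>F\<close> has content 1. Comparing contents gives the divisibility of \<open>Disc K\<close> by \<open>Disc F ^ [K : F]\<close>.\<close>

section \<open>Algebraic integers\<close>

text \<open>The ring of integers of K need not be free over that of F, so there is no relative
  integral basis along which the trace matrix of K could be factored; the twisted form stands in for
  the relative discriminant. In the counting, partial summation at one step bounds a sum of
  \<open>D powr (- b l)\<close> by a multiple of the lower bound of D to the power -1/2. It costs
  the factor \<open>2 * b l\<close>, and as the lower bound is a power of the discriminant of k with
  exponent [F l : k], it adds half of that degree to the exponent of Disc k; these halves add up to
  \<beta>. The obstacle is that the exponent with which the fields F l are counted may exceed
  \<open>b l - 1 / 2\<close>. The excess is paid for in X: as Disc (F l) is at most
  \<open>X powr (1 / ns l)\<close>, an extra exponent \<open>ns l * (M - a l)\<close> there costs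
  only \<open>X powr (M - a l)\<close>, which raises \<open>a l\<close> to the maximum M.
  Multiplying the inequalities requires \<open>C i d \<ge> 0\<close>. This is read off from the
  assumed bounds, for which some number field of degree d has to exist; hence the fields generated
  by roots of 2.\<close>

inductive_set zspan :: "complex set \<Rightarrow> complex set" for B where
  zero [intro, simp]: "0 \<in> zspan B"
| base [intro]: "b \<in> B \<Longrightarrow> b \<in> zspan B"
| add [intro]: "x \<in> zspan B \<Longrightarrow> y \<in> zspan B \<Longrightarrow> x + y \<in> zspan B"
| minus [intro]: "x \<in> zspan B \<Longrightarrow> - x \<in> zspan B"

lemma zspan_of_int_mult:
  assumes "x \<in> zspan B" shows "of_int c * x \<in> zspan B"
proof -
  have nat: "of_nat n * x \<in> zspan B" for n
    by (induction n) (use assms in \<open>auto simp: algebra_simps\<close>)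
  show ?thesis
    using nat[of "nat c"] zspan.minus[OF nat[of "nat (- c)"]] by (cases "c \<ge> 0") auto
qed

lemma zspan_sum: "(\<And>i. i \<in> I \<Longrightarrow> f i \<in> zspan B) \<Longrightarrow> sum f I \<in> zspan B"
  by (induction I rule: infinite_finite_induct) auto

lemma zspan_finite:
  assumes "finite B" "x \<in> zspan B"
  obtains c where "x = (\<Sum>b\<in>B. of_int (c b) * b)"
proof -
  have "\<exists>c. x = (\<Sum>b\<in>B. of_int (c b) * b)"
    using assms(2)
  proof induction
    case zero
    show ?case by (rule exI[of _ "\<lambda>_. 0"]) simp
  next
    case (base b)
    then show ?case
      using assms(1) by (intro exI[of _ "\<lambda>b'. if b' = b then 1 else 0"]) (simp add: if_distrib[of of_int] if_distrib[of "\<lambda>c. c * _"] sum.delta cong: if_cong)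
  next
    case (add x y)
    then obtain c d where "x = (\<Sum>b\<in>B. of_int (c b) * b)" "y = (\<Sum>b\<in>B. of_int (d b) * b)" by auto
    then show ?case
      by (intro exI[of _ "\<lambda>b. c b + d b"]) (simp add: sum.distrib algebra_simps)
  next
    case (minus x)
    then obtain c where "x = (\<Sum>b\<in>B. of_int (c b) * b)" by auto
    then show ?case
      by (intro exI[of _ "\<lambda>b. - c b"]) (simp add: sum_negf)
  qed
  then show ?thesis using that by blast
qed

text \<open>Integrality is tested on a finite set B containing 1 instead of on a polynomial: the
  numbers stabilizing one fixed B are closed under sums and products, and this makes the algebraic
  integers a ring.\<close>

definition stabilizes :: "complex \<Rightarrow> complex set \<Rightarrow> bool" where
  "stabilizes y B \<longleftrightarrow> (\<forall>b\<in>B. y * b \<in> zspan B)"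

lemma stabilizes_mult_zspan:
  assumes "stabilizes y B" "x \<in> zspan B" shows "y * x \<in> zspan B"
  using assms(2) by induction (use assms(1) in \<open>auto simp: stabilizes_def algebra_simps\<close>)

lemma stabilizes_add: "stabilizes x B \<Longrightarrow> stabilizes y B \<Longrightarrow> stabilizes (x + y) B"
  by (auto simp: stabilizes_def ring_distribs)

lemma stabilizes_mult: "stabilizes x B \<Longrightarrow> stabilizes y B \<Longrightarrow> stabilizes (x * y) B"
  using stabilizes_mult_zspan[of x B] by (auto simp: stabilizes_def mult.assoc)

text \<open>Multiplication by y acts on B through an integer matrix A. The vector listing B is an
  eigenvector for y, nonzero because B contains 1, so y is a root of the monic integer polynomial
  \<open>char_poly A\<close>.\<close>

lemma algebraic_int_if_stabilizes:
  assumes B: "finite B" "1 \<in> B" and y: "stabilizes y B"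
  shows "algebraic_int y"
proof -
  obtain bs where bs: "set bs = B" "distinct bs"
    using finite_distinct_list[OF B(1)] by auto
  define n where "n = length bs"
  have "\<exists>c. y * b = (\<Sum>b'\<in>B. of_int (c b') * b')" if "b \<in> B" for b
    using zspan_finite[OF B(1)] y that unfolding stabilizes_def by metis
  then obtain c where c: "\<And>b. b \<in> B \<Longrightarrow> y * b = (\<Sum>b'\<in>B. of_int (c b b') * b')"
    by metis
  define A :: "int mat" where "A = mat n n (\<lambda>(i, j). c (bs ! i) (bs ! j))"
  define v :: "complex vec" where "v = vec n (\<lambda>i. bs ! i)"
  have A: "A \<in> carrier_mat n n" by (simp add: A_def)
  have v: "v \<in> carrier_vec n" by (simp add: v_def)
  have v0: "v \<noteq> 0\<^sub>v n"
  proof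
    assume "v = 0\<^sub>v n"
    moreover obtain i where "i < n" "bs ! i = 1"
      using B(2) bs(1) by (metis in_set_conv_nth n_def)
    ultimately show False
      by (metis index_vec index_zero_vec(1) v_def zero_neq_one)
  qed
  have "map_mat of_int A *\<^sub>v v = y \<cdot>\<^sub>v v"
  proof (rule eq_vecI)
    fix i assume i: "i < dim_vec (y \<cdot>\<^sub>v v)"
    then have i: "i < n" by (simp add: v_def)
    have "y * (bs ! i) = (\<Sum>b'\<in>B. of_int (c (bs ! i) b') * b')"
      using c[of "bs ! i"] i bs(1) n_def by auto
    also have "\<dots> = (\<Sum>j<n. of_int (c (bs ! i) (bs ! j)) * (bs ! j))"
      using bs by (intro sum.reindex_bij_betw[symmetric] bij_betw_nth) (auto simp: n_def)
    finally show "(map_mat of_int A *\<^sub>v v) $ i = (y \<cdot>\<^sub>v v) $ i"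
      using i by (simp add: A_def v_def scalar_prod_def lessThan_atLeast0)
  qed (auto simp: A_def v_def)
  then have "eigenvalue (map_mat of_int A) y"
    unfolding eigenvalue_def eigenvector_def using A v v0 by (intro exI[of _ v]) auto
  then have "poly (char_poly (map_mat of_int A)) y = 0"
    using eigenvalue_root_char_poly[of "map_mat of_int A" n y] A by auto
  then have "poly (map_poly of_int (char_poly A)) y = 0"
    by (simp add: of_int_hom.char_poly_hom[OF A])
  moreover have "lead_coeff (char_poly A) = 1"
    using degree_monic_char_poly[OF A] by simp
  ultimately show ?thesis
    unfolding algebraic_int_altdef_ipoly by blast
qed

text \<open>If M is the module spanned by B, the new set spans M + M x + ... + M x^(n-1). The monic
  relation rewrites x^n through lower powers with coefficients that stabilize B, so x maps this
  module to itself.\<close>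

lemma stabilized_extension:
  assumes B: "finite B" "1 \<in> B" and p: "lead_coeff p = 1" "poly p x = 0"
    and coeffs: "\<And>i. stabilizes (coeff p i) B"
  obtains B' where "finite B'" "1 \<in> B'" "stabilizes x B'"
    "\<And>y. stabilizes y B \<Longrightarrow> stabilizes y B'"
proof -
  define n where "n = degree p"
  have "n > 0"
  proof (rule ccontr)
    assume "\<not> n > 0"
    then obtain c where "p = [:c:]" unfolding n_def by (metis degree_eq_zeroE gr0I)
    then show False using p by simp
  qed
  define B' where "B' = (\<lambda>(b, j). b * x ^ j) ` (B \<times> {..<n})"
  have in_B': "b * x ^ j \<in> zspan B'" if "b \<in> zspan B" "j < n" for b j
    using that(1)
  proof induction
    case (base b) then show ?case using that(2) by (auto simp: B'_def)
  qed (auto simp: algebra_simps)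
  have "stabilizes x B'"
    unfolding stabilizes_def
  proof
    fix y assume "y \<in> B'"
    then obtain b j where b: "b \<in> B" "j < n" "y = b * x ^ j" by (auto simp: B'_def)
    show "x * y \<in> zspan B'"
    proof (cases "Suc j < n")
      case True
      then have "b * x ^ Suc j \<in> zspan B'" using b by (intro in_B') auto
      then show ?thesis using b by (simp add: algebra_simps)
    next
      case False
      then have "Suc j = n" using b by simp
      have "0 = (\<Sum>i<n. coeff p i * x ^ i) + x ^ n"
        using p by (simp add: poly_altdef n_def lessThan_Suc_atMost[symmetric])
      then have "x ^ n = - (\<Sum>i<n. coeff p i * x ^ i)"
        by (simp add: eq_neg_iff_add_eq_0 add.commute)
      then have "x * y = - (\<Sum>i<n. (coeff p i * b) * x ^ i)"
        using b \<open>Suc j = n\<close> by (simp add: sum_distrib_left algebra_simps flip: power_Suc)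
      moreover have "(coeff p i * b) * x ^ i \<in> zspan B'" if "i < n" for i
        using coeffs[of i] b(1) that by (intro in_B') (auto simp: stabilizes_def)
      ultimately show ?thesis by (auto intro!: zspan_sum)
    qed
  qed
  moreover have "stabilizes y B'" if "stabilizes y B" for y
    using that in_B' by (auto simp: stabilizes_def B'_def mult.assoc[symmetric])
  moreover have "1 \<in> B'"
    using \<open>n > 0\<close> B(2) by (force simp: B'_def image_iff)
  moreover have "finite B'" using B by (simp add: B'_def)
  ultimately show ?thesis using that by blast
qed

lemma stabilizes_of_int [simp]: "stabilizes (of_int c) B"
  by (auto simp: stabilizes_def intro: zspan_of_int_mult)

lemma common_stabilized_set:
  assumes "finite C" "\<And>x. x \<in> C \<Longrightarrow> algebraic_int x"
  obtains B where "finite B" "1 \<in> B" "\<And>x. x \<in> C \<Longrightarrow> stabilizes x B"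
proof -
  have "\<exists>B. finite B \<and> 1 \<in> B \<and> (\<forall>x\<in>C. stabilizes x B)"
    using assms
  proof induction
    case empty
    show ?case by (rule exI[of _ "{1}"]) simp
  next
    case (insert x C)
    then obtain B where B: "finite B" "1 \<in> B" "\<forall>x\<in>C. stabilizes x B" by auto
    obtain p where p: "lead_coeff p = 1" "\<forall>i. coeff p i \<in> \<int>" "poly p x = 0"
      using insert.prems[of x] by (auto elim: algebraic_int.cases)
    have "stabilizes (coeff p i) B" for i
      using p(2) by (metis Ints_cases stabilizes_of_int)
    from stabilized_extension[OF B(1,2) p(1,3) this] obtain B' where
      "finite B'" "1 \<in> B'" "stabilizes x B'" "\<And>y. stabilizes y B \<Longrightarrow> stabilizes y B'"
      by blast
    then show ?case using B(3) by blast
  qed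
  then show ?thesis using that by blast
qed

lemma algebraic_int_add_complex:
  fixes x y :: complex
  assumes "algebraic_int x" "algebraic_int y" shows "algebraic_int (x + y)"
proof -
  obtain B where "finite B" "1 \<in> B" "stabilizes x B" "stabilizes y B"
    by (rule common_stabilized_set[of "{x, y}"]) (use assms in auto)
  then show ?thesis by (meson algebraic_int_if_stabilizes stabilizes_add)
qed

lemma algebraic_int_mult_complex:
  fixes x y :: complex
  assumes "algebraic_int x" "algebraic_int y" shows "algebraic_int (x * y)"
proof -
  obtain B where "finite B" "1 \<in> B" "stabilizes x B" "stabilizes y B"
    by (rule common_stabilized_set[of "{x, y}"]) (use assms in auto)
  then show ?thesis by (meson algebraic_int_if_stabilizes stabilizes_mult)
qed

text \<open>Transitivity of integrality: one set B is stabilized by all of the finitely many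
  coefficients, and the root is then adjoined to it.\<close>

lemma algebraic_int_if_root_monic:
  fixes x :: complex
  assumes "lead_coeff p = 1" "poly p x = 0" "\<And>i. algebraic_int (coeff p i)"
  shows "algebraic_int x"
proof -
  have "finite (range (coeff p))"
    by (rule finite_subset[of _ "insert 0 (coeff p ` {..degree p})"]) (use coeff_eq_0[of p] in \<open>auto simp: not_le[symmetric]\<close>)
  then obtain B where B: "finite B" "1 \<in> B" "\<And>c. c \<in> range (coeff p) \<Longrightarrow> stabilizes c B"
    by (rule common_stabilized_set[of "range (coeff p)"]) (use assms(3) in auto)
  have "stabilizes (coeff p i) B" for i using B(3) by blast
  from stabilized_extension[OF B(1,2) assms(1,2) this] obtain B' where
    "finite B'" "1 \<in> B'" "stabilizes x B'"
    by blast
  then show ?thesis by (rule algebraic_int_if_stabilizes)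
qed

lemma algebraic_int_diff_complex:
  fixes x y :: complex
  assumes "algebraic_int x" "algebraic_int y" shows "algebraic_int (x - y)"
  using algebraic_int_add_complex[of x "- y"] assms by auto

lemma algebraic_int_of_int [simp]: "algebraic_int (of_int c :: complex)"
  by (intro int_imp_algebraic_int) auto

lemma algebraic_int_sum_complex:
  "(\<And>i. i \<in> I \<Longrightarrow> algebraic_int (f i :: complex)) \<Longrightarrow> algebraic_int (sum f I)"
  by (induction I rule: infinite_finite_induct) (auto intro: algebraic_int_add_complex)

section \<open>Polynomials with algebraic integer coefficients\<close>

definition int_coeffs :: "complex poly \<Rightarrow> bool" where
  "int_coeffs p \<longleftrightarrow> (\<forall>i. algebraic_int (coeff p i))"

lemma int_coeffs_diff: "int_coeffs p \<Longrightarrow> int_coeffs q \<Longrightarrow> int_coeffs (p - q)"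
  by (auto simp: int_coeffs_def intro: algebraic_int_diff_complex)

lemma int_coeffs_add: "int_coeffs p \<Longrightarrow> int_coeffs q \<Longrightarrow> int_coeffs (p + q)"
  by (simp add: int_coeffs_def algebraic_int_add_complex)

lemma int_coeffs_mult: "int_coeffs p \<Longrightarrow> int_coeffs q \<Longrightarrow> int_coeffs (p * q)"
  by (auto simp: int_coeffs_def coeff_mult intro!: algebraic_int_sum_complex algebraic_int_mult_complex)

lemma int_coeffs_monom: "algebraic_int c \<Longrightarrow> int_coeffs (monom c n)"
  by (simp add: int_coeffs_def)

text \<open>For the leading coefficient a and n = degree h, the number a^(n-1) h(r) is the value at
  a r of a monic polynomial q with integral coefficients.\<close>

lemma algebraic_int_lead_coeff_times_root:
  assumes "int_coeffs h" "poly h r = 0" "h \<noteq> 0"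
  shows "algebraic_int (lead_coeff h * r)"
proof -
  define n where "n = degree h"
  define a where "a = lead_coeff h"
  have "n > 0"
  proof (rule ccontr)
    assume "\<not> n > 0"
    then obtain c where "h = [:c:]" unfolding n_def by (metis degree_eq_zeroE gr0I)
    then show False using assms by simp
  qed
  define q where "q = monom 1 n + (\<Sum>i<n. monom (coeff h i * a ^ (n - 1 - i)) i)"
  have cq: "coeff q i = (if i = n then 1 else if i < n then coeff h i * a ^ (n - 1 - i) else 0)" for i
    by (auto simp: q_def coeff_sum)
  have dq: "degree q = n"
    by (intro antisym degree_le le_degree) (auto simp: cq)
  have "a * poly q (a * r) = a ^ n * poly h r"
  proof -
    have "poly q (a * r) = (a * r) ^ n + (\<Sum>i<n. coeff h i * a ^ (n - 1 - i) * (a * r) ^ i)"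
      by (simp add: q_def poly_sum poly_monom)
    then have "a * poly q (a * r) = a * (a * r) ^ n + (\<Sum>i<n. a * (coeff h i * a ^ (n - 1 - i) * (a * r) ^ i))"
      by (simp add: ring_distribs sum_distrib_left)
    also have "(\<Sum>i<n. a * (coeff h i * a ^ (n - 1 - i) * (a * r) ^ i)) = (\<Sum>i<n. a ^ n * (coeff h i * r ^ i))"
    proof (rule sum.cong)
      fix i assume "i \<in> {..<n}"
      then have "Suc (n - 1 - i + i) = n" by simp
      then have pow: "a ^ n = a * (a ^ (n - 1 - i) * a ^ i)"
        by (metis power_Suc power_add)
      show "a * (coeff h i * a ^ (n - 1 - i) * (a * r) ^ i) = a ^ n * (coeff h i * r ^ i)"
        unfolding pow power_mult_distrib by (simp only: mult_ac)
    qed simp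
    also have "a * (a * r) ^ n + \<dots> = a ^ n * ((\<Sum>i<n. coeff h i * r ^ i) + a * r ^ n)"
      by (simp add: power_mult_distrib sum_distrib_left algebra_simps)
    also have "\<dots> = a ^ n * poly h r"
      by (simp add: poly_altdef a_def n_def lessThan_Suc_atMost[symmetric])
    finally show ?thesis .
  qed
  moreover have "a \<noteq> 0" using assms by (simp add: a_def)
  ultimately have root: "poly q (a * r) = 0" using assms(2) by simp
  have a: "algebraic_int a" using assms(1) by (simp add: a_def int_coeffs_def)
  have pow: "algebraic_int (a ^ k)" for k
    by (induction k) (simp_all add: a algebraic_int_mult_complex int_imp_algebraic_int)
  have "algebraic_int (coeff h i * a ^ (n - 1 - i))" for i
    by (rule algebraic_int_mult_complex[OF _ pow]) (use assms(1) in \<open>simp add: int_coeffs_def\<close>)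
  then have "algebraic_int (coeff q i)" for i
    by (simp add: cq int_imp_algebraic_int)
  moreover have "lead_coeff q = 1" by (simp add: dq cq)
  ultimately show ?thesis
    using algebraic_int_if_root_monic[OF _ root] by (simp add: a_def)
qed

text \<open>Induction on the degree, removing the leading term a x^n of h. The product with x - r
  loses a x^(n+1) - a r x^n, which is integral: r is a root of the product, whose leading
  coefficient is a, so a r is an algebraic integer.\<close>

lemma int_coeffs_div_linear:
  assumes "int_coeffs ([:- r, 1:] * h)"
  shows "int_coeffs h"
  using assms
proof (induction "degree h" arbitrary: h rule: less_induct)
  case less
  show ?case
  proof (cases "h = 0")
    case True then show ?thesis by (simp add: int_coeffs_def)
  next
    case False
    define a where "a = lead_coeff h"
    define n where "n = degree h"
    have lc: "lead_coeff ([:- r, 1:] * h) = a"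
      by (simp only: lead_coeff_mult a_def) simp
    have a: "algebraic_int a"
      using less.prems lc unfolding int_coeffs_def by metis
    have ar: "algebraic_int (a * r)"
    proof -
      have "[:- r, 1:] * h \<noteq> 0" using False by (metis mult_eq_0_iff pCons_eq_0_iff zero_neq_one)
      moreover have "poly ([:- r, 1:] * h) r = 0" by (simp only: poly_mult) simp
      ultimately show ?thesis
        using algebraic_int_lead_coeff_times_root[OF less.prems] lc by metis
    qed
    define h' where "h' = h - monom a n"
    have ch': "coeff h' i = (if i = n then 0 else coeff h i)" for i
      by (auto simp: h'_def a_def n_def)
    have "[:- r, 1:] * monom a n = monom a (Suc n) - monom (a * r) n"
      by (simp add: monom_Suc algebra_simps smult_monom add_monom)
    then have "[:- r, 1:] * h' = [:- r, 1:] * h - (monom a (Suc n) - monom (a * r) n)"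
      by (simp only: h'_def right_diff_distrib)
    then have int': "int_coeffs ([:- r, 1:] * h')"
      using less.prems int_coeffs_monom[OF a] int_coeffs_monom[OF ar] int_coeffs_diff by metis
    have mon: "int_coeffs (monom a n)" using a by (rule int_coeffs_monom)
    have "int_coeffs h'"
    proof (cases "n = 0")
      case True
      then have "h' = 0" by (intro poly_eqI) (use coeff_eq_0[of h] in \<open>auto simp: ch' n_def\<close>)
      then show ?thesis by (simp add: int_coeffs_def)
    next
      case n: False
      have "degree h' < n"
        using n coeff_eq_0[of h] by (intro degree_lessI) (auto simp: ch' n_def)
      then show ?thesis using less.hyps[of h'] int' by (simp add: n_def)
    qed
    moreover have "h = h' + monom a n" by (simp add: h'_def)
    ultimately show ?thesis
      using mon by (metis int_coeffs_add)
  qed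
qed

text \<open>Dedekind's Prague theorem.\<close>

lemma algebraic_int_coeff_times_coeff:
  assumes "int_coeffs (f * g)"
  shows "algebraic_int (coeff f i * coeff g j)"
  using assms
proof (induction "degree f" arbitrary: f i)
  case 0
  then obtain c where "f = [:c:]" by (metis degree_eq_zeroE)
  have "algebraic_int (c * coeff g j)"
    using 0(2) unfolding \<open>f = [:c:]\<close> int_coeffs_def by simp
  then show ?case
    unfolding \<open>f = [:c:]\<close> by (simp add: coeff_pCons split: nat.split)
next
  case (Suc d)
  then obtain r where "poly f r = 0"
    using fundamental_theorem_of_algebra[of f] constant_degree[of f] by (metis Zero_not_Suc)
  then obtain f1 where f1: "f = [:- r, 1:] * f1" by (auto simp: poly_eq_0_iff_dvd elim: dvdE)
  have "f \<noteq> 0" using Suc.hyps(2) by fastforce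
  then have "f1 \<noteq> 0" using f1 by auto
  then have "degree f = Suc (degree f1)" unfolding f1 by (subst degree_mult_eq) auto
  then have deg: "d = degree f1" using Suc.hyps(2) by simp
  have 1: "int_coeffs (f1 * g)"
    using Suc.prems unfolding f1 mult.assoc by (rule int_coeffs_div_linear)
  \<comment> \<open>Both f1 * g and r f1 * g turn out integral, so the induction hypothesis applies
    to f1 and, if r is not 0, to r f1 of the same degree. The coefficients of f are differences of
    coefficients of x f1 and r f1.\<close>
  have "smult r f1 * g = monom 1 1 * (f1 * g) - f * g"
    unfolding f1 by (simp add: monom_altdef algebra_simps)
  moreover have "int_coeffs (monom 1 1 * (f1 * g))"
    by (rule int_coeffs_mult[OF int_coeffs_monom[OF int_imp_algebraic_int] 1]) simp
  ultimately have 2: "int_coeffs (smult r f1 * g)"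
    using Suc.prems int_coeffs_diff by metis
  have A1: "algebraic_int (coeff f1 i * coeff g j)" for i
    using Suc.hyps(1)[OF deg 1] .
  have A2: "algebraic_int (r * coeff f1 i * coeff g j)" for i
  proof (cases "r = 0")
    case False
    then show ?thesis using Suc.hyps(1)[of "smult r f1" i] deg 2 by simp
  qed simp
  have "coeff f i = (if i = 0 then 0 else coeff f1 (i - 1)) - r * coeff f1 i"
    unfolding f1 by (cases i) auto
  then show ?case
    using A1 A2 by (auto simp: left_diff_distrib intro!: algebraic_int_diff_complex)
qed

section \<open>Subfields of the complex numbers\<close>

lemma complex_field: "field complex_ring" by (rule class_field.field_axioms)
lemma complex_domain: "domain complex_ring" by (rule field.axioms(1)[OF complex_field])
lemma complex_cring: "cring complex_ring" by (rule domain.axioms(1)[OF complex_domain])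
lemma complex_is_ring: "ring complex_ring" by (rule cring.axioms(1)[OF complex_cring])

abbreviation is_subfield :: "complex set \<Rightarrow> bool" where
  "is_subfield k \<equiv> subfield k complex_ring"

context
  fixes k :: "complex set"
  assumes k: "is_subfield k"
begin

lemma subfield_0: "0 \<in> k"
  using subringE(2)[OF subfieldE(1)[OF k]] by simp
lemma subfield_1: "1 \<in> k"
  using subringE(3)[OF subfieldE(1)[OF k]] by simp
lemma subfield_add: "x \<in> k \<Longrightarrow> y \<in> k \<Longrightarrow> x + y \<in> k"
  using subringE(7)[OF subfieldE(1)[OF k]] by simp
lemma subfield_mult: "x \<in> k \<Longrightarrow> y \<in> k \<Longrightarrow> x * y \<in> k"
  using subringE(6)[OF subfieldE(1)[OF k]] by simp
lemma subfield_uminus: "x \<in> k \<Longrightarrow> - x \<in> k"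
  using subringE(5)[OF subfieldE(1)[OF k]] by (simp add: class_ring_simps)
lemma subfield_diff: "x \<in> k \<Longrightarrow> y \<in> k \<Longrightarrow> x - y \<in> k"
  using subfield_add[of x "- y"] subfield_uminus[of y] by simp
lemma subfield_inverse: "x \<in> k \<Longrightarrow> inverse x \<in> k"
  using ring.subfield_m_inv(1)[OF complex_is_ring k, of x] subfield_0
  by (cases "x = 0") (auto simp: class_ring_simps)
lemma subfield_divide: "x \<in> k \<Longrightarrow> y \<in> k \<Longrightarrow> x / y \<in> k"
  by (simp add: divide_inverse subfield_mult subfield_inverse)
lemma subfield_power: "x \<in> k \<Longrightarrow> x ^ n \<in> k"
  by (induction n) (auto intro: subfield_1 subfield_mult)
lemma subfield_sum: "(\<And>i. i \<in> I \<Longrightarrow> f i \<in> k) \<Longrightarrow> sum f I \<in> k"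
  by (induction I rule: infinite_finite_induct) (auto intro: subfield_0 subfield_add)
lemma subfield_of_nat: "of_nat n \<in> k"
  by (induction n) (auto intro: subfield_0 subfield_1 subfield_add)
lemma subfield_of_int: "of_int n \<in> k"
  by (cases n) (auto intro: subfield_of_nat subfield_uminus simp del: of_nat_Suc)
lemma Rats_subset_subfield: "\<rat> \<subseteq> k"
proof
  fix x :: complex assume "x \<in> \<rat>"
  then obtain a b where "x = of_int a / of_int b" by (metis Rats_cases')
  then show "x \<in> k" by (simp add: subfield_divide subfield_of_int)
qed

lemmas subfield_simps = subfield_0 subfield_1 subfield_add subfield_mult subfield_uminus
  subfield_diff subfield_inverse subfield_divide subfield_power subfield_of_nat subfield_of_int

end

lemma is_subfieldI:
  assumes "1 \<in> k" "\<And>x y. x \<in> k \<Longrightarrow> y \<in> k \<Longrightarrow> x - y \<in> k"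
    "\<And>x y. x \<in> k \<Longrightarrow> y \<in> k \<Longrightarrow> x * y \<in> k" "\<And>x. x \<in> k \<Longrightarrow> x \<noteq> 0 \<Longrightarrow> inverse x \<in> k"
  shows "is_subfield k"
proof (rule field.subfieldI'[OF complex_field])
  have 0: "0 \<in> k" using assms(2)[OF assms(1) assms(1)] by simp
  have um: "- x \<in> k" if "x \<in> k" for x using assms(2)[OF 0 that] by simp
  show "subring k complex_ring"
    by (rule ring.subringI[OF complex_is_ring])
      (use assms um assms(2)[OF _ um] in \<open>auto simp: class_ring_simps\<close>)
  show "inv\<^bsub>complex_ring\<^esub> x \<in> k" if "x \<in> k - {\<zero>\<^bsub>complex_ring\<^esub>}" for x
    using that assms(4) by (simp add: class_ring_simps)
qed

lemma is_subfield_Rats: "is_subfield \<rat>"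
  by (rule is_subfieldI) auto

subsection \<open>Dimension and bases\<close>

text \<open>The coefficients are functions on all of \<open>nat\<close> with values in k, of which
  only the indices below \<open>length us\<close> enter; this avoids carrying lengths of coefficient
  lists. \<open>is_basis_iff\<close> links the notion to independence and spans of lists, hence to
  \<open>degree_eq\<close>.\<close>

definition is_basis :: "complex set \<Rightarrow> complex set \<Rightarrow> complex list \<Rightarrow> bool" where
  "is_basis k V us \<longleftrightarrow> set us \<subseteq> V \<and>
     (\<forall>x\<in>V. \<exists>c. (\<forall>i. c i \<in> k) \<and> x = (\<Sum>i<length us. c i * us ! i)) \<and>
     (\<forall>c. (\<forall>i. c i \<in> k) \<and> (\<Sum>i<length us. c i * us ! i) = 0 \<longrightarrow> (\<forall>i<length us. c i = 0))"

lemma combine_eq_sum: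
  "length cs = length us \<Longrightarrow> ring.combine complex_ring cs us = (\<Sum>i<length us. cs ! i * us ! i)"
proof (induction cs us rule: list_induct2)
  case Nil
  then show ?case by (simp add: ring.combine.simps[OF complex_is_ring])
next
  case (Cons c cs u us)
  have "(\<Sum>i<length (u # us). (c # cs) ! i * (u # us) ! i) = c * u + (\<Sum>i<length us. cs ! i * us ! i)"
    by (simp add: sum.lessThan_Suc_shift del: sum.lessThan_Suc)
  then show ?case using Cons by (simp add: ring.combine.simps[OF complex_is_ring])
qed

lemma Span_eq_sums:
  assumes "is_subfield k"
  shows "ring.Span complex_ring k us = {x. \<exists>c. (\<forall>i. c i \<in> k) \<and> x = (\<Sum>i<length us. c i * us ! i)}"
proof -
  have "x \<in> ring.Span complex_ring k us \<longleftrightarrow>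
        (\<exists>cs. set cs \<subseteq> k \<and> length cs = length us \<and> x = ring.combine complex_ring cs us)" for x
    using ring.Span_mem_iff_length_version[OF complex_is_ring assms, of us x] by simp
  also have "\<dots> x \<longleftrightarrow> (\<exists>c. (\<forall>i. c i \<in> k) \<and> x = (\<Sum>i<length us. c i * us ! i))" for x
  proof
    assume "\<exists>cs. set cs \<subseteq> k \<and> length cs = length us \<and> x = ring.combine complex_ring cs us"
    then obtain cs where cs: "set cs \<subseteq> k" "length cs = length us" "x = ring.combine complex_ring cs us"
      by blast
    have "\<forall>i. (if i < length us then cs ! i else 0) \<in> k"
      using cs subfield_0[OF assms] by auto
    moreover have "x = (\<Sum>i<length us. (if i < length us then cs ! i else 0) * us ! i)"
      using cs combine_eq_sum by simp
    ultimately show "\<exists>c. (\<forall>i. c i \<in> k) \<and> x = (\<Sum>i<length us. c i * us ! i)"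
      by (intro exI[of _ "\<lambda>i. if i < length us then cs ! i else 0"]) blast
  next
    assume "\<exists>c. (\<forall>i. c i \<in> k) \<and> x = (\<Sum>i<length us. c i * us ! i)"
    then obtain c where c: "\<forall>i. c i \<in> k" "x = (\<Sum>i<length us. c i * us ! i)" by blast
    then show "\<exists>cs. set cs \<subseteq> k \<and> length cs = length us \<and> x = ring.combine complex_ring cs us"
      by (intro exI[of _ "map c [0..<length us]"]) (auto simp: combine_eq_sum)
  qed
  finally show ?thesis by blast
qed

lemma independent_iff:
  assumes k: "is_subfield k"
  shows "ring.independent complex_ring k us \<longleftrightarrow>
     (\<forall>c. (\<forall>i. c i \<in> k) \<and> (\<Sum>i<length us. c i * us ! i) = 0 \<longrightarrow> (\<forall>i<length us. c i = 0))"
proof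
  assume ind: "ring.independent complex_ring k us"
  show "\<forall>c. (\<forall>i. c i \<in> k) \<and> (\<Sum>i<length us. c i * us ! i) = 0 \<longrightarrow> (\<forall>i<length us. c i = 0)"
  proof (intro allI impI, elim conjE)
    fix c i assume c: "\<forall>i. c i \<in> k" "(\<Sum>i<length us. c i * us ! i) = 0" and i: "i < length us"
    have "ring.combine complex_ring (map c [0..<length us]) us = \<zero>\<^bsub>complex_ring\<^esub>"
      using c by (simp add: combine_eq_sum)
    then have "set (take (length us) (map c [0..<length us])) \<subseteq> {0}"
      using ring.independent_imp_trivial_combine[OF complex_is_ring k ind, of "map c [0..<length us]"] c(1)
      by auto
    then show "c i = 0" using i by (auto simp: image_subset_iff)
  qed
next
  assume *: "\<forall>c. (\<forall>i. c i \<in> k) \<and> (\<Sum>i<length us. c i * us ! i) = 0 \<longrightarrow> (\<forall>i<length us. c i = 0)"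
  show "ring.independent complex_ring k us"
  proof (rule ccontr)
    assume "\<not> ring.independent complex_ring k us"
    then obtain cs where cs: "length cs = length us" "ring.combine complex_ring cs us = 0" "set cs \<subseteq> k" "set cs \<noteq> {0}"
      using ring.dependent_imp_non_trivial_combine[OF complex_is_ring k, of us] by auto
    have "us \<noteq> []"
      using \<open>\<not> ring.independent complex_ring k us\<close> ring.independent.li_Nil[OF complex_is_ring] by auto
    have "\<forall>i. (if i < length us then cs ! i else 0) \<in> k"
      using cs(1,3) subfield_0[OF k] by (auto simp: subset_iff)
    moreover have "(\<Sum>i<length us. (if i < length us then cs ! i else 0) * us ! i) = 0"
      using cs combine_eq_sum by simp
    ultimately have "\<forall>i<length us. (if i < length us then cs ! i else 0) = 0"
      using *[rule_format, of "\<lambda>i. if i < length us then cs ! i else 0"] by blast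
    then have "\<forall>i<length us. cs ! i = 0" by simp
    then have "set cs \<subseteq> {0}" using cs(1) by (metis in_set_conv_nth singletonI subsetI)
    moreover have "set cs \<noteq> {}" using cs(1) \<open>us \<noteq> []\<close> by auto
    ultimately show False using cs(4) by (metis subset_singletonD)
  qed
qed

lemma is_basis_iff:
  assumes k: "is_subfield k" and V: "\<And>c us. (\<forall>i. c i \<in> k) \<Longrightarrow> set us \<subseteq> V \<Longrightarrow> (\<Sum>i<length us. c i * us ! i) \<in> V"
  shows "is_basis k V us \<longleftrightarrow> ring.independent complex_ring k us \<and> ring.Span complex_ring k us = V"
proof -
  have "set us \<subseteq> ring.Span complex_ring k us"
    using ring.Span_base_incl[OF complex_is_ring k, of us] by simp
  then have "ring.Span complex_ring k us = V \<longleftrightarrow>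
      set us \<subseteq> V \<and> (\<forall>x\<in>V. \<exists>c. (\<forall>i. c i \<in> k) \<and> x = (\<Sum>i<length us. c i * us ! i))"
    using V[of _ us] unfolding Span_eq_sums[OF k, of us] by blast
  then show ?thesis
    unfolding is_basis_def independent_iff[OF k] by blast
qed

lemma degree_eq_iff_basis:
  assumes k: "is_subfield k" and V: "\<And>c us. (\<forall>i. c i \<in> k) \<Longrightarrow> set us \<subseteq> V \<Longrightarrow> (\<Sum>i<length us. c i * us ! i) \<in> V"
  shows "degree_eq k V n \<longleftrightarrow> (\<exists>us. is_basis k V us \<and> length us = n)"
  using is_basis_iff[OF k V] ring.exists_base[OF complex_is_ring k] ring.dimensionI[OF complex_is_ring k]
  by metis

lemma degree_eq_unique:
  "is_subfield k \<Longrightarrow> degree_eq k V n \<Longrightarrow> degree_eq k V m \<Longrightarrow> n = m"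
  using ring.dimension_is_inj[OF complex_is_ring] .

text \<open>The degree is not a parameter of the relation: once embeddings are available, it is
  written as \<open>card (embeddings k K)\<close>.\<close>

definition finite_ext :: "complex set \<Rightarrow> complex set \<Rightarrow> bool" where
  "finite_ext k K \<longleftrightarrow> is_subfield k \<and> is_subfield K \<and> k \<subseteq> K \<and> (\<exists>n. degree_eq k K n)"

lemma subfield_sum_mult:
  assumes "is_subfield K" "k \<subseteq> K" "\<forall>i. c i \<in> k" "set us \<subseteq> K"
  shows "(\<Sum>i<length us. c i * us ! i) \<in> K"
  using assms by (intro subfield_sum subfield_mult) auto

lemma finite_ext_basis:
  assumes "finite_ext k K"
  shows "degree_eq k K n \<longleftrightarrow> (\<exists>us. is_basis k K us \<and> length us = n)"
  using assms subfield_sum_mult unfolding finite_ext_def by (intro degree_eq_iff_basis) blast+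

lemma finite_ext_trans:
  assumes "finite_ext k F" "finite_ext F K" shows "finite_ext k K"
  using assms ring.telescopic_base[OF complex_is_ring, of k F] unfolding finite_ext_def by blast

lemma degree_eq_mult:
  assumes "finite_ext k F" "finite_ext F K" "degree_eq k F m" "degree_eq F K n" shows "degree_eq k K (m * n)"
  using assms ring.telescopic_base[OF complex_is_ring, of k F] unfolding finite_ext_def by blast

text \<open>A basis of K over k still spans K over F, and the span of a finite list has finite
  dimension.\<close>

lemma finite_ext_base_change:
  assumes kK: "finite_ext k K" and F: "is_subfield F" "k \<subseteq> F" "F \<subseteq> K"
  shows "finite_ext F K"
proof -
  obtain us where us: "is_basis k K us"
    using kK finite_ext_basis[OF kK] unfolding finite_ext_def by blast
  have K: "is_subfield K" using kK by (simp add: finite_ext_def)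
  have "ring.Span complex_ring F us = K"
  proof
    show "ring.Span complex_ring F us \<subseteq> K"
      using subfield_sum_mult[OF K F(3)] us unfolding Span_eq_sums[OF F(1)] is_basis_def by blast
    show "K \<subseteq> ring.Span complex_ring F us"
      using us F(2) unfolding Span_eq_sums[OF F(1)] is_basis_def by blast
  qed
  moreover have "ring.finite_dimension complex_ring F (ring.Span complex_ring F us)"
    using ring.Span_finite_dimension[OF complex_is_ring F(1)] by simp
  ultimately show ?thesis
    using F K by (simp add: finite_ext_def ring.finite_dimension_def[OF complex_is_ring])
qed

lemma subalgebra_complexI:
  assumes "is_subfield F" "k \<subseteq> F"
  shows "subalgebra k F complex_ring"
proof -
  have "subgroup F (add_monoid complex_ring)"
    using subring.axioms(1)[OF subfieldE(1)[OF assms(1)]] .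
  then show ?thesis
    using assms subfield_mult[OF assms(1)] by (auto simp: subalgebra_def subalgebra_axioms_def)
qed

lemma finite_ext_intermediate:
  assumes kK: "finite_ext k K" and F: "is_subfield F" "k \<subseteq> F" "F \<subseteq> K"
  shows "finite_ext k F"
  using ring.subalbegra_incl_imp_finite_dimension[OF complex_is_ring _ _ subalgebra_complexI[OF F(1,2)] F(3)]
    kK F unfolding finite_ext_def ring.finite_dimension_def[OF complex_is_ring] by blast

lemma finite_ext_refl: "is_subfield k \<Longrightarrow> finite_ext k k"
  using ring.dimension_one[OF complex_is_ring, of k] by (auto simp: finite_ext_def)

subsection \<open>Polynomials over a subfield\<close>

definition polys :: "complex set \<Rightarrow> complex poly set" where
  "polys k = {p. \<forall>i. coeff p i \<in> k}"

context
  fixes k :: "complex set"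
  assumes k: "is_subfield k"
begin

lemma polys_0: "0 \<in> polys k" by (simp add: polys_def subfield_0[OF k])
lemma polys_1: "1 \<in> polys k" by (simp add: polys_def subfield_0[OF k] subfield_1[OF k] coeff_1)
lemma polys_add: "p \<in> polys k \<Longrightarrow> q \<in> polys k \<Longrightarrow> p + q \<in> polys k"
  by (simp add: polys_def subfield_add[OF k])
lemma polys_diff: "p \<in> polys k \<Longrightarrow> q \<in> polys k \<Longrightarrow> p - q \<in> polys k"
  by (simp add: polys_def subfield_diff[OF k])
lemma polys_mult: "p \<in> polys k \<Longrightarrow> q \<in> polys k \<Longrightarrow> p * q \<in> polys k"
  by (simp add: polys_def coeff_mult subfield_sum[OF k] subfield_mult[OF k])
lemma polys_smult: "c \<in> k \<Longrightarrow> q \<in> polys k \<Longrightarrow> Polynomial.smult c q \<in> polys k"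
  by (simp add: polys_def subfield_mult[OF k])
lemma polys_monom: "c \<in> k \<Longrightarrow> monom c n \<in> polys k"
  by (simp add: polys_def subfield_0[OF k])
lemma polys_pCons: "c \<in> k \<Longrightarrow> p \<in> polys k \<Longrightarrow> pCons c p \<in> polys k"
  by (simp add: polys_def coeff_pCons split: nat.split)
lemma polys_pderiv: "p \<in> polys k \<Longrightarrow> pderiv p \<in> polys k"
  by (simp add: polys_def coeff_pderiv subfield_mult[OF k] subfield_of_nat[OF k] del: of_nat_Suc)
lemma poly_in_subfield: "p \<in> polys k \<Longrightarrow> x \<in> k \<Longrightarrow> poly p x \<in> k"
  by (simp add: polys_def poly_altdef subfield_sum[OF k] subfield_mult[OF k] subfield_power[OF k])
lemma polys_pcompose: 
  assumes "p \<in> polys k" "q \<in> polys k" shows "pcompose p q \<in> polys k"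
proof -
  have "(\<forall>i. coeff p i \<in> k) \<longrightarrow> pcompose p q \<in> polys k"
  proof (induction p)
    case (pCons a p)
    show ?case
    proof
      assume *: "\<forall>i. coeff (pCons a p) i \<in> k"
      then have "a \<in> k" "\<forall>i. coeff p i \<in> k"
        by (metis coeff_pCons_0, metis coeff_pCons_Suc)
      then show "pcompose (pCons a p) q \<in> polys k"
        using pCons assms by (simp add: pcompose_pCons polys_add polys_mult polys_pCons polys_0)
    qed
  qed (simp add: polys_0)
  then show ?thesis using assms(1) by (simp add: polys_def)
qed

text \<open>Long division by a monic polynomial never leaves the field of coefficients; this keeps
  quotient and remainder in \<open>polys k\<close>.\<close>

lemma polys_division:
  assumes "p \<in> polys k" "m \<in> polys k" "lead_coeff m = 1"
  shows "\<exists>q r. q \<in> polys k \<and> r \<in> polys k \<and> p = q * m + r \<and> (r = 0 \<or> degree r < degree m)"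
  using assms(1)
proof (induction "degree p" arbitrary: p rule: less_induct)
  case less
  show ?case
  proof (cases "p = 0 \<or> degree p < degree m")
    case True
    then show ?thesis using less.prems polys_0 by (intro exI[of _ 0] exI[of _ p]) auto
  next
    case False
    define s where "s = monom (lead_coeff p) (degree p - degree m)"
    have s: "s \<in> polys k" using less.prems unfolding s_def by (intro polys_monom) (simp add: polys_def)
    define p' where "p' = p - s * m"
    have p': "p' \<in> polys k" using less.prems s assms by (simp add: p'_def polys_diff polys_mult)
    have s0: "s \<noteq> 0" using False by (simp add: s_def monom_eq_0_iff)
    have m0: "m \<noteq> 0" using assms(3) by auto
    have deg: "degree (s * m) = degree p"
      using False s0 m0 by (simp add: degree_mult_eq) (simp add: s_def degree_monom_eq)
    have lc: "lead_coeff (s * m) = lead_coeff p"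
      unfolding lead_coeff_mult assms(3) using False by (simp add: s_def degree_monom_eq)
    show ?thesis
    proof (cases "p' = 0")
      case True
      then show ?thesis using s polys_0 by (intro exI[of _ s] exI[of _ 0]) (auto simp: p'_def)
    next
      case p0: False
      have "coeff p' (degree p) = 0" using deg lc by (simp add: p'_def)
      moreover have "degree p' \<le> degree p" using deg by (auto simp: p'_def intro: degree_diff_le)
      ultimately have "degree p' < degree p"
        using p0 by (metis le_neq_implies_less leading_coeff_0_iff)
      from less.hyps[OF this p'] obtain q r where
        "q \<in> polys k" "r \<in> polys k" "p' = q * m + r" "r = 0 \<or> degree r < degree m" by blast
      then show ?thesis
        using s by (intro exI[of _ "q + s"] exI[of _ r]) (auto simp: polys_add p'_def algebra_simps)
    qed
  qed
qed

end

lemma polys_mono: "k \<subseteq> F \<Longrightarrow> polys k \<subseteq> polys F"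
  by (auto simp: polys_def)

definition algebraic_over :: "complex set \<Rightarrow> complex \<Rightarrow> bool" where
  "algebraic_over k x \<longleftrightarrow> (\<exists>p\<in>polys k. p \<noteq> 0 \<and> poly p x = 0)"

definition min_poly :: "complex set \<Rightarrow> complex \<Rightarrow> complex poly \<Rightarrow> bool" where
  "min_poly k x m \<longleftrightarrow> m \<in> polys k \<and> lead_coeff m = 1 \<and> poly m x = 0 \<and>
     (\<forall>p\<in>polys k. p \<noteq> 0 \<and> poly p x = 0 \<longrightarrow> degree m \<le> degree p)"

lemma ex_min_poly:
  assumes k: "is_subfield k" and x: "algebraic_over k x"
  obtains m where "min_poly k x m"
proof -
  define P where "P = (\<lambda>p. p \<in> polys k \<and> p \<noteq> 0 \<and> poly p x = 0)"
  obtain q where q: "P q" using x by (auto simp: algebraic_over_def P_def)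
  define p where "p = arg_min degree P"
  have p: "P p" and le: "\<And>q. P q \<Longrightarrow> degree p \<le> degree q"
    using arg_min_natI[of P q degree] arg_min_nat_le[of P _ degree] q by (auto simp: p_def)
  define m where "m = Polynomial.smult (inverse (lead_coeff p)) p"
  have "min_poly k x m"
    unfolding min_poly_def
  proof (intro conjI ballI impI)
    show "m \<in> polys k"
      unfolding m_def using p by (intro polys_smult k subfield_inverse) (auto simp: P_def polys_def)
    show "lead_coeff m = 1" "poly m x = 0" using p by (auto simp: m_def P_def)
    fix r assume "r \<in> polys k" "r \<noteq> 0 \<and> poly r x = 0"
    then show "degree m \<le> degree r" using le[of r] p by (auto simp: P_def m_def)
  qed
  then show ?thesis using that by blast
qed

lemma min_poly_dvd:
  assumes k: "is_subfield k" and m: "min_poly k x m" and p: "p \<in> polys k" "poly p x = 0"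
  obtains q where "q \<in> polys k" "p = q * m"
proof -
  obtain q r where qr: "q \<in> polys k" "r \<in> polys k" "p = q * m + r" "r = 0 \<or> degree r < degree m"
    using polys_division[OF k p(1), of m] m by (auto simp: min_poly_def)
  have "poly r x = 0" using p(2) m qr(3) by (simp add: min_poly_def)
  then have "r = 0" using qr m by (auto simp: min_poly_def not_le[symmetric])
  then show ?thesis using qr that by simp
qed

text \<open>Write m = q m' with m' the minimal polynomial of z. Then x is a root of m' or of q.
  Minimality of m gives degree m \<le> degree m' in the first case, and in the second makes m'
  constant, which is absurd.\<close>

lemma min_poly_of_root:
  assumes k: "is_subfield k" and m: "min_poly k x m" and z: "poly m z = 0"
  shows "min_poly k z m"
proof -
  have mk: "m \<in> polys k" "lead_coeff m = 1" "poly m x = 0" using m by (auto simp: min_poly_def)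
  have m0: "m \<noteq> 0" using mk by auto
  have "algebraic_over k z" using mk z m0 by (auto simp: algebraic_over_def)
  then obtain m' where m': "min_poly k z m'" using ex_min_poly[OF k] by blast
  then obtain q where q: "q \<in> polys k" "m = q * m'" using min_poly_dvd[OF k m' mk(1) z] by blast
  have nz: "q \<noteq> 0" "m' \<noteq> 0" using q m0 by auto
  have deg: "degree m = degree q + degree m'" using q nz by (simp add: degree_mult_eq)
  have "degree m \<le> degree m'"
  proof (cases "poly m' x = 0")
    case True
    then show ?thesis using m m' nz by (auto simp: min_poly_def)
  next
    case False
    then have "poly q x = 0" using mk q by simp
    then have "degree m \<le> degree q" using m q nz by (auto simp: min_poly_def)
    then have "degree m' = 0" using deg by simp
    then obtain c where "m' = [:c:]" by (metis degree_eq_zeroE)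
    then show ?thesis using m' by (auto simp: min_poly_def)
  qed
  then show ?thesis
    using m' mk z by (auto simp: min_poly_def intro: order_trans)
qed

lemma min_poly_degree_pos:
  assumes "min_poly k x m" shows "degree m > 0"
proof (rule ccontr)
  assume "\<not> degree m > 0"
  then obtain c where "m = [:c:]" by (metis degree_eq_zeroE gr0I)
  then show False using assms by (auto simp: min_poly_def)
qed

text \<open>Separability in characteristic 0: m is also the minimal polynomial of z, and its
  derivative is nonzero of smaller degree.\<close>

lemma min_poly_simple_root:
  assumes k: "is_subfield k" and m: "min_poly k x m" and z: "poly m z = 0"
  shows "poly (pderiv m) z \<noteq> 0"
proof
  assume *: "poly (pderiv m) z = 0"
  have mz: "min_poly k z m" using min_poly_of_root[OF assms] .
  have "pderiv m \<noteq> 0" using min_poly_degree_pos[OF m] by (simp add: pderiv_eq_0_iff)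
  then have "degree m \<le> degree (pderiv m)"
    using mz * polys_pderiv[OF k] by (auto simp: min_poly_def)
  then show False using min_poly_degree_pos[OF m] by (simp add: degree_pderiv)
qed

lemma card_roots_min_poly:
  assumes k: "is_subfield k" and m: "min_poly k x m"
  shows "card {z. poly m z = 0} = degree m"
proof -
  have "rsquarefree m" using min_poly_simple_root[OF assms] by (auto simp: rsquarefree_roots)
  have m0: "m \<noteq> 0" using m by (auto simp: min_poly_def)
  have "degree m = degree (Polynomial.smult (lead_coeff m) (\<Prod>z|poly m z = 0. [:- z, 1:]))"
    using complex_poly_decompose_rsquarefree[OF \<open>rsquarefree m\<close>] by simp
  also have "\<dots> = (\<Sum>z|poly m z = 0. degree [:- z, 1:])"
    using m0 by (simp add: degree_prod_eq_sum_degree)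
  also have "\<dots> = card {z. poly m z = 0}" by simp
  finally show ?thesis by simp
qed

subsection \<open>Simple extensions\<close>

abbreviation adjoin :: "complex set \<Rightarrow> complex \<Rightarrow> complex set" where
  "adjoin k x \<equiv> ring.simple_extension complex_ring k x"

lemma adjoin_eq:
  assumes k: "is_subfield k"
  shows "adjoin k x = {poly p x | p. p \<in> polys k}"
proof (intro equalityI subsetI)
  fix y assume "y \<in> adjoin k x"
  then show "y \<in> {poly p x | p. p \<in> polys k}"
  proof (induction rule: ring.simple_extension.induct[OF complex_is_ring, consumes 1])
    case 1
    then show ?case using polys_0[OF k] by force
  next
    case (2 k1 k2)
    then obtain p where p: "k1 = poly p x" "p \<in> polys k" by auto
    then have "k1 * x + k2 = poly (pCons k2 p) x" by (simp add: mult.commute)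
    then show ?case using polys_pCons[OF k] p 2 by force
  qed
next
  fix y assume "y \<in> {poly p x | p. p \<in> polys k}"
  then obtain p where p: "y = poly p x" "\<forall>i. coeff p i \<in> k" by (auto simp: polys_def)
  have "(\<forall>i. coeff p i \<in> k) \<longrightarrow> poly p x \<in> adjoin k x"
  proof (induction p)
    case 0
    then show ?case using ring.simple_extension.zero[OF complex_is_ring, of k x] by simp
  next
    case (pCons a p)
    show ?case
    proof
      assume *: "\<forall>i. coeff (pCons a p) i \<in> k"
      then have "a \<in> k" "\<forall>i. coeff p i \<in> k"
        by (metis coeff_pCons_0, metis coeff_pCons_Suc)
      then show "poly (pCons a p) x \<in> adjoin k x"
        using ring.simple_extension.lin[OF complex_is_ring, of "poly p x" k x a] pCons
        by (simp add: mult.commute add.commute)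
    qed
  qed
  then show "y \<in> adjoin k x" using p by simp
qed

lemma adjoin_basis:
  assumes k: "is_subfield k" and m: "min_poly k x m"
  shows "is_basis k (adjoin k x) (map (\<lambda>i. x ^ i) [0..<degree m])"
  unfolding is_basis_def
proof (intro conjI ballI allI impI; (elim conjE)?)
  show "set (map (\<lambda>i. x ^ i) [0..<degree m]) \<subseteq> adjoin k x"
  proof
    fix y assume "y \<in> set (map (\<lambda>i. x ^ i) [0..<degree m])"
    then obtain i where "y = x ^ i" by auto
    then have "y = poly (monom 1 i) x" by (simp add: poly_monom)
    then show "y \<in> adjoin k x"
      unfolding adjoin_eq[OF k] using polys_monom[OF k subfield_1[OF k]] by blast
  qed
next
  fix y assume "y \<in> adjoin k x"
  then obtain p where p: "p \<in> polys k" "y = poly p x" by (auto simp: adjoin_eq[OF k])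
  have m': "m \<in> polys k" "lead_coeff m = 1" "poly m x = 0" using m by (auto simp: min_poly_def)
  obtain q r where qr: "q \<in> polys k" "r \<in> polys k" "p = q * m + r" "r = 0 \<or> degree r < degree m"
    using polys_division[OF k p(1) m'(1,2)] by blast
  have "y = poly r x" using p qr m' by simp
  also have "\<dots> = (\<Sum>i<degree m. coeff r i * x ^ i)"
  proof -
    have "poly r x = (\<Sum>i\<le>degree r. coeff r i * x ^ i)" by (simp add: poly_altdef)
    also have "\<dots> = (\<Sum>i<degree m. coeff r i * x ^ i)"
    proof (cases "r = 0")
      case False
      then show ?thesis
        using qr(4) by (intro sum.mono_neutral_left) (auto simp: coeff_eq_0)
    qed simp
    finally show ?thesis .
  qed
  finally show "\<exists>c. (\<forall>i. c i \<in> k) \<and> y = (\<Sum>i<length (map (\<lambda>i. x ^ i) [0..<degree m]). c i * map (\<lambda>i. x ^ i) [0..<degree m] ! i)"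
    using qr(2) by (intro exI[of _ "coeff r"]) (auto simp: polys_def)
next
  fix c i
  assume c: "\<forall>i. c i \<in> k"
    and sum: "(\<Sum>i<length (map (\<lambda>i. x ^ i) [0..<degree m]). c i * map (\<lambda>i. x ^ i) [0..<degree m] ! i) = 0"
    and i: "i < length (map (\<lambda>i. x ^ i) [0..<degree m])"
  define p where "p = (\<Sum>i<degree m. monom (c i) i)"
  have cp: "coeff p i = (if i < degree m then c i else 0)" for i by (simp add: p_def coeff_sum)
  have pk: "p \<in> polys k" using c subfield_0[OF k] by (simp add: polys_def cp)
  have "poly p x = 0" using sum by (simp add: p_def poly_sum poly_monom)
  moreover have "degree p < degree m"
    using min_poly_degree_pos[OF m] by (intro degree_lessI) (auto simp: cp)
  ultimately have "p = 0" using m pk by (auto simp: min_poly_def not_le[symmetric])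
  then show "c i = 0" using cp[of i] i by simp
qed

text \<open>The algebraic theory stores polynomials as lists with the leading coefficient first,
  whereas \<open>Poly\<close> expects the constant term first.\<close>

lemma poly_of_rev_list:
  "poly (Poly (rev p)) x = ring.eval complex_ring p x"
proof (induction p)
  case Nil
  then show ?case by (simp add: ring.eval.simps[OF complex_is_ring])
next
  case (Cons a p)
  have "poly (Poly (rev (a # p))) x = a * x ^ length p + poly (Poly (rev p)) x"
    by (simp add: Poly_append poly_monom)
  then show ?case using Cons by (simp add: ring.eval.simps[OF complex_is_ring] class_ring_simps)
qed

lemma algebraic_over_iff:
  assumes k: "is_subfield k"
  shows "algebraic_over k x \<longleftrightarrow> ring.algebraic complex_ring k x"
proof
  assume "algebraic_over k x"
  then obtain p where p: "p \<in> polys k" "p \<noteq> 0" "poly p x = 0" by (auto simp: algebraic_over_def)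
  define ps where "ps = rev (coeffs p)"
  have ne: "coeffs p \<noteq> []" using p by simp
  have "ps \<in> carrier (univ_poly complex_ring k)"
    using p ne by (auto simp: univ_poly_def polynomial_def ps_def polys_def coeffs_def hd_rev last_coeffs_eq_coeff_degree)
  moreover have "ps \<noteq> []" using ne by (simp add: ps_def)
  moreover have "ring.eval complex_ring ps x = 0"
    using p by (simp add: ps_def flip: poly_of_rev_list)
  ultimately show "ring.algebraic complex_ring k x"
    using ring.algebraicI[OF complex_is_ring, of ps k x] by (simp add: over_def)
next
  assume "ring.algebraic complex_ring k x"
  then obtain ps where ps: "ps \<in> carrier (univ_poly complex_ring k)" "ps \<noteq> []" "ring.eval complex_ring ps x = 0"
    using domain.algebraicE[OF complex_domain subfieldE(1)[OF k], of x] by (auto simp: over_def)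
  have "set ps \<subseteq> k" "hd ps \<noteq> 0" using ps by (auto simp: univ_poly_def polynomial_def)
  have "coeff (Poly (rev ps)) i \<in> k" for i
  proof (cases "i < length ps")
    case True
    then have "rev ps ! i \<in> set ps" by (metis length_rev nth_mem set_rev)
    then show ?thesis
      using True \<open>set ps \<subseteq> k\<close> by (auto simp: coeff_Poly_eq nth_default_def)
  qed (simp add: coeff_Poly_eq nth_default_def subfield_0[OF k])
  then have "Poly (rev ps) \<in> polys k" by (simp add: polys_def)
  moreover have "coeff (Poly (rev ps)) (length ps - 1) = hd ps"
    using ps(2) by (cases ps) (simp_all add: coeff_Poly_eq nth_default_def nth_append)
  then have "Poly (rev ps) \<noteq> 0" using \<open>hd ps \<noteq> 0\<close> by (metis coeff_0)
  ultimately show "algebraic_over k x"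
    using ps(3) by (auto simp: algebraic_over_def poly_of_rev_list intro!: bexI[of _ "Poly (rev ps)"])
qed

lemma finite_ext_algebraic:
  assumes "finite_ext k K" "x \<in> K" shows "algebraic_over k x"
  using assms ring.finite_dimension_imp_algebraic[OF complex_is_ring, of k K x]
  by (auto simp: finite_ext_def algebraic_over_iff ring.finite_dimension_def[OF complex_is_ring] over_def subfieldE(1))

lemma subset_adjoin: "is_subfield k \<Longrightarrow> k \<subseteq> adjoin k x"
  using ring.simple_extension_incl[OF complex_is_ring] by simp

lemma adjoin_self: "is_subfield k \<Longrightarrow> x \<in> adjoin k x"
  by (rule ring.simple_extension_mem[OF complex_is_ring subfieldE(1)]) simp_all

lemma adjoin_subset:
  assumes "is_subfield F" "k \<subseteq> F" "x \<in> F" shows "adjoin k x \<subseteq> F"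
  using ring.simple_extension_subring_incl[OF complex_is_ring subfieldE(1)] assms by simp

lemma is_subfield_adjoin:
  "is_subfield k \<Longrightarrow> algebraic_over k x \<Longrightarrow> is_subfield (adjoin k x)"
  using domain.simple_extension_is_subfield[OF complex_domain, of k x] by (simp add: algebraic_over_iff over_def)

lemma adjoin_finite_ext:
  assumes k: "is_subfield k" and m: "min_poly k x m"
  shows "finite_ext k (adjoin k x)" "degree_eq k (adjoin k x) (degree m)"
proof -
  have "m \<noteq> 0" using m by (auto simp: min_poly_def)
  then have "algebraic_over k x" using m by (auto simp: algebraic_over_def min_poly_def)
  then have F: "is_subfield (adjoin k x)" using is_subfield_adjoin[OF k] by blast
  show "degree_eq k (adjoin k x) (degree m)"
    by (subst degree_eq_iff_basis[OF k subfield_sum_mult[OF F subset_adjoin[OF k]]])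
      (use adjoin_basis[OF k m] in \<open>auto intro!: exI[of _ "map (\<lambda>i. x ^ i) [0..<degree m]"]\<close>)
  then show "finite_ext k (adjoin k x)"
    using k F subset_adjoin[OF k] by (auto simp: finite_ext_def)
qed

lemma finite_ext_adjoin:
  assumes "is_subfield k" "algebraic_over k x" shows "finite_ext k (adjoin k x)"
proof -
  obtain m where "min_poly k x m" using ex_min_poly[OF assms] .
  then show ?thesis by (rule adjoin_finite_ext(1)[OF assms(1)])
qed

lemma finite_ext_degree_le:
  assumes "finite_ext k K" "degree_eq k K n" "x \<in> K" "min_poly k x m" shows "degree m \<le> n"
proof -
  have k: "is_subfield k" and K: "is_subfield K" "k \<subseteq> K" using assms by (auto simp: finite_ext_def)
  have sub: "adjoin k x \<subseteq> K" by (rule adjoin_subset[OF K assms(3)])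
  let ?us = "map (\<lambda>i. x ^ i) [0..<degree m]"
  have b: "is_basis k (adjoin k x) ?us" by (rule adjoin_basis[OF k assms(4)])
  then have "ring.independent complex_ring k ?us"
    unfolding independent_iff[OF k] is_basis_def by blast
  moreover have "set ?us \<subseteq> K" using b sub by (auto simp: is_basis_def)
  ultimately show ?thesis
    using ring.independent_length_le_dimension[OF complex_is_ring k assms(2), of ?us] by simp
qed

text \<open>For all but finitely many \<open>c\<close>, the polynomials \<open>f (\<gamma> - c t)\<close> and \<open>g\<close>, where \<open>f\<close> and \<open>g\<close> are the
  minimal polynomials of \<open>\<alpha>\<close> and \<open>\<beta>\<close> and \<open>\<gamma> = \<alpha> + c \<beta>\<close>, have only the root \<open>\<beta>\<close> in common.\<close>

lemma primitive_element_two: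
  assumes kK: "finite_ext k K" and ab: "\<alpha> \<in> K" "\<beta> \<in> K"
  obtains \<gamma> where "\<gamma> \<in> K" "\<alpha> \<in> adjoin k \<gamma>" "\<beta> \<in> adjoin k \<gamma>"
proof -
  have k: "is_subfield k" and K: "is_subfield K" "k \<subseteq> K" using kK by (auto simp: finite_ext_def)
  obtain f where f: "min_poly k \<alpha> f" using ex_min_poly[OF k finite_ext_algebraic[OF kK ab(1)]] .
  obtain g where g: "min_poly k \<beta> g" using ex_min_poly[OF k finite_ext_algebraic[OF kK ab(2)]] .
  have fg: "f \<in> polys k" "g \<in> polys k" "f \<noteq> 0" "g \<noteq> 0" "poly f \<alpha> = 0" "poly g \<beta> = 0"
    using f g by (auto simp: min_poly_def)
  \<comment> \<open>The value c is bad if \<open>\<gamma> - c * b\<close> equals a root a of f for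
    some root b of g. Pairs with b = \<beta> only contribute 0, by the convention for division by
    zero.\<close>
  define bad where "bad = (\<lambda>(a, b). (a - \<alpha>) / (\<beta> - b)) ` ({z. poly f z = 0} \<times> {z. poly g z = 0})"
  have "finite bad" using fg by (auto simp: bad_def intro!: poly_roots_finite)
  moreover have "infinite (range (of_nat :: nat \<Rightarrow> complex))"
    by (intro range_inj_infinite injI) simp
  ultimately obtain c :: nat where c: "of_nat c \<notin> bad"
    using finite_subset[of "range of_nat" bad] by blast
  define \<gamma> where "\<gamma> = \<alpha> + of_nat c * \<beta>"
  have \<gamma>: "\<gamma> \<in> K" using ab by (simp add: \<gamma>_def subfield_simps[OF K(1)])
  define F where "F = adjoin k \<gamma>"
  have F: "is_subfield F" unfolding F_def by (rule is_subfield_adjoin[OF k finite_ext_algebraic[OF kK \<gamma>]])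
  have kF: "k \<subseteq> F" unfolding F_def by (rule subset_adjoin[OF k])
  have \<gamma>F: "\<gamma> \<in> F" unfolding F_def by (rule adjoin_self[OF k])
  have gF: "g \<in> polys F" and fF: "f \<in> polys F" using polys_mono[OF kF] fg by auto
  define h where "h = pcompose f [:\<gamma>, - of_nat c:]"
  have hF: "h \<in> polys F"
    unfolding h_def by (intro polys_pcompose[OF F] polys_pCons[OF F] polys_0[OF F] fF \<gamma>F) (simp add: subfield_simps[OF F])
  have h: "poly h z = poly f (\<gamma> - of_nat c * z)" for z by (simp add: h_def poly_pcompose mult.commute)
  have "algebraic_over F \<beta>" using gF fg by (auto simp: algebraic_over_def)
  then obtain m where m: "min_poly F \<beta> m" using ex_min_poly[OF F] by blast
  obtain q1 where q1: "g = q1 * m" using min_poly_dvd[OF F m gF] fg by blast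
  obtain q2 where q2: "h = q2 * m" using min_poly_dvd[OF F m hF] fg by (auto simp: h \<gamma>_def)
  have root: "z = \<beta>" if "poly m z = 0" for z
  proof (rule ccontr)
    assume z: "z \<noteq> \<beta>"
    have "poly g z = 0" "poly f (\<gamma> - of_nat c * z) = 0" using that q1 q2 h[of z] by auto
    moreover have "of_nat c = ((\<gamma> - of_nat c * z) - \<alpha>) / (\<beta> - z)"
      using z by (simp add: \<gamma>_def field_simps)
    ultimately have "of_nat c \<in> bad" unfolding bad_def by force
    then show False using c by simp
  qed
  \<comment> \<open>A minimal polynomial has as many roots as its degree, so m is linear and its
    root \<beta> lies in F.\<close>
  have "{z. poly m z = 0} = {\<beta>}" using root m by (auto simp: min_poly_def)
  then have deg: "degree m = 1" using card_roots_min_poly[OF F m] by simp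
  then have "m = [:coeff m 0, 1:]"
    using m by (intro poly_eqI) (auto simp: coeff_pCons min_poly_def coeff_eq_0 split: nat.split)
  moreover have "poly m \<beta> = 0" using m by (simp add: min_poly_def)
  ultimately have "poly [:coeff m 0, 1:] \<beta> = 0" by simp
  then have "coeff m 0 + \<beta> = 0" by simp
  then have "\<beta> = - coeff m 0" by (simp add: eq_neg_iff_add_eq_0 add.commute)
  then have \<beta>F: "\<beta> \<in> F" using m subfield_uminus[OF F] by (auto simp: min_poly_def polys_def)
  have "\<alpha> = \<gamma> - of_nat c * \<beta>" by (simp add: \<gamma>_def)
  then have "\<alpha> \<in> F" using \<beta>F \<gamma>F by (simp add: subfield_simps[OF F])
  then show ?thesis using that[OF \<gamma>] \<beta>F by (simp add: F_def)
qed

text \<open>Take \<theta> in K of maximal degree over k. For x in K there is \<gamma> in K whose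
  field k(\<gamma>) contains both \<theta> and x; its degree is not larger than that of \<theta>, so
  k(\<gamma>) = k(\<theta>) contains x.\<close>

lemma primitive_element:
  assumes kK: "finite_ext k K"
  obtains \<theta> m where "\<theta> \<in> K" "K = adjoin k \<theta>" "min_poly k \<theta> m" "degree_eq k K (degree m)"
proof -
  have k: "is_subfield k" and K: "is_subfield K" "k \<subseteq> K" using kK by (auto simp: finite_ext_def)
  obtain n where n: "degree_eq k K n" using kK by (auto simp: finite_ext_def)
  define D where "D = {d. \<exists>\<theta>\<in>K. \<exists>m. min_poly k \<theta> m \<and> d = degree m}"
  have "D \<subseteq> {..n}" using finite_ext_degree_le[OF kK n] by (auto simp: D_def)
  then have fin: "finite D" by (rule finite_subset) simp
  obtain m0 where "min_poly k 1 m0"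
    using ex_min_poly[OF k finite_ext_algebraic[OF kK subfield_1[OF K(1)]]] .
  then have "D \<noteq> {}" using subfield_1[OF K(1)] by (auto simp: D_def)
  then have "Max D \<in> D" using fin by simp
  then obtain \<theta> m where \<theta>: "\<theta> \<in> K" "min_poly k \<theta> m" "Max D = degree m" by (auto simp: D_def)
  have "K \<subseteq> adjoin k \<theta>"
  proof
    fix x assume x: "x \<in> K"
    obtain \<gamma> where \<gamma>: "\<gamma> \<in> K" "\<theta> \<in> adjoin k \<gamma>" "x \<in> adjoin k \<gamma>"
      using primitive_element_two[OF kK \<theta>(1) x] .
    obtain m' where m': "min_poly k \<gamma> m'" using ex_min_poly[OF k finite_ext_algebraic[OF kK \<gamma>(1)]] .
    have "degree m' \<le> degree m"
      using Max_ge[OF fin, of "degree m'"] m' \<gamma> \<theta>(3) by (auto simp: D_def)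
    moreover have "finite_ext k (adjoin k \<gamma>)" and g: "degree_eq k (adjoin k \<gamma>) (degree m')"
      using adjoin_finite_ext[OF k m'] by auto
    then have "degree m \<le> degree m'" using finite_ext_degree_le \<gamma>(2) \<theta>(2) by blast
    ultimately have eq: "degree m' = degree m" by simp
    have F: "is_subfield (adjoin k \<gamma>)" using \<open>finite_ext k (adjoin k \<gamma>)\<close> by (simp add: finite_ext_def)
    let ?us = "map (\<lambda>i. \<theta> ^ i) [0..<degree m]"
    have sub: "adjoin k \<theta> \<subseteq> adjoin k \<gamma>"
      by (rule adjoin_subset[OF F subset_adjoin[OF k] \<gamma>(2)])
    have b: "is_basis k (adjoin k \<theta>) ?us" by (rule adjoin_basis[OF k \<theta>(2)])
    then have ind: "ring.independent complex_ring k ?us"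
      unfolding independent_iff[OF k] is_basis_def by blast
    have "ring.Span complex_ring k ?us = adjoin k \<gamma>"
      using ring.independent_length_eq_dimension[OF complex_is_ring k g ind] b sub eq
      by (auto simp: is_basis_def)
    moreover have "ring.Span complex_ring k ?us \<subseteq> adjoin k \<theta>"
      using subfield_sum_mult[of "adjoin k \<theta>" k _ ?us] adjoin_finite_ext(1)[OF k \<theta>(2)] b
      unfolding Span_eq_sums[OF k] finite_ext_def is_basis_def by blast
    ultimately show "x \<in> adjoin k \<theta>" using \<gamma>(3) by blast
  qed
  then have "K = adjoin k \<theta>" using adjoin_subset[OF K \<theta>(1)] by blast
  then show ?thesis using that[OF \<theta>(1) _ \<theta>(2)] adjoin_finite_ext(2)[OF k \<theta>(2)] by simp
qed

subsection \<open>Embeddings\<close>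

lemma embeddings_iff:
  "\<tau> \<in> embeddings k K \<longleftrightarrow> \<tau> \<in> extensional K \<and> (\<forall>x\<in>k. \<tau> x = x) \<and> \<tau> 1 = 1 \<and>
     (\<forall>x\<in>K. \<forall>y\<in>K. \<tau> (x + y) = \<tau> x + \<tau> y \<and> \<tau> (x * y) = \<tau> x * \<tau> y)"
  by (auto simp: embeddings_def Ring.ring_hom_def)

context
  fixes k K \<tau>
  assumes K: "is_subfield K" and \<tau>: "\<tau> \<in> embeddings k K"
begin

lemma emb_base: "x \<in> k \<Longrightarrow> \<tau> x = x" using \<tau> by (simp add: embeddings_iff)
lemma emb_1: "\<tau> 1 = 1" using \<tau> by (simp add: embeddings_iff)
lemma emb_add: "x \<in> K \<Longrightarrow> y \<in> K \<Longrightarrow> \<tau> (x + y) = \<tau> x + \<tau> y" using \<tau> by (simp add: embeddings_iff)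
lemma emb_mult: "x \<in> K \<Longrightarrow> y \<in> K \<Longrightarrow> \<tau> (x * y) = \<tau> x * \<tau> y" using \<tau> by (simp add: embeddings_iff)
lemma emb_0: "\<tau> 0 = 0"
  using emb_add[of 0 0] subfield_0[OF K] by simp
lemma emb_uminus: "x \<in> K \<Longrightarrow> \<tau> (- x) = - \<tau> x"
  using emb_add[of x "- x"] emb_0 subfield_uminus[OF K] by (simp add: eq_neg_iff_add_eq_0 add.commute)
lemma emb_diff: "x \<in> K \<Longrightarrow> y \<in> K \<Longrightarrow> \<tau> (x - y) = \<tau> x - \<tau> y"
  using emb_add[of x "- y"] emb_uminus[of y] subfield_uminus[OF K] by simp
lemma emb_sum: "(\<And>i. i \<in> I \<Longrightarrow> f i \<in> K) \<Longrightarrow> \<tau> (sum f I) = (\<Sum>i\<in>I. \<tau> (f i))"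
  by (induction I rule: infinite_finite_induct) (simp_all add: emb_0 emb_add subfield_sum[OF K])
lemma emb_power: "x \<in> K \<Longrightarrow> \<tau> (x ^ n) = \<tau> x ^ n"
  by (induction n) (simp_all add: emb_1 emb_mult subfield_power[OF K])
lemma emb_inverse: "x \<in> K \<Longrightarrow> \<tau> (inverse x) = inverse (\<tau> x)"
proof (cases "x = 0")
  case False
  assume x: "x \<in> K"
  have "\<tau> x * \<tau> (inverse x) = 1"
    using False by (simp add: x subfield_inverse[OF K] emb_1 flip: emb_mult)
  then show ?thesis by (simp add: inverse_unique)
qed (simp add: emb_0)
lemma emb_eq_0_iff: "x \<in> K \<Longrightarrow> \<tau> x = 0 \<longleftrightarrow> x = 0"
proof (cases "x = 0")
  case False
  assume x: "x \<in> K"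
  have "\<tau> x * \<tau> (inverse x) = 1"
    using False by (simp add: x subfield_inverse[OF K] emb_1 flip: emb_mult)
  then show ?thesis using False by auto
qed (simp add: emb_0)
lemma emb_inj: "inj_on \<tau> K"
  by (rule inj_onI) (metis emb_diff emb_eq_0_iff subfield_diff[OF K] eq_iff_diff_eq_0)
lemma emb_poly_map: "p \<in> polys K \<Longrightarrow> x \<in> K \<Longrightarrow> \<tau> (poly p x) = poly (map_poly \<tau> p) (\<tau> x)"
proof -
  assume p: "p \<in> polys K" and x: "x \<in> K"
  have "\<tau> (poly p x) = (\<Sum>i\<le>degree p. \<tau> (coeff p i) * \<tau> x ^ i)"
    using p x by (simp add: poly_altdef emb_sum emb_mult emb_power subfield_mult[OF K] subfield_power[OF K] polys_def)
  also have "\<dots> = (\<Sum>i\<le>degree p. coeff (map_poly \<tau> p) i * \<tau> x ^ i)"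
    by (simp add: coeff_map_poly emb_0)
  also have "\<dots> = poly (map_poly \<tau> p) (\<tau> x)"
    unfolding poly_altdef
    by (rule sum.mono_neutral_right) (auto simp: map_poly_degree_leq coeff_eq_0 not_le)
  finally show ?thesis .
qed
lemma emb_poly: "k \<subseteq> K \<Longrightarrow> p \<in> polys k \<Longrightarrow> x \<in> K \<Longrightarrow> \<tau> (poly p x) = poly p (\<tau> x)"
proof -
  assume "k \<subseteq> K" and p: "p \<in> polys k" and x: "x \<in> K"
  then have "p \<in> polys K" using polys_mono by blast
  moreover have "map_poly \<tau> p = p"
    using p by (intro poly_eqI) (simp add: coeff_map_poly emb_0 emb_base polys_def)
  ultimately show ?thesis using emb_poly_map[of p x] x by simp
qed
lemma emb_of_int: "\<tau> (of_int c) = of_int c"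
proof -
  have "\<tau> (of_nat n) = of_nat n" for n
    by (induction n) (simp_all add: emb_0 emb_1 emb_add subfield_1[OF K] subfield_of_nat[OF K])
  then show ?thesis by (cases c) (simp_all add: emb_uminus subfield_of_nat[OF K] del: of_nat_Suc)
qed
end

lemma emb_ext: "\<tau> \<in> embeddings k K \<Longrightarrow> \<tau>' \<in> embeddings k' K \<Longrightarrow> (\<And>x. x \<in> K \<Longrightarrow> \<tau> x = \<tau>' x) \<Longrightarrow> \<tau> = \<tau>'"
  using extensionalityI[of \<tau> K \<tau>'] by (auto simp: embeddings_iff)

lemma emb_id: "is_subfield K \<Longrightarrow> k \<subseteq> K \<Longrightarrow> (\<lambda>x\<in>K. x) \<in> embeddings k K"
  by (auto simp: embeddings_iff subfield_simps)

lemma emb_restrict: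
  assumes "\<tau> \<in> embeddings k K" "is_subfield F" "F \<subseteq> K" "k \<subseteq> F"
  shows "restrict \<tau> F \<in> embeddings k F"
  using assms by (auto simp: embeddings_iff subfield_simps[OF assms(2)] subset_iff)

lemma emb_base_mono: "k \<subseteq> F \<Longrightarrow> embeddings F K \<subseteq> embeddings k K"
  by (auto simp: embeddings_def)

lemma emb_compose:
  assumes "is_subfield K" "k \<subseteq> K" "\<tau> \<in> embeddings k K" "\<sigma> \<in> embeddings k L" "\<tau> ` K \<subseteq> L"
  shows "compose K \<sigma> \<tau> \<in> embeddings k K"
proof -
  have "\<tau> x \<in> L" if "x \<in> K" for x using assms(5) that by blast
  then show ?thesis
    using assms(2-4) by (auto simp: embeddings_iff compose_def subfield_simps[OF assms(1)] subset_iff)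
qed

lemma embeddings_adjoin:
  assumes k: "is_subfield k" and m: "min_poly k \<theta> m"
  shows "bij_betw (\<lambda>\<tau>. \<tau> \<theta>) (embeddings k (adjoin k \<theta>)) {z. poly m z = 0}"
proof -
  define K where "K = adjoin k \<theta>"
  have K: "is_subfield K" "k \<subseteq> K" and \<theta>: "\<theta> \<in> K"
    using adjoin_finite_ext(1)[OF k m] adjoin_self[OF k] by (auto simp: K_def finite_ext_def)
  have mk: "m \<in> polys k" "poly m \<theta> = 0" using m by (auto simp: min_poly_def)
  have Kp: "\<exists>p\<in>polys k. x = poly p \<theta>" if "x \<in> K" for x
    using that by (auto simp: K_def adjoin_eq[OF k])
  have pK: "poly p \<theta> \<in> K" if "p \<in> polys k" for p
    using that by (auto simp: K_def adjoin_eq[OF k])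
  have "inj_on (\<lambda>\<tau>. \<tau> \<theta>) (embeddings k K)"
  proof (rule inj_onI)
    fix \<tau> \<tau>' assume \<tau>: "\<tau> \<in> embeddings k K" "\<tau>' \<in> embeddings k K" "\<tau> \<theta> = \<tau>' \<theta>"
    show "\<tau> = \<tau>'"
    proof (rule emb_ext[OF \<tau>(1,2)])
      fix x assume "x \<in> K"
      then obtain p where "p \<in> polys k" "x = poly p \<theta>" using Kp by blast
      then show "\<tau> x = \<tau>' x"
        using emb_poly[OF K(1) \<tau>(1) K(2) _ \<theta>] emb_poly[OF K(1) \<tau>(2) K(2) _ \<theta>] \<tau>(3) by simp
    qed
  qed
  moreover have "\<tau> \<theta> \<in> {z. poly m z = 0}" if "\<tau> \<in> embeddings k K" for \<tau>
    using emb_poly[OF K(1) that K(2) mk(1) \<theta>] mk(2) emb_0[OF K(1) that] by simp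
  moreover have "\<exists>\<tau>\<in>embeddings k K. \<tau> \<theta> = z" if z: "poly m z = 0" for z
  proof -
    \<comment> \<open>Each x is written as some p(\<theta>) and sent to p(z). The choice of p is
      harmless, as two choices differ by a multiple of m, which vanishes at z.\<close>
    define \<tau> where "\<tau> = (\<lambda>x\<in>K. poly (SOME p. p \<in> polys k \<and> poly p \<theta> = x) z)"
    have \<tau>: "\<tau> (poly p \<theta>) = poly p z" if p: "p \<in> polys k" for p
    proof -
      define p' where "p' = (SOME p'. p' \<in> polys k \<and> poly p' \<theta> = poly p \<theta>)"
      have p': "p' \<in> polys k \<and> poly p' \<theta> = poly p \<theta>"
        unfolding p'_def by (rule someI[of _ p]) (use p in simp)
      then have "p' - p \<in> polys k" "poly (p' - p) \<theta> = 0" using polys_diff[OF k] p by auto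
      then obtain q where "p' - p = q * m" using min_poly_dvd[OF k m] by blast
      then have "poly (p' - p) z = 0" using z by simp
      then show ?thesis using pK[OF p] by (simp add: \<tau>_def p'_def)
    qed
    have "\<tau> \<in> embeddings k K"
      unfolding embeddings_iff
    proof (intro conjI ballI)
      show "\<tau> \<in> extensional K" by (simp add: \<tau>_def)
      show "\<tau> x = x" if "x \<in> k" for x
        using \<tau>[of "[:x:]"] that polys_pCons[OF k that polys_0[OF k]] by simp
      show "\<tau> 1 = 1" using \<tau>[of 1] polys_1[OF k] by simp
      fix x y assume "x \<in> K" "y \<in> K"
      then obtain p q where p: "p \<in> polys k" "x = poly p \<theta>" "q \<in> polys k" "y = poly q \<theta>" using Kp by metis
      show "\<tau> (x + y) = \<tau> x + \<tau> y"
        using \<tau>[of "p + q"] \<tau>[of p] \<tau>[of q] polys_add[OF k] p by simp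
      show "\<tau> (x * y) = \<tau> x * \<tau> y"
        using \<tau>[of "p * q"] \<tau>[of p] \<tau>[of q] polys_mult[OF k] p by simp
    qed
    moreover have "\<tau> \<theta> = z"
      using \<tau>[of "monom 1 1"] polys_monom[OF k subfield_1[OF k]] by (simp add: poly_monom)
    ultimately show ?thesis by blast
  qed
  ultimately show ?thesis unfolding bij_betw_def K_def by (auto simp: image_iff)
qed

section \<open>Degrees as numbers of embeddings, and extension of embeddings\<close>

lemma card_embeddings:
  assumes "finite_ext k K"
  shows "finite (embeddings k K)" "degree_eq k K (card (embeddings k K))"
proof -
  have k: "is_subfield k" using assms by (simp add: finite_ext_def)
  obtain \<theta> m where \<theta>: "K = adjoin k \<theta>" "min_poly k \<theta> m" "degree_eq k K (degree m)"
    using primitive_element[OF assms] .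
  have bij: "bij_betw (\<lambda>\<tau>. \<tau> \<theta>) (embeddings k K) {z. poly m z = 0}"
    using embeddings_adjoin[OF k \<theta>(2)] \<theta>(1) by simp
  have "finite {z. poly m z = 0}" using \<theta>(2) by (intro poly_roots_finite) (auto simp: min_poly_def)
  then show "finite (embeddings k K)" using bij bij_betw_finite by blast
  show "degree_eq k K (card (embeddings k K))"
    using bij_betw_same_card[OF bij] card_roots_min_poly[OF k \<theta>(2)] \<theta>(3) by simp
qed

lemma degree_eq_iff_card_embeddings:
  assumes "finite_ext k K" shows "degree_eq k K n \<longleftrightarrow> n = card (embeddings k K)"
  using assms card_embeddings(2)[OF assms] degree_eq_unique[of k] by (auto simp: finite_ext_def)

lemma card_embeddings_pos:
  assumes "finite_ext k K" shows "card (embeddings k K) > 0"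
  using assms card_embeddings(1)[OF assms] emb_id[of K k] by (auto simp: card_gt_0_iff finite_ext_def)

lemma card_embeddings_mult:
  assumes "finite_ext k F" "finite_ext F K"
  shows "card (embeddings k K) = card (embeddings k F) * card (embeddings F K)"
  using degree_eq_mult[OF assms card_embeddings(2)[OF assms(1)] card_embeddings(2)[OF assms(2)]]
    degree_eq_iff_card_embeddings[OF finite_ext_trans[OF assms]] by simp

text \<open>Every embedding considered here fixes \<rat>, so the extensions are sought over \<rat>
  and the base field of \<sigma> need not be recorded.\<close>

definition extensions :: "complex set \<Rightarrow> complex set \<Rightarrow> (complex \<Rightarrow> complex) \<Rightarrow> (complex \<Rightarrow> complex) set" where
  "extensions F K \<sigma> = {\<tau> \<in> embeddings \<rat> K. \<forall>x\<in>F. \<tau> x = \<sigma> x}"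

text \<open>There are at most \<open>[K : F]\<close> extensions of each embedding, as they are determined by a root of the
  conjugate of a minimal polynomial; equality follows by counting all embeddings.\<close>

lemma card_extensions_le:
  assumes FK: "finite_ext F K" and \<sigma>: "\<sigma> \<in> embeddings k F"
  shows "finite (extensions F K \<sigma>)" "card (extensions F K \<sigma>) \<le> card (embeddings F K)"
proof -
  have F: "is_subfield F" and K: "is_subfield K" "F \<subseteq> K" using FK by (auto simp: finite_ext_def)
  obtain \<theta> m where \<theta>: "\<theta> \<in> K" "K = adjoin F \<theta>" "min_poly F \<theta> m" "degree_eq F K (degree m)"
    using primitive_element[OF FK] .
  have m: "m \<in> polys F" "lead_coeff m = 1" "poly m \<theta> = 0" using \<theta> by (auto simp: min_poly_def)
  define m' where "m' = map_poly \<sigma> m"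
  have "\<sigma> 0 = 0" "\<sigma> 1 = 1" using emb_0[OF F \<sigma>] emb_1[OF F \<sigma>] .
  then have "coeff m' (degree m) = 1" using m by (simp add: m'_def coeff_map_poly)
  then have m'0: "m' \<noteq> 0" by auto
  have fin: "finite {z. poly m' z = 0}" using m'0 by (rule poly_roots_finite)
  have agree: "map_poly \<tau> p = map_poly \<sigma> p" if "\<tau> \<in> extensions F K \<sigma>" "p \<in> polys F" for \<tau> p
    using that \<open>\<sigma> 0 = 0\<close> subfield_0[OF F]
    by (intro poly_eqI) (auto simp: coeff_map_poly extensions_def polys_def)
  have val: "\<tau> (poly p \<theta>) = poly (map_poly \<sigma> p) (\<tau> \<theta>)" if "\<tau> \<in> extensions F K \<sigma>" "p \<in> polys F" for \<tau> p
    using emb_poly_map[OF K(1), of \<tau> \<rat> p \<theta>] agree[OF that] that polys_mono[OF K(2)] \<theta>(1)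
    by (auto simp: extensions_def)
  have inj: "inj_on (\<lambda>\<tau>. \<tau> \<theta>) (extensions F K \<sigma>)"
  proof (rule inj_onI)
    fix \<tau> \<tau>' assume \<tau>: "\<tau> \<in> extensions F K \<sigma>" "\<tau>' \<in> extensions F K \<sigma>" "\<tau> \<theta> = \<tau>' \<theta>"
    show "\<tau> = \<tau>'"
    proof (rule emb_ext)
      show "\<tau> \<in> embeddings \<rat> K" "\<tau>' \<in> embeddings \<rat> K" using \<tau> by (auto simp: extensions_def)
      fix x assume "x \<in> K"
      then obtain p where "p \<in> polys F" "x = poly p \<theta>" using \<theta>(2) adjoin_eq[OF F] by auto
      then show "\<tau> x = \<tau>' x" using val[OF \<tau>(1), of p] val[OF \<tau>(2), of p] \<tau>(3) by simp
    qed
  qed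
  moreover have sub: "(\<lambda>\<tau>. \<tau> \<theta>) ` extensions F K \<sigma> \<subseteq> {z. poly m' z = 0}"
  proof (clarsimp)
    fix \<tau> assume \<tau>: "\<tau> \<in> extensions F K \<sigma>"
    have "\<tau> 0 = 0" using \<tau> emb_0[OF K(1), of \<tau> \<rat>] by (simp add: extensions_def)
    then show "poly m' (\<tau> \<theta>) = 0" using val[OF \<tau> m(1)] m(3) by (simp add: m'_def)
  qed
  ultimately show "finite (extensions F K \<sigma>)"
    using fin by (meson finite_imageD finite_subset)
  have "card (extensions F K \<sigma>) \<le> card {z. poly m' z = 0}"
    using card_inj_on_le[OF inj sub fin] .
  also have "\<dots> \<le> degree m'" using m'0 by (rule card_poly_roots_bound)
  also have "\<dots> \<le> degree m" by (simp add: m'_def map_poly_degree_leq)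
  also have "\<dots> = card (embeddings F K)"
    using degree_eq_iff_card_embeddings[OF FK] \<theta>(4) by simp
  finally show "card (extensions F K \<sigma>) \<le> card (embeddings F K)" .
qed

lemma extensions_subset_embeddings:
  assumes "k \<subseteq> F" "is_subfield k" "\<sigma> \<in> embeddings k F"
  shows "extensions F K \<sigma> \<subseteq> embeddings k K"
  using assms by (auto simp: extensions_def embeddings_iff subsetD)

lemma embeddings_eq_Union_extensions:
  assumes k: "is_subfield k" and F: "is_subfield F" "k \<subseteq> F" "F \<subseteq> K"
  shows "embeddings k K = (\<Union>\<sigma>\<in>embeddings k F. extensions F K \<sigma>)"
proof (intro equalityI subsetI)
  fix \<tau> assume \<tau>: "\<tau> \<in> embeddings k K"
  have "\<tau> \<in> extensions F K (restrict \<tau> F)"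
    using \<tau> emb_base_mono[OF Rats_subset_subfield[OF k]] by (auto simp: extensions_def)
  then show "\<tau> \<in> (\<Union>\<sigma>\<in>embeddings k F. extensions F K \<sigma>)"
    using emb_restrict[OF \<tau> F(1) F(3) F(2)] by blast
qed (use extensions_subset_embeddings[OF F(2) k] in blast)

lemma disjoint_extensions:
  assumes "\<sigma> \<in> embeddings k F" "\<sigma>' \<in> embeddings k' F" "\<sigma> \<noteq> \<sigma>'"
  shows "extensions F K \<sigma> \<inter> extensions F K \<sigma>' = {}"
  using emb_ext[OF assms(1,2)] assms(3) by (fastforce simp: extensions_def)

lemma card_extensions:
  assumes kF: "finite_ext k F" and FK: "finite_ext F K" and \<sigma>: "\<sigma> \<in> embeddings k F"
  shows "card (extensions F K \<sigma>) = card (embeddings F K)"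
proof (rule ccontr)
  assume ne: "card (extensions F K \<sigma>) \<noteq> card (embeddings F K)"
  have F: "is_subfield F" "k \<subseteq> F" "is_subfield k" and K: "is_subfield K" "F \<subseteq> K"
    using assms by (auto simp: finite_ext_def)
  have "card (embeddings k K) = card (\<Union>\<sigma>\<in>embeddings k F. extensions F K \<sigma>)"
    using embeddings_eq_Union_extensions[OF F(3,1,2) K(2)] by simp
  also have "\<dots> = (\<Sum>\<sigma>\<in>embeddings k F. card (extensions F K \<sigma>))"
    using card_extensions_le[OF FK] disjoint_extensions card_embeddings(1)[OF kF]
    by (intro card_UN_disjoint) blast+
  also have "\<dots> < (\<Sum>\<sigma>\<in>embeddings k F. card (embeddings F K))"
    using card_extensions_le(2)[OF FK] \<sigma> ne card_embeddings(1)[OF kF]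
    by (intro sum_strict_mono_ex1) (auto simp: order_less_le)
  also have "\<dots> = card (embeddings k K)"
    using card_embeddings_mult[OF kF FK] by simp
  finally show False by simp
qed

lemma ex_extension:
  assumes kF: "finite_ext k F" and FK: "finite_ext F K" and \<sigma>: "\<sigma> \<in> embeddings k F"
  obtains \<tau> where "\<tau> \<in> embeddings k K" "\<And>x. x \<in> F \<Longrightarrow> \<tau> x = \<sigma> x"
proof -
  have "card (extensions F K \<sigma>) > 0"
    using card_extensions[OF assms] card_embeddings_pos[OF FK] by simp
  then obtain \<tau> where "\<tau> \<in> extensions F K \<sigma>" by (metis card_gt_0_iff equals0I)
  then show ?thesis
    using that[of \<tau>] extensions_subset_embeddings[of k F \<sigma> K] kF \<sigma> by (auto simp: extensions_def finite_ext_def)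
qed

text \<open>Every embedding of k(x) extends to K and therefore fixes x. Hence x is the only root of
  its minimal polynomial, which has simple roots and so is linear.\<close>

lemma in_base_if_fixed:
  assumes kK: "finite_ext k K" and x: "x \<in> K" and fixed: "\<And>\<tau>. \<tau> \<in> embeddings k K \<Longrightarrow> \<tau> x = x"
  shows "x \<in> k"
proof -
  have k: "is_subfield k" and K: "is_subfield K" "k \<subseteq> K" using kK by (auto simp: finite_ext_def)
  obtain m where m: "min_poly k x m" using ex_min_poly[OF k finite_ext_algebraic[OF kK x]] .
  define F where "F = adjoin k x"
  have kF: "finite_ext k F" unfolding F_def by (rule adjoin_finite_ext(1)[OF k m])
  have F: "is_subfield F" "k \<subseteq> F" "F \<subseteq> K" "x \<in> F"
    using kF adjoin_subset[OF K x] adjoin_self[OF k] by (auto simp: F_def finite_ext_def)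
  have FK: "finite_ext F K" by (rule finite_ext_base_change[OF kK F(1-3)])
  have bij: "bij_betw (\<lambda>\<tau>. \<tau> x) (embeddings k F) {z. poly m z = 0}"
    using embeddings_adjoin[OF k m] by (simp add: F_def)
  have "\<sigma> x = x" if "\<sigma> \<in> embeddings k F" for \<sigma>
    using ex_extension[OF kF FK that] fixed F(4) by metis
  then have "(\<lambda>\<tau>. \<tau> x) ` embeddings k F \<subseteq> {x}" by auto
  then have "{z. poly m z = 0} \<subseteq> {x}" using bij_betw_imp_surj_on[OF bij] by simp
  then have "{z. poly m z = 0} = {x}" using m by (auto simp: min_poly_def)
  then have deg: "degree m = 1" using card_roots_min_poly[OF k m] by simp
  then have "m = [:coeff m 0, 1:]"
    using m by (intro poly_eqI) (auto simp: coeff_pCons min_poly_def coeff_eq_0 split: nat.split)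
  moreover have "poly m x = 0" using m by (simp add: min_poly_def)
  ultimately have "poly [:coeff m 0, 1:] x = 0" by simp
  then have "x = - coeff m 0" by (simp add: eq_neg_iff_add_eq_0 add.commute)
  then show ?thesis using m subfield_uminus[OF k] by (auto simp: min_poly_def polys_def)
qed

section \<open>Galois theory\<close>

subsection \<open>Normal closures\<close>

lemma ex_finite_ext_containing:
  assumes "finite A" "is_subfield k" "\<And>a. a \<in> A \<Longrightarrow> algebraic_over k a"
  shows "\<exists>M. finite_ext k M \<and> A \<subseteq> M"
  using assms
proof (induction A)
  case empty
  then show ?case using finite_ext_refl by blast
next
  case (insert a A)
  then obtain M where M: "finite_ext k M" "A \<subseteq> M" by auto
  have kM: "k \<subseteq> M" "is_subfield M" using M by (auto simp: finite_ext_def)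
  have "algebraic_over M a"
    using insert.prems(2)[of a] polys_mono[OF kM(1)] by (auto simp: algebraic_over_def)
  then have "finite_ext M (adjoin M a)" by (rule finite_ext_adjoin[OF kM(2)])
  then have "finite_ext k (adjoin M a)" by (rule finite_ext_trans[OF M(1)])
  moreover have "insert a A \<subseteq> adjoin M a"
    using M(2) subset_adjoin[OF kM(2), of a] adjoin_self[OF kM(2), of a] by blast
  ultimately show ?case by blast
qed

lemma emb_image_subset_normal_closure: "\<tau> \<in> embeddings k K \<Longrightarrow> \<tau> ` K \<subseteq> normal_closure k K"
  by (auto simp: normal_closure_def intro: generate_field.incl)

lemma normal_closure_subset:
  assumes "is_subfield M" "\<And>\<tau>. \<tau> \<in> embeddings k K \<Longrightarrow> \<tau> ` K \<subseteq> M"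
  shows "normal_closure k K \<subseteq> M"
  unfolding normal_closure_def
  by (rule field.generate_field_min_subfield1[OF complex_field]) (use assms in auto)

text \<open>The conjugates of a primitive element are algebraic over k and lie in one finite
  extension M; then all conjugates of K lie in M.\<close>

lemma finite_ext_normal_closure:
  assumes kK: "finite_ext k K"
  shows "finite_ext k (normal_closure k K)" "K \<subseteq> normal_closure k K"
proof -
  have k: "is_subfield k" and K: "is_subfield K" "k \<subseteq> K" using kK by (auto simp: finite_ext_def)
  obtain \<theta> m where \<theta>: "\<theta> \<in> K" "K = adjoin k \<theta>" "min_poly k \<theta> m"
    using primitive_element[OF kK] .
  have m: "m \<in> polys k" "m \<noteq> 0" "poly m \<theta> = 0" using \<theta> by (auto simp: min_poly_def)
  have "algebraic_over k (\<tau> \<theta>)" if "\<tau> \<in> embeddings k K" for \<tau>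
    using emb_poly[OF K(1) that K(2) m(1) \<theta>(1)] m emb_0[OF K(1) that] by (auto simp: algebraic_over_def)
  then obtain M where M: "finite_ext k M" "(\<lambda>\<tau>. \<tau> \<theta>) ` embeddings k K \<subseteq> M"
    using ex_finite_ext_containing[of "(\<lambda>\<tau>. \<tau> \<theta>) ` embeddings k K" k] card_embeddings(1)[OF kK] k by blast
  have M': "is_subfield M" "k \<subseteq> M" using M by (auto simp: finite_ext_def)
  have "normal_closure k K \<subseteq> M"
  proof (rule normal_closure_subset[OF M'(1)])
    fix \<tau> assume \<tau>: "\<tau> \<in> embeddings k K"
    show "\<tau> ` K \<subseteq> M"
    proof clarify
      fix x assume "x \<in> K"
      then obtain p where p: "p \<in> polys k" "x = poly p \<theta>" using \<theta>(2) adjoin_eq[OF k] by auto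
      have "p \<in> polys M" "\<tau> \<theta> \<in> M" using p polys_mono[OF M'(2)] M(2) \<tau> by auto
      then show "\<tau> x \<in> M"
        unfolding p(2) emb_poly[OF K(1) \<tau> K(2) p(1) \<theta>(1)] by (rule poly_in_subfield[OF M'(1)])
    qed
  qed
  moreover have "is_subfield (normal_closure k K)"
    unfolding normal_closure_def by (rule field.generate_field_is_subfield[OF complex_field]) simp
  moreover show KL: "K \<subseteq> normal_closure k K"
    using emb_image_subset_normal_closure[OF emb_id[OF K]] by auto
  ultimately show "finite_ext k (normal_closure k K)"
    using finite_ext_intermediate[OF M(1)] K(2) by blast
qed

text \<open>The elements of L that \<sigma> keeps inside L form a subfield. It contains every
  conjugate of K, because composing an embedding of K with \<sigma> gives an embedding of K
  again.\<close>

lemma emb_normal_closure_image: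
  assumes kK: "finite_ext k K" and \<sigma>: "\<sigma> \<in> embeddings k (normal_closure k K)"
  shows "\<sigma> ` normal_closure k K \<subseteq> normal_closure k K"
proof -
  define L where "L = normal_closure k K"
  have K: "is_subfield K" "k \<subseteq> K" using kK by (auto simp: finite_ext_def)
  have L: "is_subfield L" using finite_ext_normal_closure(1)[OF kK] by (simp add: L_def finite_ext_def)
  have \<sigma>L: "\<sigma> \<in> embeddings k L" using \<sigma> by (simp add: L_def)
  have "is_subfield {x \<in> L. \<sigma> x \<in> L}"
    by (rule is_subfieldI)
      (auto simp: subfield_simps[OF L] emb_1[OF L \<sigma>L] emb_diff[OF L \<sigma>L] emb_mult[OF L \<sigma>L] emb_inverse[OF L \<sigma>L])
  moreover have "\<tau> ` K \<subseteq> {x \<in> L. \<sigma> x \<in> L}" if \<tau>: "\<tau> \<in> embeddings k K" for \<tau>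
  proof -
    have \<tau>K: "\<tau> ` K \<subseteq> L" unfolding L_def by (rule emb_image_subset_normal_closure[OF \<tau>])
    have "compose K \<sigma> \<tau> ` K \<subseteq> L"
      unfolding L_def by (rule emb_image_subset_normal_closure[OF emb_compose[OF K \<tau> \<sigma>L \<tau>K]])
    then show ?thesis using \<tau>K by (auto simp: compose_def)
  qed
  ultimately have "L \<subseteq> {x \<in> L. \<sigma> x \<in> L}"
    unfolding L_def by (rule normal_closure_subset)
  then show ?thesis by (auto simp: L_def)
qed

lemma compose_emb_inj_on:
  assumes L: "is_subfield L" and \<sigma>: "\<sigma> \<in> embeddings k L" and sub: "\<And>\<tau>. \<tau> \<in> A \<Longrightarrow> \<tau> ` K \<subseteq> L"
    and A: "A \<subseteq> embeddings k' K"
  shows "inj_on (compose K \<sigma>) A"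
proof (rule inj_onI)
  fix \<tau> \<tau>' assume \<tau>: "\<tau> \<in> A" "\<tau>' \<in> A" "compose K \<sigma> \<tau> = compose K \<sigma> \<tau>'"
  show "\<tau> = \<tau>'"
  proof (rule emb_ext)
    show "\<tau> \<in> embeddings k' K" "\<tau>' \<in> embeddings k' K" using A \<tau> by auto
    fix x assume x: "x \<in> K"
    have "\<sigma> (\<tau> x) = \<sigma> (\<tau>' x)" using fun_cong[OF \<tau>(3), of x] x by (simp add: compose_def)
    moreover have "\<tau> x \<in> L" "\<tau>' x \<in> L" using sub \<tau> x by blast+
    ultimately show "\<tau> x = \<tau>' x" using emb_inj[OF L \<sigma>] by (simp add: inj_on_eq_iff)
  qed
qed

lemma compose_emb_surj:
  assumes kK: "finite_ext k K" and L: "is_subfield L" and \<sigma>: "\<sigma> \<in> embeddings k L"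
    and sub: "\<And>\<tau>. \<tau> \<in> embeddings k K \<Longrightarrow> \<tau> ` K \<subseteq> L"
  shows "bij_betw (compose K \<sigma>) (embeddings k K) (embeddings k K)"
proof -
  have K: "is_subfield K" "k \<subseteq> K" using kK by (auto simp: finite_ext_def)
  have inj: "inj_on (compose K \<sigma>) (embeddings k K)"
    by (rule compose_emb_inj_on[OF L \<sigma> sub]) auto
  moreover have "compose K \<sigma> ` embeddings k K \<subseteq> embeddings k K"
    using emb_compose[OF K _ \<sigma> sub] by blast
  ultimately show ?thesis
    using endo_inj_surj[OF card_embeddings(1)[OF kK]] by (simp add: bij_betw_def)
qed

text \<open>What has to be shown is that an embedding \<sigma> of L is onto L. Composition with
  \<sigma> permutes the finite set of embeddings of L, so some \<sigma>' composes with \<sigma> to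
  the identity.\<close>

lemma Gal_normal_closure:
  assumes kK: "finite_ext k K"
  shows "Gal k (normal_closure k K) = embeddings k (normal_closure k K)"
proof -
  define L where "L = normal_closure k K"
  have kL: "finite_ext k L" unfolding L_def by (rule finite_ext_normal_closure(1)[OF kK])
  have L: "is_subfield L" "k \<subseteq> L" using kL by (auto simp: finite_ext_def)
  have img: "\<sigma> ` L \<subseteq> L" if "\<sigma> \<in> embeddings k L" for \<sigma>
    using emb_normal_closure_image[OF kK] that by (simp add: L_def)
  have "bij_betw \<sigma> L L" if \<sigma>: "\<sigma> \<in> embeddings k L" for \<sigma>
  proof -
    have "(\<lambda>x\<in>L. x) \<in> compose L \<sigma> ` embeddings k L"
      using compose_emb_surj[OF kL L(1) \<sigma> img] emb_id[OF L] by (simp add: bij_betw_def)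
    then obtain \<sigma>' where \<sigma>': "\<sigma>' \<in> embeddings k L" "compose L \<sigma> \<sigma>' = (\<lambda>x\<in>L. x)" by auto
    have "y \<in> \<sigma> ` L" if y: "y \<in> L" for y
    proof -
      have "\<sigma> (\<sigma>' y) = y" using fun_cong[OF \<sigma>'(2), of y] y by (simp add: compose_def)
      then show ?thesis using img[OF \<sigma>'(1)] y by force
    qed
    then show ?thesis using img[OF \<sigma>] emb_inj[OF L(1) \<sigma>] by (auto simp: bij_betw_def)
  qed
  then have "Gal k L = embeddings k L"
    using img by (auto simp: Gal_def embeddings_def ring_iso_def Ring.ring_hom_def)
  then show ?thesis by (simp add: L_def)
qed

text \<open>The Galois action can be computed with the embeddings of any larger finite extension M:
  they restrict to the normal closure, and every embedding of it extends to M. Thus a single field L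
  serves for all steps of a tower.\<close>

lemma Gal_perm_group_eq:
  assumes kK: "finite_ext k K" and kM: "finite_ext k M" and sub: "normal_closure k K \<subseteq> M"
  shows "Gal_perm_group k K = (\<lambda>\<sigma>. \<lambda>\<tau>\<in>embeddings k K. compose K \<sigma> \<tau>) ` embeddings k M"
proof -
  define L where "L = normal_closure k K"
  have kL: "finite_ext k L" unfolding L_def by (rule finite_ext_normal_closure(1)[OF kK])
  have L: "is_subfield L" "k \<subseteq> L" "L \<subseteq> M" using kL sub by (auto simp: finite_ext_def L_def)
  have LM: "finite_ext L M" by (rule finite_ext_base_change[OF kM L])
  have eq: "(\<lambda>\<tau>\<in>embeddings k K. compose K \<sigma> \<tau>) = (\<lambda>\<tau>\<in>embeddings k K. compose K \<sigma>' \<tau>)"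
    if "\<And>x. x \<in> L \<Longrightarrow> \<sigma> x = \<sigma>' x" for \<sigma> \<sigma>'
  proof (rule restrict_ext)
    fix \<tau> assume "\<tau> \<in> embeddings k K"
    then have "\<tau> ` K \<subseteq> L" unfolding L_def by (rule emb_image_subset_normal_closure)
    then show "compose K \<sigma> \<tau> = compose K \<sigma>' \<tau>"
      using that by (intro ext) (auto simp: compose_def)
  qed
  have "Gal_perm_group k K = (\<lambda>\<sigma>. \<lambda>\<tau>\<in>embeddings k K. compose K \<sigma> \<tau>) ` embeddings k L"
    using Gal_normal_closure[OF kK] by (simp add: Gal_perm_group_def L_def)
  also have "\<dots> = (\<lambda>\<sigma>. \<lambda>\<tau>\<in>embeddings k K. compose K \<sigma> \<tau>) ` embeddings k M"
  proof (intro equalityI image_subsetI)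
    fix \<sigma> assume "\<sigma> \<in> embeddings k L"
    then obtain \<sigma>' where \<sigma>': "\<sigma>' \<in> embeddings k M" "\<And>x. x \<in> L \<Longrightarrow> \<sigma>' x = \<sigma> x"
      using ex_extension[OF kL LM] by blast
    then show "(\<lambda>\<tau>\<in>embeddings k K. compose K \<sigma> \<tau>) \<in> (\<lambda>\<sigma>. \<lambda>\<tau>\<in>embeddings k K. compose K \<sigma> \<tau>) ` embeddings k M"
      using eq[of \<sigma> \<sigma>'] by (intro image_eqI[of _ _ \<sigma>']) auto
  next
    fix \<sigma> assume "\<sigma> \<in> embeddings k M"
    then show "(\<lambda>\<tau>\<in>embeddings k K. compose K \<sigma> \<tau>) \<in> (\<lambda>\<sigma>. \<lambda>\<tau>\<in>embeddings k K. compose K \<sigma> \<tau>) ` embeddings k L"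
      using eq[of \<sigma> "restrict \<sigma> L"] emb_restrict[of \<sigma> k M L] L
      by (intro image_eqI[of _ _ "restrict \<sigma> L"]) auto
  qed
  finally show ?thesis .
qed

lemma map_poly_emb_prod:
  assumes L: "is_subfield L" and \<sigma>: "\<sigma> \<in> embeddings k L"
  shows "(\<And>i. i \<in> I \<Longrightarrow> f i \<in> polys L) \<Longrightarrow> map_poly \<sigma> (prod f I) = (\<Prod>i\<in>I. map_poly \<sigma> (f i)) \<and> prod f I \<in> polys L"
proof (induction I rule: infinite_finite_induct)
  case (insert x I)
  have mult: "map_poly \<sigma> (p * q) = map_poly \<sigma> p * map_poly \<sigma> q" if "p \<in> polys L" "q \<in> polys L" for p q
    using that by (intro poly_eqI) (simp add: coeff_map_poly emb_0[OF L \<sigma>] coeff_mult emb_sum[OF L \<sigma>]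
        emb_mult[OF L \<sigma>] polys_def subfield_mult[OF L])
  show ?case using insert by (simp add: mult polys_mult[OF L])
qed (simp_all add: emb_1[OF L \<sigma>] polys_1[OF L])

subsection \<open>Blocks and intermediate fields\<close>

definition fixed_field :: "complex set \<Rightarrow> (complex \<Rightarrow> complex) set \<Rightarrow> complex set" where
  "fixed_field K B = {x \<in> K. \<forall>\<tau>\<in>B. \<tau> x = x}"

lemma is_subfield_fixed_field:
  assumes K: "is_subfield K" and B: "B \<subseteq> embeddings k K" shows "is_subfield (fixed_field K B)"
proof (rule is_subfieldI)
  note B' = subsetD[OF B]
  have "\<tau> 1 = 1" if "\<tau> \<in> B" for \<tau> using emb_1[OF K B'[OF that]] .
  then show "1 \<in> fixed_field K B" by (simp add: fixed_field_def subfield_simps[OF K])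
  fix x y assume x: "x \<in> fixed_field K B" and y: "y \<in> fixed_field K B"
  then have K: "x \<in> K" "y \<in> K" by (auto simp: fixed_field_def)
  have "\<tau> (x - y) = x - y \<and> \<tau> (x * y) = x * y" if "\<tau> \<in> B" for \<tau>
    using emb_diff[OF assms(1) B'[OF that] K] emb_mult[OF assms(1) B'[OF that] K] x y that
    by (auto simp: fixed_field_def)
  then show "x - y \<in> fixed_field K B" "x * y \<in> fixed_field K B"
    using K by (auto simp: fixed_field_def subfield_simps[OF assms(1)])
next
  fix x assume x: "x \<in> fixed_field K B"
  then have "\<tau> (inverse x) = inverse x" if "\<tau> \<in> B" for \<tau>
    using emb_inverse[OF K subsetD[OF B that], of x] that by (simp add: fixed_field_def)
  then show "inverse x \<in> fixed_field K B"
    using x by (simp add: fixed_field_def subfield_simps[OF K])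
qed

text \<open>Only the block that contains the inclusion of K is considered, since its fixed field is
  the one that is a subfield of K in the tower; the group acts by composition with embeddings of the
  normal closure.\<close>

definition galois_block :: "complex set \<Rightarrow> complex set \<Rightarrow> (complex \<Rightarrow> complex) set \<Rightarrow> bool" where
  "galois_block k K B \<longleftrightarrow> B \<subseteq> embeddings k K \<and> (\<lambda>x\<in>K. x) \<in> B \<and>
     (\<forall>\<sigma>\<in>embeddings k (normal_closure k K).
        compose K \<sigma> ` B \<inter> B \<noteq> {} \<longrightarrow> compose K \<sigma> ` B = B)"

lemma compose_emb_id: "\<sigma> \<in> embeddings k L \<Longrightarrow> compose K \<sigma> (\<lambda>x\<in>K. x) = restrict \<sigma> K"
  by (auto simp: compose_def)

text \<open>For a primitive element \<theta>, let p have the roots \<tau> \<theta> with \<tau> in B.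
  By the block property p is invariant under each \<sigma> whose restriction to K lies in B, so its
  coefficients lie in the fixed field F of B. An embedding of K over F must then send \<theta> to
  some \<tau> \<theta>, which places it in B.\<close>

lemma fixed_field_galois_block:
  assumes kK: "finite_ext k K" and B: "galois_block k K B"
  shows "finite_ext k (fixed_field K B)" "finite_ext (fixed_field K B) K"
    "embeddings (fixed_field K B) K = B"
proof -
  define L where "L = normal_closure k K"
  define F where "F = fixed_field K B"
  define \<iota> where "\<iota> = (\<lambda>x\<in>K. x)"
  have k: "is_subfield k" and K: "is_subfield K" "k \<subseteq> K" using kK by (auto simp: finite_ext_def)
  have kL: "finite_ext k L" and KL: "K \<subseteq> L"
    unfolding L_def by (rule finite_ext_normal_closure[OF kK])+
  have L: "is_subfield L" using kL by (auto simp: finite_ext_def)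
  have KL': "finite_ext K L" by (rule finite_ext_base_change[OF kL K KL])
  have Bsub: "B \<subseteq> embeddings k K" and \<iota>B: "\<iota> \<in> B" using B by (auto simp: galois_block_def \<iota>_def)
  have block: "compose K \<sigma> ` B = B" if "\<sigma> \<in> embeddings k L" "restrict \<sigma> K \<in> B" for \<sigma>
  proof -
    have "restrict \<sigma> K \<in> compose K \<sigma> ` B"
      using \<iota>B compose_emb_id[OF that(1), of K] by (force simp: \<iota>_def)
    then have "compose K \<sigma> ` B \<inter> B \<noteq> {}" using that(2) by blast
    then show ?thesis using B that(1) unfolding galois_block_def L_def by blast
  qed
  have finB: "finite B" using Bsub card_embeddings(1)[OF kK] finite_subset by blast
  have F: "is_subfield F" unfolding F_def by (rule is_subfield_fixed_field[OF K(1) Bsub])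
  have kF: "k \<subseteq> F" using K(2) Bsub emb_base[OF K(1)] by (fastforce simp: F_def fixed_field_def)
  have FK: "F \<subseteq> K" by (auto simp: F_def fixed_field_def)
  show "finite_ext k (fixed_field K B)" "finite_ext (fixed_field K B) K"
    using finite_ext_intermediate[OF kK F kF FK] finite_ext_base_change[OF kK F kF FK] by (simp_all add: F_def)
  obtain \<theta> m where \<theta>: "\<theta> \<in> K" "K = adjoin k \<theta>" "min_poly k \<theta> m"
    using primitive_element[OF kK] .
  define p where "p = (\<Prod>\<tau>\<in>B. [:- \<tau> \<theta>, 1:])"
  have lin: "[:- \<tau> \<theta>, 1:] \<in> polys L" if "\<tau> \<in> B" for \<tau>
  proof -
    have "\<tau> \<theta> \<in> L"
      using emb_image_subset_normal_closure[of \<tau> k K] that Bsub \<theta>(1) by (auto simp: L_def)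
    then show ?thesis by (intro polys_pCons[OF L] polys_0[OF L]) (auto simp: subfield_simps[OF L])
  qed
  have pL: "p \<in> polys L"
    unfolding p_def using map_poly_emb_prod[OF L emb_id[OF L order_refl], of B "\<lambda>\<tau>. [:- \<tau> \<theta>, 1:]"] lin by blast
  have inv: "map_poly \<sigma> p = p" if \<sigma>: "\<sigma> \<in> embeddings k L" and r: "restrict \<sigma> K \<in> B" for \<sigma>
  proof -
    have "map_poly \<sigma> p = (\<Prod>\<tau>\<in>B. map_poly \<sigma> [:- \<tau> \<theta>, 1:])"
      unfolding p_def using map_poly_emb_prod[OF L \<sigma>, of B "\<lambda>\<tau>. [:- \<tau> \<theta>, 1:]"] lin by blast
    also have "\<dots> = (\<Prod>\<tau>\<in>B. [:- compose K \<sigma> \<tau> \<theta>, 1:])"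
    proof (rule prod.cong)
      fix \<tau> assume "\<tau> \<in> B"
      then have "\<tau> \<theta> \<in> L"
        using emb_image_subset_normal_closure[of \<tau> k K] Bsub \<theta>(1) by (auto simp: L_def)
      then show "map_poly \<sigma> [:- \<tau> \<theta>, 1:] = [:- compose K \<sigma> \<tau> \<theta>, 1:]"
        using \<theta>(1) by (simp add: map_poly_pCons emb_0[OF L \<sigma>] emb_1[OF L \<sigma>] emb_uminus[OF L \<sigma>] compose_def)
    qed simp
    also have "\<dots> = (\<Prod>\<tau>\<in>compose K \<sigma> ` B. [:- \<tau> \<theta>, 1:])"
    proof -
      have "\<tau> ` K \<subseteq> L" if "\<tau> \<in> B" for \<tau>
        unfolding L_def by (rule emb_image_subset_normal_closure) (use that Bsub in blast)
      then have "inj_on (compose K \<sigma>) B" by (rule compose_emb_inj_on[OF L \<sigma> _ Bsub])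
      then show ?thesis by (subst prod.reindex) auto
    qed
    also have "\<dots> = p" unfolding p_def block[OF \<sigma> r] ..
    finally show ?thesis .
  qed
  have coeff_inv: "\<sigma> (coeff p i) = coeff p i" if "\<sigma> \<in> embeddings k L" "restrict \<sigma> K \<in> B" for \<sigma> i
    using arg_cong[OF inv[OF that], of "\<lambda>q. coeff q i"] by (simp add: coeff_map_poly emb_0[OF L that(1)])
  \<comment> \<open>An embedding of L over K restricts to the inclusion of K, which belongs to B, so
    it fixes the coefficients.\<close>
  have pK: "coeff p i \<in> K" for i
  proof (rule in_base_if_fixed[OF KL'])
    show "coeff p i \<in> L" using pL by (simp add: polys_def)
    fix \<sigma> assume \<sigma>: "\<sigma> \<in> embeddings K L"
    then have \<sigma>k: "\<sigma> \<in> embeddings k L" using emb_base_mono[OF K(2)] by blast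
    have "restrict \<sigma> K = \<iota>" using emb_base[OF L \<sigma>] by (auto simp: \<iota>_def)
    then show "\<sigma> (coeff p i) = coeff p i" using coeff_inv[OF \<sigma>k] \<iota>B by simp
  qed
  have "\<tau> (coeff p i) = coeff p i" if "\<tau> \<in> B" for \<tau> i
  proof -
    have \<tau>: "\<tau> \<in> embeddings k K" using that Bsub by blast
    then obtain \<sigma> where \<sigma>: "\<sigma> \<in> embeddings k L" "\<And>x. x \<in> K \<Longrightarrow> \<sigma> x = \<tau> x"
      using ex_extension[OF kK KL' \<tau>] by blast
    have "restrict \<sigma> K = \<tau>"
      using \<sigma>(2) \<tau> by (intro extensionalityI[of _ K]) (auto simp: embeddings_iff)
    then show ?thesis using coeff_inv[OF \<sigma>(1)] that \<sigma>(2) pK by simp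
  qed
  then have pF: "p \<in> polys F" using pK by (simp add: polys_def F_def fixed_field_def)
  have p0: "poly p \<theta> = 0"
    unfolding p_def poly_prod using finB \<iota>B \<theta>(1) by (auto simp: \<iota>_def intro!: prod_zero bexI[of _ \<iota>])
  have "embeddings F K = B"
  proof (intro equalityI subsetI)
    fix \<rho> assume \<rho>: "\<rho> \<in> embeddings F K"
    have "poly p (\<rho> \<theta>) = 0"
      using emb_poly[OF K(1) \<rho> FK pF \<theta>(1)] p0 emb_0[OF K(1) \<rho>] by simp
    then obtain \<tau> where \<tau>: "\<tau> \<in> B" "\<rho> \<theta> = \<tau> \<theta>"
      unfolding p_def poly_prod using finB by (auto simp: prod_zero_iff)
    have "\<rho> = \<tau>"
      using bij_betw_imp_inj_on[OF embeddings_adjoin[OF k \<theta>(3)]] \<tau> Bsub \<rho> emb_base_mono[OF kF]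
      unfolding \<theta>(2)[symmetric] inj_on_def by blast
    then show "\<rho> \<in> B" using \<tau> by simp
  next
    fix \<tau> assume "\<tau> \<in> B"
    then show "\<tau> \<in> embeddings F K"
      using Bsub by (auto simp: embeddings_def F_def fixed_field_def)
  qed
  then show "embeddings (fixed_field K B) K = B" by (simp add: F_def)
qed

subsection \<open>Permutation isomorphism\<close>

lemma Bij_subset_extensional: "Bij S \<subseteq> extensional S"
  by (auto simp: Bij_def)

text \<open>The group isomorphism is conjugation by \<phi>, and the homomorphism law comes for free.
  Since permutations are extensional functions, it is enough to match the two groups elementwise in
  both directions, and no group operation is needed later on.\<close>

lemma perm_isomorphicI:
  assumes \<phi>: "bij_betw \<phi> \<Omega> \<Omega>'" and G: "G \<subseteq> Bij \<Omega>" and G': "G' \<subseteq> extensional \<Omega>'"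
    and 1: "\<And>g. g \<in> G \<Longrightarrow> \<exists>g'\<in>G'. \<forall>x\<in>\<Omega>. \<phi> (g x) = g' (\<phi> x)"
    and 2: "\<And>g'. g' \<in> G' \<Longrightarrow> \<exists>g\<in>G. \<forall>x\<in>\<Omega>. \<phi> (g x) = g' (\<phi> x)"
  shows "perm_isomorphic \<Omega> G \<Omega>' G'"
proof -
  define \<psi> where "\<psi> g = (\<lambda>y\<in>\<Omega>'. \<phi> (g (inv_into \<Omega> \<phi> y)))" for g
  have inv: "inv_into \<Omega> \<phi> (\<phi> x) = x" if "x \<in> \<Omega>" for x
    using bij_betw_inv_into_left[OF \<phi> that] .
  have inv': "inv_into \<Omega> \<phi> y \<in> \<Omega>" "\<phi> (inv_into \<Omega> \<phi> y) = y" if "y \<in> \<Omega>'" for y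
    using bij_betw_apply[OF bij_betw_inv_into[OF \<phi>] that] bij_betw_inv_into_right[OF \<phi> that] .
  have \<psi>: "\<psi> g (\<phi> x) = \<phi> (g x)" if "x \<in> \<Omega>" for g x
    using inv[OF that] bij_betw_apply[OF \<phi> that] by (simp add: \<psi>_def)
  have \<psi>_eq: "\<psi> g = g'" if "g' \<in> extensional \<Omega>'" "\<forall>x\<in>\<Omega>. \<phi> (g x) = g' (\<phi> x)" for g g'
    using that inv' by (intro extensionalityI[of _ \<Omega>']) (auto simp: \<psi>_def)
  have gmem: "g x \<in> \<Omega>" if "g \<in> G" "x \<in> \<Omega>" for g x
    using that G by (auto simp: Bij_def bij_betw_def)
  have \<psi>G: "\<psi> ` G = G'"
  proof (intro equalityI subsetI)
    fix g' assume "g' \<in> \<psi> ` G"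
    then obtain g where "g \<in> G" "g' = \<psi> g" by auto
    then show "g' \<in> G'" using 1[of g] \<psi>_eq G' by blast
  next
    fix g' assume "g' \<in> G'"
    then show "g' \<in> \<psi> ` G" using 2[of g'] \<psi>_eq G' by blast
  qed
  have G'_Bij: "\<psi> g \<in> Bij \<Omega>'" if "g \<in> G" for g
  proof -
    have "bij_betw (\<phi> \<circ> g \<circ> inv_into \<Omega> \<phi>) \<Omega>' \<Omega>'"
      using that G by (intro bij_betw_trans[OF _ \<phi>] bij_betw_trans[OF bij_betw_inv_into[OF \<phi>]] )
        (auto simp: Bij_def comp_assoc intro!: bij_betw_trans[OF bij_betw_inv_into[OF \<phi>]] bij_betw_trans[OF _ \<phi>])
    then have "bij_betw (\<psi> g) \<Omega>' \<Omega>'"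
      by (subst bij_betw_cong[of _ _ "\<phi> \<circ> g \<circ> inv_into \<Omega> \<phi>"]) (auto simp: \<psi>_def)
    then show ?thesis by (auto simp: Bij_def \<psi>_def)
  qed
  have inj: "inj_on \<psi> G"
  proof (rule inj_onI)
    fix g h assume gh: "g \<in> G" "h \<in> G" "\<psi> g = \<psi> h"
    show "g = h"
    proof (rule extensionalityI)
      show "g \<in> extensional \<Omega>" "h \<in> extensional \<Omega>" using gh G Bij_subset_extensional by blast+
      fix x assume x: "x \<in> \<Omega>"
      have "\<phi> (g x) = \<phi> (h x)" using \<psi>[OF x] gh(3) by metis
      then show "g x = h x"
        using bij_betw_imp_inj_on[OF \<phi>] gmem gh x by (auto dest: inj_onD)
    qed
  qed
  have hom: "\<psi> (g \<otimes>\<^bsub>group_of_perms \<Omega> G\<^esub> h) = \<psi> g \<otimes>\<^bsub>group_of_perms \<Omega>' G'\<^esub> \<psi> h"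
    if g: "g \<in> G" and h: "h \<in> G" for g h
  proof -
    have "\<psi> (compose \<Omega> g h) = compose \<Omega>' (\<psi> g) (\<psi> h)"
    proof (rule extensionalityI[of _ \<Omega>'])
      fix y assume y: "y \<in> \<Omega>'"
      define x where "x = inv_into \<Omega> \<phi> y"
      have x: "x \<in> \<Omega>" "y = \<phi> x" using inv'[OF y] by (auto simp: x_def)
      show "\<psi> (compose \<Omega> g h) y = compose \<Omega>' (\<psi> g) (\<psi> h) y"
        using y x gmem[OF h x(1)] by (simp add: \<psi> compose_eq)
    qed (auto simp: \<psi>_def compose_def)
    then show ?thesis
      using G'_Bij[OF g] G'_Bij[OF h] subsetD[OF G g] subsetD[OF G h] by (simp add: BijGroup_def)
  qed
  have "\<psi> \<in> iso (group_of_perms \<Omega> G) (group_of_perms \<Omega>' G')"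
    unfolding iso_def hom_def bij_betw_def using hom inj \<psi>G by auto
  then show ?thesis
    unfolding perm_isomorphic_def using \<phi> \<psi> by (intro exI[of _ \<phi>] exI[of _ \<psi>]) simp
qed

lemma perm_isomorphicE:
  assumes "perm_isomorphic \<Omega> G \<Omega>' G'"
  obtains \<phi> where "bij_betw \<phi> \<Omega> \<Omega>'" "\<And>g. g \<in> G \<Longrightarrow> \<exists>g'\<in>G'. \<forall>x\<in>\<Omega>. \<phi> (g x) = g' (\<phi> x)"
    "\<And>g'. g' \<in> G' \<Longrightarrow> \<exists>g\<in>G. \<forall>x\<in>\<Omega>. \<phi> (g x) = g' (\<phi> x)"
proof -
  obtain \<phi> \<psi> where \<phi>: "bij_betw \<phi> \<Omega> \<Omega>'" and \<psi>: "\<psi> \<in> iso (group_of_perms \<Omega> G) (group_of_perms \<Omega>' G')"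
    and eq: "\<forall>g\<in>G. \<forall>x\<in>\<Omega>. \<phi> (g x) = \<psi> g (\<phi> x)"
    using assms unfolding perm_isomorphic_def by blast
  have "\<psi> ` G = G'" using \<psi> by (simp add: iso_def bij_betw_def)
  show ?thesis
  proof (rule that[OF \<phi>])
    show "\<exists>g'\<in>G'. \<forall>x\<in>\<Omega>. \<phi> (g x) = g' (\<phi> x)" if "g \<in> G" for g
      using that eq \<open>\<psi> ` G = G'\<close> by (intro bexI[of _ "\<psi> g"]) auto
    show "\<exists>g\<in>G. \<forall>x\<in>\<Omega>. \<phi> (g x) = g' (\<phi> x)" if "g' \<in> G'" for g'
      using that eq \<open>\<psi> ` G = G'\<close> by blast
  qed
qed

lemma perm_isomorphic_trans:
  assumes G: "G \<subseteq> Bij \<Omega>" and G'': "G'' \<subseteq> extensional \<Omega>''" and G': "\<And>g x. g \<in> G' \<Longrightarrow> x \<in> \<Omega>' \<Longrightarrow> g x \<in> \<Omega>'"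
    and 1: "perm_isomorphic \<Omega> G \<Omega>' G'" and 2: "perm_isomorphic \<Omega>' G' \<Omega>'' G''"
  shows "perm_isomorphic \<Omega> G \<Omega>'' G''"
proof -
  obtain \<phi> where \<phi>: "bij_betw \<phi> \<Omega> \<Omega>'" "\<And>g. g \<in> G \<Longrightarrow> \<exists>g'\<in>G'. \<forall>x\<in>\<Omega>. \<phi> (g x) = g' (\<phi> x)"
    "\<And>g'. g' \<in> G' \<Longrightarrow> \<exists>g\<in>G. \<forall>x\<in>\<Omega>. \<phi> (g x) = g' (\<phi> x)"
    using perm_isomorphicE[OF 1] by blast
  obtain \<chi> where \<chi>: "bij_betw \<chi> \<Omega>' \<Omega>''" "\<And>g. g \<in> G' \<Longrightarrow> \<exists>g'\<in>G''. \<forall>x\<in>\<Omega>'. \<chi> (g x) = g' (\<chi> x)"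
    "\<And>g'. g' \<in> G'' \<Longrightarrow> \<exists>g\<in>G'. \<forall>x\<in>\<Omega>'. \<chi> (g x) = g' (\<chi> x)"
    using perm_isomorphicE[OF 2] by blast
  have \<phi>\<Omega>: "\<phi> x \<in> \<Omega>'" if "x \<in> \<Omega>" for x using bij_betw_apply[OF \<phi>(1) that] .
  show ?thesis
  proof (rule perm_isomorphicI[OF bij_betw_trans[OF \<phi>(1) \<chi>(1)] G G''])
    fix g assume "g \<in> G"
    then obtain g' where g': "g' \<in> G'" "\<forall>x\<in>\<Omega>. \<phi> (g x) = g' (\<phi> x)" using \<phi>(2) by blast
    then obtain g'' where g'': "g'' \<in> G''" "\<forall>x\<in>\<Omega>'. \<chi> (g' x) = g'' (\<chi> x)" using \<chi>(2) by blast
    then show "\<exists>g'\<in>G''. \<forall>x\<in>\<Omega>. (\<chi> \<circ> \<phi>) (g x) = g' ((\<chi> \<circ> \<phi>) x)"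
      using g' \<phi>\<Omega> by (intro bexI[of _ g'']) auto
  next
    fix g'' assume "g'' \<in> G''"
    then obtain g' where g'': "g' \<in> G'" "\<forall>x\<in>\<Omega>'. \<chi> (g' x) = g'' (\<chi> x)" using \<chi>(3) by blast
    then obtain g where g': "g \<in> G" "\<forall>x\<in>\<Omega>. \<phi> (g x) = g' (\<phi> x)" using \<phi>(3) by blast
    then show "\<exists>g\<in>G. \<forall>x\<in>\<Omega>. (\<chi> \<circ> \<phi>) (g x) = g'' ((\<chi> \<circ> \<phi>) x)"
      using g'' \<phi>\<Omega> by (intro bexI[of _ g]) auto
  qed
qed

section \<open>Towers from block systems\<close>

lemma block_system_eqI:
  assumes "block_system \<Omega> G \<Delta>" "B \<in> \<Delta>" "B' \<in> \<Delta>" "x \<in> B" "x \<in> B'" shows "B = B'"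
  using assms by (auto simp: block_system_def partition_on_def disjoint_def)

text \<open>The assumptions on \<phi> are the elementwise form of a permutation isomorphism between
  the Galois group on the embeddings of K and G on \<Omega>; blocks and embeddings are translated
  into each other through them alone.\<close>

locale galois_tower =
  fixes k K :: "complex set" and \<Omega> :: "'a set" and G :: "('a \<Rightarrow> 'a) set"
    and m :: nat and \<Delta> :: "nat \<Rightarrow> 'a set set" and \<phi> :: "(complex \<Rightarrow> complex) \<Rightarrow> 'a"
  assumes kK: "finite_ext k K" and nested: "nested_block_systems \<Omega> G m \<Delta>"
    and G: "perm_group \<Omega> G"
    and \<phi>: "bij_betw \<phi> (embeddings k K) \<Omega>"
    and gal1: "\<And>g. g \<in> Gal_perm_group k K \<Longrightarrow> \<exists>g'\<in>G. \<forall>\<tau>\<in>embeddings k K. \<phi> (g \<tau>) = g' (\<phi> \<tau>)"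
    and gal2: "\<And>g'. g' \<in> G \<Longrightarrow> \<exists>g\<in>Gal_perm_group k K. \<forall>\<tau>\<in>embeddings k K. \<phi> (g \<tau>) = g' (\<phi> \<tau>)"
begin

definition "L = normal_closure k K"
definition "\<iota> = (\<lambda>x\<in>K. x)"
definition "base_block i = (THE B. B \<in> \<Delta> i \<and> \<phi> \<iota> \<in> B)"
definition "emb_block i = {\<tau> \<in> embeddings k K. \<phi> \<tau> \<in> base_block i}"
definition "level i = fixed_field K (emb_block i)"

lemma k: "is_subfield k" and K: "is_subfield K" "k \<subseteq> K"
  using kK by (auto simp: finite_ext_def)

lemma kL: "finite_ext k L" and KL: "K \<subseteq> L" and L: "is_subfield L"
proof -
  show "finite_ext k L" "K \<subseteq> L" unfolding L_def by (rule finite_ext_normal_closure[OF kK])+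
  then show "is_subfield L" by (auto simp: finite_ext_def)
qed

lemma KL_ext: "finite_ext K L" by (rule finite_ext_base_change[OF kL K KL])

lemma emb_L: "\<tau> \<in> embeddings k K \<Longrightarrow> \<tau> ` K \<subseteq> L"
  unfolding L_def by (rule emb_image_subset_normal_closure)

lemma \<iota>: "\<iota> \<in> embeddings k K" unfolding \<iota>_def by (rule emb_id[OF K])

lemma compose_\<iota>: "\<sigma> \<in> embeddings k' L \<Longrightarrow> compose K \<sigma> \<iota> = restrict \<sigma> K"
  by (simp add: \<iota>_def compose_emb_id)

lemma compose_emb: "\<sigma> \<in> embeddings k L \<Longrightarrow> \<tau> \<in> embeddings k K \<Longrightarrow> compose K \<sigma> \<tau> \<in> embeddings k K"
  by (rule emb_compose[OF K _ _ emb_L])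

lemma Gal_perm_group_L: "Gal_perm_group k K = (\<lambda>\<sigma>. \<lambda>\<tau>\<in>embeddings k K. compose K \<sigma> \<tau>) ` embeddings k L"
  by (rule Gal_perm_group_eq[OF kK kL]) (simp add: L_def)

lemma gal_perm:
  assumes "\<sigma> \<in> embeddings k L"
  obtains g where "g \<in> G" "\<And>\<tau>. \<tau> \<in> embeddings k K \<Longrightarrow> \<phi> (compose K \<sigma> \<tau>) = g (\<phi> \<tau>)"
proof -
  have "(\<lambda>\<tau>\<in>embeddings k K. compose K \<sigma> \<tau>) \<in> Gal_perm_group k K"
    using assms by (auto simp: Gal_perm_group_L)
  from gal1[OF this] show ?thesis using that by auto
qed

lemma perm_gal:
  assumes "g \<in> G"
  obtains \<sigma> where "\<sigma> \<in> embeddings k L" "\<And>\<tau>. \<tau> \<in> embeddings k K \<Longrightarrow> \<phi> (compose K \<sigma> \<tau>) = g (\<phi> \<tau>)"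
  using gal2[OF assms] that by (auto simp: Gal_perm_group_L)

lemma block_system: "i \<le> m \<Longrightarrow> block_system \<Omega> G (\<Delta> i)"
  using nested by (simp add: nested_block_systems_def)

lemma \<phi>_mem: "\<tau> \<in> embeddings k K \<Longrightarrow> \<phi> \<tau> \<in> \<Omega>"
  using bij_betw_apply[OF \<phi>] .

lemma base_block:
  assumes "i \<le> m" shows "base_block i \<in> \<Delta> i" "\<phi> \<iota> \<in> base_block i"
proof -
  have "\<phi> \<iota> \<in> \<Union> (\<Delta> i)"
    using \<phi>_mem[OF \<iota>] block_system[OF assms] by (simp add: block_system_def partition_on_def)
  then have "\<exists>!B. B \<in> \<Delta> i \<and> \<phi> \<iota> \<in> B"
    using block_system_eqI[OF block_system[OF assms]] by blast
  from theI'[OF this] show "base_block i \<in> \<Delta> i" "\<phi> \<iota> \<in> base_block i"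
    by (simp_all add: base_block_def)
qed

lemma block_subset: "i \<le> m \<Longrightarrow> B \<in> \<Delta> i \<Longrightarrow> B \<subseteq> \<Omega>"
  using block_system[of i] by (auto simp: block_system_def partition_on_def)

lemma image_block: "i \<le> m \<Longrightarrow> g \<in> G \<Longrightarrow> B \<in> \<Delta> i \<Longrightarrow> g ` B \<in> \<Delta> i"
  using block_system[of i] by (auto simp: block_system_def)

lemma emb_block_\<iota>: "i \<le> m \<Longrightarrow> \<iota> \<in> emb_block i"
  using \<iota> base_block by (simp add: emb_block_def)

lemma image_emb_block: "i \<le> m \<Longrightarrow> \<phi> ` emb_block i = base_block i"
  using bij_betw_imp_surj_on[OF \<phi>] block_subset[OF _ base_block(1)] by (auto simp: emb_block_def)

text \<open>If \<sigma> sends one point of the set into the set, the matching g sends the base block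
  to a block meeting it, hence to itself. The resulting inclusion is an equality because composition
  with \<sigma> is injective on a finite set.\<close>

lemma galois_block_emb_block:
  assumes "i \<le> m" shows "galois_block k K (emb_block i)"
  unfolding galois_block_def
proof (intro conjI ballI impI)
  show "emb_block i \<subseteq> embeddings k K" by (auto simp: emb_block_def)
  show "(\<lambda>x\<in>K. x) \<in> emb_block i" using emb_block_\<iota>[OF assms] by (simp add: \<iota>_def)
  fix \<sigma> assume "\<sigma> \<in> embeddings k (normal_closure k K)"
    and ne: "compose K \<sigma> ` emb_block i \<inter> emb_block i \<noteq> {}"
  then have \<sigma>: "\<sigma> \<in> embeddings k L" by (simp add: L_def)
  obtain g where g: "g \<in> G" "\<And>\<tau>. \<tau> \<in> embeddings k K \<Longrightarrow> \<phi> (compose K \<sigma> \<tau>) = g (\<phi> \<tau>)"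
    using gal_perm[OF \<sigma>] by blast
  obtain \<tau> where \<tau>: "\<tau> \<in> emb_block i" "compose K \<sigma> \<tau> \<in> emb_block i" using ne by auto
  have "g (\<phi> \<tau>) \<in> g ` base_block i" "g (\<phi> \<tau>) \<in> base_block i"
    using \<tau> g(2)[of \<tau>] by (auto simp: emb_block_def)
  then have gB: "g ` base_block i = base_block i"
    using block_system_eqI[OF block_system[OF assms] image_block[OF assms g(1)]] base_block[OF assms] by blast
  have "compose K \<sigma> ` emb_block i \<subseteq> emb_block i"
    using g(2) gB compose_emb[OF \<sigma>] by (auto simp: emb_block_def)
  moreover have "finite (emb_block i)"
    using card_embeddings(1)[OF kK] by (simp add: emb_block_def)
  moreover have "inj_on (compose K \<sigma>) (emb_block i)"
    by (rule compose_emb_inj_on[OF L \<sigma>, of _ _ k]) (auto simp: emb_block_def dest: emb_L)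
  ultimately show "compose K \<sigma> ` emb_block i = emb_block i"
    by (intro endo_inj_surj)
qed

lemma level_ext: "i \<le> m \<Longrightarrow> finite_ext k (level i)" "i \<le> m \<Longrightarrow> finite_ext (level i) K"
  and emb_level: "i \<le> m \<Longrightarrow> embeddings (level i) K = emb_block i"
  unfolding level_def using fixed_field_galois_block[OF kK galois_block_emb_block] by auto

lemma level_0: "level 0 = K"
proof -
  have "base_block 0 \<in> (\<lambda>x. {x}) ` \<Omega>"
    using base_block(1)[of 0] nested by (simp add: nested_block_systems_def)
  then have "base_block 0 = {\<phi> \<iota>}" using base_block(2)[of 0] by auto
  then have "emb_block 0 = {\<iota>}"
    using \<iota> bij_betw_imp_inj_on[OF \<phi>] by (auto simp: emb_block_def dest: inj_onD)
  then show ?thesis by (auto simp: level_def fixed_field_def \<iota>_def)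
qed

lemma level_m: "level m = k"
proof -
  have "\<Delta> m = {\<Omega>}" using nested by (simp add: nested_block_systems_def)
  then have "base_block m = \<Omega>" using base_block(1)[of m] by simp
  then have "emb_block m = embeddings k K" using \<phi>_mem by (auto simp: emb_block_def)
  moreover have "x \<in> k" if "x \<in> fixed_field K (embeddings k K)" for x
    using in_base_if_fixed[OF kK] that by (simp add: fixed_field_def)
  moreover have "x \<in> fixed_field K (embeddings k K)" if "x \<in> k" for x
    using that K(2) emb_base[OF K(1)] by (auto simp: fixed_field_def)
  ultimately show ?thesis unfolding level_def by auto
qed

context
  fixes i assumes i: "i \<in> {1..m}"
begin

lemma i_le: "i \<le> m" "i - 1 \<le> m" using i by auto

lemma block_eq_Union: "B \<in> \<Delta> i \<Longrightarrow> B = \<Union> (subblocks \<Delta> i B)"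
  using nested i by (auto simp: nested_block_systems_def)

lemma base_block_pred_subset: "base_block (i - 1) \<subseteq> base_block i"
proof -
  have "\<phi> \<iota> \<in> \<Union> (subblocks \<Delta> i (base_block i))"
    using block_eq_Union[OF base_block(1)[OF i_le(1)]] base_block(2)[OF i_le(1)] by simp
  then obtain B' where B': "B' \<in> \<Delta> (i - 1)" "B' \<subseteq> base_block i" "\<phi> \<iota> \<in> B'"
    by (auto simp: subblocks_def)
  then have "B' = base_block (i - 1)"
    using block_system_eqI[OF block_system[OF i_le(2)]] base_block[OF i_le(2)] by blast
  then show ?thesis using B' by simp
qed

lemma level_subset: "level i \<subseteq> level (i - 1)"
  using base_block_pred_subset by (auto simp: level_def fixed_field_def emb_block_def)

lemma level_step: "finite_ext (level i) (level (i - 1))"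
proof -
  have "is_subfield (level (i - 1))" "level (i - 1) \<subseteq> K"
    using level_ext(2)[OF i_le(2)] by (auto simp: finite_ext_def)
  then show ?thesis using finite_ext_intermediate[OF level_ext(2)[OF i_le(1)] _ level_subset] by blast
qed

lemma level_L: "finite_ext (level i) L" "finite_ext (level (i - 1)) L"
  using finite_ext_trans[OF level_ext(2) KL_ext] i_le by auto

lemma emb_level_L_subset: "embeddings (level i) L \<subseteq> embeddings k L"
  using level_ext(1)[OF i_le(1)] by (intro emb_base_mono) (auto simp: finite_ext_def)

text \<open>A fibre of the restriction map from embeddings of K over \<open>level i\<close> to
  embeddings of \<open>level (i - 1)\<close>. Under \<phi> these fibres become the subblocks of the
  base block, and this is how embeddings of \<open>level (i - 1)\<close> correspond to
  subblocks.\<close>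

definition "fibre \<rho> = {\<tau> \<in> emb_block i. \<forall>x\<in>level (i - 1). \<tau> x = \<rho> x}"

lemma compose_emb_block:
  assumes "\<sigma> \<in> embeddings (level i) L" "\<tau> \<in> emb_block i" shows "compose K \<sigma> \<tau> \<in> emb_block i"
proof -
  have "\<tau> \<in> embeddings (level i) K" using assms(2) emb_level[OF i_le(1)] by simp
  moreover have "\<tau> ` K \<subseteq> L" using emb_L assms(2) by (auto simp: emb_block_def)
  ultimately have "compose K \<sigma> \<tau> \<in> embeddings (level i) K"
    using emb_compose[of K "level i" \<tau> \<sigma> L] K(1) assms(1) level_ext(2)[OF i_le(1)] by (simp add: finite_ext_def)
  then show ?thesis using emb_level[OF i_le(1)] by simp
qed

lemma compose_emb_block_bij:
  assumes "\<sigma> \<in> embeddings (level i) L" shows "bij_betw (compose K \<sigma>) (emb_block i) (emb_block i)"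
proof -
  have "bij_betw (compose K \<sigma>) (embeddings (level i) K) (embeddings (level i) K)"
  proof (rule compose_emb_surj[OF level_ext(2)[OF i_le(1)] L assms])
    fix \<tau> assume "\<tau> \<in> embeddings (level i) K"
    then show "\<tau> ` K \<subseteq> L" using emb_level[OF i_le(1)] emb_L by (auto simp: emb_block_def)
  qed
  then show ?thesis using emb_level[OF i_le(1)] by simp
qed

lemma emb_K_L: "\<tau> \<in> emb_block j \<Longrightarrow> x \<in> K \<Longrightarrow> \<tau> x \<in> L"
  using emb_L[of \<tau>] by (auto simp: emb_block_def)

lemma level_K: "level j \<subseteq> K" by (auto simp: level_def fixed_field_def)

text \<open>The fibre over the inclusion is \<open>emb_block (i - 1)\<close>, and composition with
  any \<sigma> that extends \<rho> carries it to the fibre over \<rho>.\<close>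

lemma fibre_eq:
  assumes \<sigma>: "\<sigma> \<in> embeddings (level i) L" and \<rho>: "\<And>x. x \<in> level (i - 1) \<Longrightarrow> \<sigma> x = \<rho> x"
  shows "fibre \<rho> = compose K \<sigma> ` emb_block (i - 1)"
proof (intro equalityI subsetI)
  fix \<tau> assume \<tau>: "\<tau> \<in> fibre \<rho>"
  then have "\<tau> \<in> compose K \<sigma> ` emb_block i"
    using bij_betw_imp_surj_on[OF compose_emb_block_bij[OF \<sigma>]] by (simp add: fibre_def)
  then obtain \<tau>1 where \<tau>1: "\<tau>1 \<in> emb_block i" "\<tau> = compose K \<sigma> \<tau>1" by blast
  have "\<tau>1 x = x" if x: "x \<in> level (i - 1)" for x
  proof -
    have xK: "x \<in> K" using x level_K by blast
    have "\<tau> x = \<rho> x" using \<tau> x by (simp add: fibre_def)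
    moreover have "\<tau> x = \<sigma> (\<tau>1 x)" using \<tau>1(2) xK by (simp add: compose_eq)
    ultimately have "\<sigma> (\<tau>1 x) = \<sigma> x" using \<rho>[OF x] by simp
    then show ?thesis
      using inj_onD[OF emb_inj[OF L \<sigma>]] emb_K_L[OF \<tau>1(1) xK] KL xK by blast
  qed
  then have "\<tau>1 \<in> embeddings (level (i - 1)) K"
    using \<tau>1(1) by (auto simp: emb_block_def embeddings_def)
  then show "\<tau> \<in> compose K \<sigma> ` emb_block (i - 1)"
    using \<tau>1 emb_level[OF i_le(2)] by blast
next
  fix \<tau> assume "\<tau> \<in> compose K \<sigma> ` emb_block (i - 1)"
  then obtain \<tau>1 where \<tau>1: "\<tau>1 \<in> emb_block (i - 1)" "\<tau> = compose K \<sigma> \<tau>1" by blast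
  have "\<tau>1 \<in> emb_block i" using \<tau>1(1) base_block_pred_subset by (auto simp: emb_block_def)
  moreover have "compose K \<sigma> \<tau>1 x = \<rho> x" if x: "x \<in> level (i - 1)" for x
  proof -
    have "\<tau>1 x = x" using \<tau>1(1) x by (auto simp: level_def fixed_field_def)
    moreover have "x \<in> K" using level_K x by blast
    ultimately show ?thesis using \<rho>[OF x] by (simp add: compose_eq)
  qed
  ultimately show "\<tau> \<in> fibre \<rho>" using \<tau>1 compose_emb_block[OF \<sigma>] by (simp add: fibre_def)
qed

lemma ex_extension_L:
  assumes "\<rho> \<in> embeddings (level i) (level (i - 1))"
  obtains \<sigma> where "\<sigma> \<in> embeddings (level i) L" "\<And>x. x \<in> level (i - 1) \<Longrightarrow> \<sigma> x = \<rho> x"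
  using ex_extension[OF level_step level_L(2) assms] by blast

lemma image_fibre:
  assumes \<rho>: "\<rho> \<in> embeddings (level i) (level (i - 1))"
  shows "\<phi> ` fibre \<rho> \<in> subblocks \<Delta> i (base_block i)"
proof -
  obtain \<sigma> where \<sigma>: "\<sigma> \<in> embeddings (level i) L" "\<And>x. x \<in> level (i - 1) \<Longrightarrow> \<sigma> x = \<rho> x"
    using ex_extension_L[OF \<rho>] by blast
  obtain g where g: "g \<in> G" "\<And>\<tau>. \<tau> \<in> embeddings k K \<Longrightarrow> \<phi> (compose K \<sigma> \<tau>) = g (\<phi> \<tau>)"
    using gal_perm[of \<sigma>] \<sigma>(1) emb_level_L_subset by blast
  have "fibre \<rho> = compose K \<sigma> ` emb_block (i - 1)" by (rule fibre_eq[OF \<sigma>])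
  then have "\<phi> ` fibre \<rho> = (\<lambda>\<tau>. \<phi> (compose K \<sigma> \<tau>)) ` emb_block (i - 1)"
    by (simp only: image_image)
  also have "\<dots> = (\<lambda>\<tau>. g (\<phi> \<tau>)) ` emb_block (i - 1)"
    by (rule image_cong) (auto simp: g(2) emb_block_def)
  also have "\<dots> = g ` base_block (i - 1)"
    using image_emb_block[OF i_le(2)] by (simp flip: image_image)
  finally have "\<phi> ` fibre \<rho> \<in> \<Delta> (i - 1)"
    using image_block[OF i_le(2) g(1)] base_block(1)[OF i_le(2)] by simp
  moreover have "\<phi> ` fibre \<rho> \<subseteq> base_block i"
    using image_emb_block[OF i_le(1)] by (auto simp: fibre_def)
  ultimately show ?thesis by (simp add: subblocks_def)
qed

lemma fibre_nonempty:
  assumes \<rho>: "\<rho> \<in> embeddings (level i) (level (i - 1))" shows "fibre \<rho> \<noteq> {}"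
proof -
  obtain \<sigma> where \<sigma>: "\<sigma> \<in> embeddings (level i) L" "\<And>x. x \<in> level (i - 1) \<Longrightarrow> \<sigma> x = \<rho> x"
    using ex_extension_L[OF \<rho>] by blast
  have "fibre \<rho> = compose K \<sigma> ` emb_block (i - 1)" by (rule fibre_eq[OF \<sigma>])
  then show ?thesis using emb_block_\<iota>[OF i_le(2)] by blast
qed

text \<open>Fibres are nonempty and determine \<rho>. For surjectivity, take \<tau> with \<phi>
  \<tau> in a given subblock: that subblock and the image of the fibre over the restriction of
  \<tau> are blocks with a common point.\<close>

lemma fibre_bij:
  "bij_betw (\<lambda>\<rho>. \<phi> ` fibre \<rho>) (embeddings (level i) (level (i - 1))) (subblocks \<Delta> i (base_block i))"
proof (rule bij_betw_imageI)
  show "inj_on (\<lambda>\<rho>. \<phi> ` fibre \<rho>) (embeddings (level i) (level (i - 1)))"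
  proof (rule inj_onI)
    fix \<rho> \<rho>' assume \<rho>: "\<rho> \<in> embeddings (level i) (level (i - 1))" "\<rho>' \<in> embeddings (level i) (level (i - 1))"
      and eq: "\<phi> ` fibre \<rho> = \<phi> ` fibre \<rho>'"
    have "fibre \<rho> \<subseteq> embeddings k K" "fibre \<rho>' \<subseteq> embeddings k K" by (auto simp: fibre_def emb_block_def)
    then have "fibre \<rho> = fibre \<rho>'"
      using eq inj_on_image_eq_iff[OF bij_betw_imp_inj_on[OF \<phi>]] by blast
    moreover obtain \<tau> where "\<tau> \<in> fibre \<rho>" using fibre_nonempty[OF \<rho>(1)] by blast
    ultimately have \<tau>: "\<tau> \<in> fibre \<rho>" "\<tau> \<in> fibre \<rho>'" by auto
    show "\<rho> = \<rho>'"
    proof (rule emb_ext[OF \<rho>])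
      fix x assume x: "x \<in> level (i - 1)"
      have "\<tau> x = \<rho> x" using \<tau>(1) x by (simp add: fibre_def)
      moreover have "\<tau> x = \<rho>' x" using \<tau>(2) x by (simp add: fibre_def)
      ultimately show "\<rho> x = \<rho>' x" by simp
    qed
  qed
  show "(\<lambda>\<rho>. \<phi> ` fibre \<rho>) ` embeddings (level i) (level (i - 1)) = subblocks \<Delta> i (base_block i)"
  proof (intro equalityI image_subsetI image_fibre)
    show "subblocks \<Delta> i (base_block i) \<subseteq> (\<lambda>\<rho>. \<phi> ` fibre \<rho>) ` embeddings (level i) (level (i - 1))"
    proof
      fix B' assume B': "B' \<in> subblocks \<Delta> i (base_block i)"
      then have "B' \<in> \<Delta> (i - 1)" "B' \<subseteq> base_block i" by (auto simp: subblocks_def)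
      moreover have "B' \<noteq> {}"
        using \<open>B' \<in> \<Delta> (i - 1)\<close> block_system[OF i_le(2)] by (auto simp: block_system_def partition_on_def)
      ultimately obtain \<omega> where \<omega>: "\<omega> \<in> B'" "\<omega> \<in> base_block i" by blast
      then obtain \<tau> where \<tau>: "\<tau> \<in> emb_block i" "\<omega> = \<phi> \<tau>" using image_emb_block[OF i_le(1)] by blast
      define \<rho> where "\<rho> = restrict \<tau> (level (i - 1))"
      have \<rho>: "\<rho> \<in> embeddings (level i) (level (i - 1))"
        unfolding \<rho>_def using \<tau>(1) emb_level[OF i_le(1)] level_K level_subset level_step
        by (intro emb_restrict[of _ _ K]) (auto simp: finite_ext_def)
      have "\<tau> \<in> fibre \<rho>" using \<tau> by (simp add: fibre_def \<rho>_def)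
      then have "\<omega> \<in> \<phi> ` fibre \<rho>" using \<tau> by blast
      then have "\<phi> ` fibre \<rho> = B'"
        using image_fibre[OF \<rho>] \<open>B' \<in> \<Delta> (i - 1)\<close> \<omega>(1) block_system_eqI[OF block_system[OF i_le(2)]]
        by (auto simp: subblocks_def)
      then show "B' \<in> (\<lambda>\<rho>. \<phi> ` fibre \<rho>) ` embeddings (level i) (level (i - 1))" using \<rho> by blast
    qed
  qed
qed

lemma normal_closure_level: "normal_closure (level i) (level (i - 1)) \<subseteq> L"
proof (rule normal_closure_subset[OF L])
  fix \<rho> assume "\<rho> \<in> embeddings (level i) (level (i - 1))"
  then obtain \<tau> where \<tau>: "\<tau> \<in> fibre \<rho>" using fibre_nonempty by blast
  show "\<rho> ` level (i - 1) \<subseteq> L"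
  proof clarify
    fix x assume x: "x \<in> level (i - 1)"
    then have "\<tau> x = \<rho> x" using \<tau> by (simp add: fibre_def)
    then show "\<rho> x \<in> L" using emb_K_L[of \<tau> i x] \<tau> x level_K by (auto simp: fibre_def)
  qed
qed

lemma emb_level_level_L:
  assumes \<rho>: "\<rho> \<in> embeddings (level i) (level (i - 1))" shows "\<rho> ` level (i - 1) \<subseteq> L"
  using emb_image_subset_normal_closure[OF \<rho>] normal_closure_level by blast

lemma compose_level:
  assumes \<sigma>: "\<sigma> \<in> embeddings (level i) L" and \<rho>: "\<rho> \<in> embeddings (level i) (level (i - 1))"
  shows "compose (level (i - 1)) \<sigma> \<rho> \<in> embeddings (level i) (level (i - 1))"
  using level_step by (intro emb_compose[OF _ _ \<rho> \<sigma> emb_level_level_L[OF \<rho>]]) (auto simp: finite_ext_def)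

lemma perm_stabilizes:
  assumes \<sigma>: "\<sigma> \<in> embeddings (level i) L" and g: "g \<in> G" "\<And>\<tau>. \<tau> \<in> embeddings k K \<Longrightarrow> \<phi> (compose K \<sigma> \<tau>) = g (\<phi> \<tau>)"
  shows "g ` base_block i = base_block i"
proof -
  have "compose K \<sigma> \<iota> \<in> emb_block i" by (rule compose_emb_block[OF \<sigma> emb_block_\<iota>[OF i_le(1)]])
  then have "g (\<phi> \<iota>) \<in> base_block i" using g(2)[OF \<iota>] by (simp add: emb_block_def)
  moreover have "g (\<phi> \<iota>) \<in> g ` base_block i" using base_block(2)[OF i_le(1)] by blast
  ultimately show ?thesis
    using block_system_eqI[OF block_system[OF i_le(1)] image_block[OF i_le(1) g(1)]] base_block[OF i_le(1)] by blast
qed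

text \<open>Both sides are blocks of \<open>\<Delta> (i - 1)\<close>, so one common point is enough:
  \<open>g (\<phi> \<tau>)\<close> for any \<tau> in the fibre over \<rho>.\<close>

lemma image_fibre_compose:
  assumes \<sigma>: "\<sigma> \<in> embeddings (level i) L" and g: "g \<in> G" "\<And>\<tau>. \<tau> \<in> embeddings k K \<Longrightarrow> \<phi> (compose K \<sigma> \<tau>) = g (\<phi> \<tau>)"
    and \<rho>: "\<rho> \<in> embeddings (level i) (level (i - 1))"
  shows "\<phi> ` fibre (compose (level (i - 1)) \<sigma> \<rho>) = g ` \<phi> ` fibre \<rho>"
proof -
  obtain \<tau> where \<tau>: "\<tau> \<in> fibre \<rho>" using fibre_nonempty[OF \<rho>] by blast
  then have \<tau>i: "\<tau> \<in> emb_block i" by (simp add: fibre_def)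
  have "compose K \<sigma> \<tau> \<in> fibre (compose (level (i - 1)) \<sigma> \<rho>)"
    using compose_emb_block[OF \<sigma> \<tau>i] \<tau> level_K by (auto simp: fibre_def compose_def)
  then have 1: "g (\<phi> \<tau>) \<in> \<phi> ` fibre (compose (level (i - 1)) \<sigma> \<rho>)"
    using g(2)[of \<tau>] \<tau>i by (force simp: emb_block_def)
  have 2: "g (\<phi> \<tau>) \<in> g ` \<phi> ` fibre \<rho>" using \<tau> by blast
  have "\<phi> ` fibre (compose (level (i - 1)) \<sigma> \<rho>) \<in> \<Delta> (i - 1)" "g ` \<phi> ` fibre \<rho> \<in> \<Delta> (i - 1)"
    using image_fibre[OF compose_level[OF \<sigma> \<rho>]] image_fibre[OF \<rho>] image_block[OF i_le(2) g(1)]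
    by (auto simp: subblocks_def)
  then show ?thesis using block_system_eqI[OF block_system[OF i_le(2)]] 1 2 by blast
qed

lemma Gal_perm_group_level:
  "Gal_perm_group (level i) (level (i - 1)) =
   (\<lambda>\<sigma>. \<lambda>\<rho>\<in>embeddings (level i) (level (i - 1)). compose (level (i - 1)) \<sigma> \<rho>) ` embeddings (level i) L"
  by (rule Gal_perm_group_eq[OF level_step level_L(1) normal_closure_level])

lemma Gal_perm_group_level_Bij:
  "Gal_perm_group (level i) (level (i - 1)) \<subseteq> Bij (embeddings (level i) (level (i - 1)))"
proof -
  have "bij_betw (\<lambda>\<rho>\<in>embeddings (level i) (level (i - 1)). compose (level (i - 1)) \<sigma> \<rho>)
     (embeddings (level i) (level (i - 1))) (embeddings (level i) (level (i - 1)))"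
    if "\<sigma> \<in> embeddings (level i) L" for \<sigma>
    by (subst bij_betw_cong[of _ _ "compose (level (i - 1)) \<sigma>"])
      (use compose_emb_surj[OF level_step L that emb_level_level_L] in auto)
  then show ?thesis unfolding Gal_perm_group_level Bij_def by auto
qed

text \<open>The elements of G that stabilize the base block are matched with the embeddings of L
  over \<open>level i\<close>, and \<open>fibre_bij\<close> intertwines the two actions.\<close>

lemma perm_isomorphic_level:
  "perm_isomorphic (embeddings (level i) (level (i - 1))) (Gal_perm_group (level i) (level (i - 1)))
     (subblocks \<Delta> i (base_block i)) (induced_perm_group G (base_block i) (subblocks \<Delta> i (base_block i)))"
  (is "perm_isomorphic ?E ?P ?D ?I")
proof (rule perm_isomorphicI[OF fibre_bij Gal_perm_group_level_Bij])
  show "?I \<subseteq> extensional ?D" by (auto simp: induced_perm_group_def)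
next
  fix g assume "g \<in> ?P"
  then obtain \<sigma> where \<sigma>: "\<sigma> \<in> embeddings (level i) L" "g = (\<lambda>\<rho>\<in>?E. compose (level (i - 1)) \<sigma> \<rho>)"
    unfolding Gal_perm_group_level by blast
  obtain h where h: "h \<in> G" "\<And>\<tau>. \<tau> \<in> embeddings k K \<Longrightarrow> \<phi> (compose K \<sigma> \<tau>) = h (\<phi> \<tau>)"
    using gal_perm[of \<sigma>] \<sigma>(1) emb_level_L_subset by blast
  have "(\<lambda>B'\<in>?D. h ` B') \<in> ?I"
    using h(1) perm_stabilizes[OF \<sigma>(1) h] by (auto simp: induced_perm_group_def)
  moreover have "\<phi> ` fibre (g \<rho>) = (\<lambda>B'\<in>?D. h ` B') (\<phi> ` fibre \<rho>)" if "\<rho> \<in> ?E" for \<rho>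
    using that image_fibre_compose[OF \<sigma>(1) h that] image_fibre[OF that] \<sigma>(2) by simp
  ultimately show "\<exists>g'\<in>?I. \<forall>\<rho>\<in>?E. \<phi> ` fibre (g \<rho>) = g' (\<phi> ` fibre \<rho>)" by blast
next
  fix g' assume "g' \<in> ?I"
  then obtain h where h: "h \<in> G" "h ` base_block i = base_block i" "g' = (\<lambda>B'\<in>?D. h ` B')"
    by (auto simp: induced_perm_group_def)
  obtain \<sigma> where \<sigma>: "\<sigma> \<in> embeddings k L" "\<And>\<tau>. \<tau> \<in> embeddings k K \<Longrightarrow> \<phi> (compose K \<sigma> \<tau>) = h (\<phi> \<tau>)"
    using perm_gal[OF h(1)] by blast
  \<comment> \<open>As h stabilizes the base block, \<sigma> moves the inclusion of K to a member of
    \<open>emb_block i\<close>; this says that \<sigma> fixes \<open>level i\<close>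
    pointwise.\<close>
  have "\<phi> (compose K \<sigma> \<iota>) \<in> base_block i"
    using \<sigma>(2)[OF \<iota>] h(2) base_block(2)[OF i_le(1)] by auto
  then have "compose K \<sigma> \<iota> \<in> emb_block i"
    using compose_emb[OF \<sigma>(1) \<iota>] by (simp add: emb_block_def)
  then have "restrict \<sigma> K \<in> emb_block i" using compose_\<iota>[OF \<sigma>(1)] by simp
  then have "\<sigma> x = x" if "x \<in> level i" for x
    using that by (force simp: level_def fixed_field_def)
  then have \<sigma>': "\<sigma> \<in> embeddings (level i) L" using \<sigma>(1) by (simp add: embeddings_def)
  have "(\<lambda>\<rho>\<in>?E. compose (level (i - 1)) \<sigma> \<rho>) \<in> ?P"
    unfolding Gal_perm_group_level using \<sigma>' by blast
  moreover have "\<phi> ` fibre ((\<lambda>\<rho>\<in>?E. compose (level (i - 1)) \<sigma> \<rho>) \<rho>) = g' (\<phi> ` fibre \<rho>)" if "\<rho> \<in> ?E" for \<rho>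
    using that image_fibre_compose[OF \<sigma>' h(1) \<sigma>(2) that] image_fibre[OF that] h(3) by simp
  ultimately show "\<exists>g\<in>?P. \<forall>\<rho>\<in>?E. \<phi> ` fibre (g \<rho>) = g' (\<phi> ` fibre \<rho>)" by blast
qed

end

end

lemma tower_of_fields:
  assumes kK: "finite_ext k K" and G: "perm_group \<Omega> G" and tower: "tower_type \<Omega> G m S H"
    and iso: "perm_isomorphic (embeddings k K) (Gal_perm_group k K) \<Omega> G"
  obtains F where "F 0 = K" "F m = k"
    "\<And>i. i \<in> {1..m} \<Longrightarrow> finite_ext (F i) (F (i - 1)) \<and> card (embeddings (F i) (F (i - 1))) = card (S i) \<and>
       perm_isomorphic (embeddings (F i) (F (i - 1))) (Gal_perm_group (F i) (F (i - 1))) (S i) (H i) \<and> 2 \<le> card (S i)"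
proof -
  obtain \<Delta> where nested: "nested_block_systems \<Omega> G m \<Delta>"
    and H: "\<And>i. i \<in> {1..m} \<Longrightarrow> perm_group (S i) (H i)"
    and isoH: "\<And>i B. i \<in> {1..m} \<Longrightarrow> B \<in> \<Delta> i \<Longrightarrow> perm_isomorphic (subblocks \<Delta> i B)
       (induced_perm_group G B (subblocks \<Delta> i B)) (S i) (H i)"
    using tower unfolding tower_type_def by blast
  obtain \<phi> where \<phi>: "bij_betw \<phi> (embeddings k K) \<Omega>"
    "\<And>g. g \<in> Gal_perm_group k K \<Longrightarrow> \<exists>g'\<in>G. \<forall>\<tau>\<in>embeddings k K. \<phi> (g \<tau>) = g' (\<phi> \<tau>)"
    "\<And>g'. g' \<in> G \<Longrightarrow> \<exists>g\<in>Gal_perm_group k K. \<forall>\<tau>\<in>embeddings k K. \<phi> (g \<tau>) = g' (\<phi> \<tau>)"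
    using perm_isomorphicE[OF iso] by blast
  interpret galois_tower k K \<Omega> G m \<Delta> \<phi>
    by unfold_locales (use kK nested G \<phi> in blast)+
  show ?thesis
  proof (rule that[of level])
    show "level 0 = K" "level m = k" by (rule level_0 level_m)+
    fix i assume i: "i \<in> {1..m}"
    let ?D = "subblocks \<Delta> i (base_block i)"
    have B: "base_block i \<in> \<Delta> i" using base_block(1) i by simp
    have "subgroup (H i) (BijGroup (S i))" using H[OF i] by (simp add: perm_group_def)
    then have "H i \<subseteq> carrier (BijGroup (S i))" by (rule subgroup.subset)
    then have HS: "H i \<subseteq> Bij (S i)" by (simp add: BijGroup_def)
    have iso1: "perm_isomorphic ?D (induced_perm_group G (base_block i) ?D) (S i) (H i)"
      by (rule isoH[OF i B])
    have "perm_isomorphic (embeddings (level i) (level (i - 1))) (Gal_perm_group (level i) (level (i - 1))) (S i) (H i)"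
    proof (rule perm_isomorphic_trans[OF Gal_perm_group_level_Bij[OF i] _ _ perm_isomorphic_level[OF i] iso1])
      show "H i \<subseteq> extensional (S i)" using HS Bij_subset_extensional by blast
      fix g B' assume g: "g \<in> induced_perm_group G (base_block i) ?D" and B': "B' \<in> ?D"
      then obtain h where h: "h \<in> G" "h ` base_block i = base_block i" "g B' = h ` B'"
        by (auto simp: induced_perm_group_def)
      show "g B' \<in> ?D"
        using B' h image_block[of "i - 1" h B'] i by (auto simp: subblocks_def)
    qed
    moreover have "card (embeddings (level i) (level (i - 1))) = card (S i)"
      using bij_betw_same_card[OF fibre_bij[OF i]] perm_isomorphicE[OF iso1] bij_betw_same_card by metis
    moreover have "2 \<le> card ?D"
      using nested i B by (auto simp: nested_block_systems_def)
    then have "2 \<le> card (S i)" using perm_isomorphicE[OF iso1] bij_betw_same_card by metis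
    ultimately show "finite_ext (level i) (level (i - 1)) \<and> card (embeddings (level i) (level (i - 1))) = card (S i) \<and>
       perm_isomorphic (embeddings (level i) (level (i - 1))) (Gal_perm_group (level i) (level (i - 1))) (S i) (H i) \<and> 2 \<le> card (S i)"
      using level_step[OF i] by blast
  qed
qed

section \<open>Discriminants\<close>

subsection \<open>Galois invariance of traces and norms\<close>

text \<open>With A' = A this gives the Galois invariance of a trace; with A the embeddings over F
  and A' the extensions of a conjugate of F it gives the transitivity of traces.\<close>

lemma sum_embeddings_fixed:
  assumes \<sigma>: "\<sigma> \<in> embeddings k L" and L: "is_subfield L" and A: "bij_betw (compose K \<sigma>) A A'"
    and sub: "\<And>\<tau>. \<tau> \<in> A \<Longrightarrow> \<tau> ` K \<subseteq> L" and x: "x \<in> K"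
  shows "\<sigma> (\<Sum>\<tau>\<in>A. \<tau> x) = (\<Sum>\<tau>\<in>A'. \<tau> x)"
proof -
  have "\<sigma> (\<Sum>\<tau>\<in>A. \<tau> x) = (\<Sum>\<tau>\<in>A. \<sigma> (\<tau> x))"
    by (rule emb_sum[OF L \<sigma>]) (use sub x in blast)
  also have "\<dots> = (\<Sum>\<tau>\<in>A. compose K \<sigma> \<tau> x)" using x by (simp add: compose_eq)
  also have "\<dots> = (\<Sum>\<tau>\<in>A'. \<tau> x)" by (rule sum.reindex_bij_betw[OF A])
  finally show ?thesis .
qed

lemma prod_embeddings_fixed:
  assumes K: "is_subfield K" and \<sigma>: "\<sigma> \<in> embeddings k L" and L: "is_subfield L" and A: "bij_betw (compose K \<sigma>) A A'"
    and sub: "\<And>\<tau>. \<tau> \<in> A \<Longrightarrow> \<tau> \<in> embeddings k K \<and> \<tau> ` K \<subseteq> L" and f: "f \<in> polys K"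
  shows "map_poly \<sigma> (\<Prod>\<tau>\<in>A. map_poly \<tau> f) = (\<Prod>\<tau>\<in>A'. map_poly \<tau> f)"
    "(\<Prod>\<tau>\<in>A. map_poly \<tau> f) \<in> polys L"
proof -
  have fL: "map_poly \<tau> f \<in> polys L" if "\<tau> \<in> A" for \<tau>
    using sub[OF that] f emb_0[OF K] by (auto simp: polys_def coeff_map_poly)
  then show "(\<Prod>\<tau>\<in>A. map_poly \<tau> f) \<in> polys L"
    using map_poly_emb_prod[OF L \<sigma>, of A "\<lambda>\<tau>. map_poly \<tau> f"] by blast
  have "map_poly \<sigma> (\<Prod>\<tau>\<in>A. map_poly \<tau> f) = (\<Prod>\<tau>\<in>A. map_poly \<sigma> (map_poly \<tau> f))"
    using map_poly_emb_prod[OF L \<sigma>, of A "\<lambda>\<tau>. map_poly \<tau> f"] fL by blast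
  also have "\<dots> = (\<Prod>\<tau>\<in>A. map_poly (compose K \<sigma> \<tau>) f)"
  proof (rule prod.cong)
    fix \<tau> assume \<tau>: "\<tau> \<in> A"
    have 0: "\<tau> 0 = 0" "\<sigma> 0 = 0" using emb_0[OF K, of \<tau> k] emb_0[OF L \<sigma>] sub[OF \<tau>] by auto
    have "compose K \<sigma> \<tau> 0 = 0" using 0 subfield_0[OF K] by (simp add: compose_eq)
    then show "map_poly \<sigma> (map_poly \<tau> f) = map_poly (compose K \<sigma> \<tau>) f"
      using f 0 by (intro poly_eqI) (simp add: coeff_map_poly compose_eq polys_def)
  qed simp
  also have "\<dots> = (\<Prod>\<tau>\<in>A'. map_poly \<tau> f)"
    by (rule prod.reindex_bij_betw[OF A])
  finally show "map_poly \<sigma> (\<Prod>\<tau>\<in>A. map_poly \<tau> f) = (\<Prod>\<tau>\<in>A'. map_poly \<tau> f)" .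
qed

lemma compose_normal_closure_bij:
  assumes kK: "finite_ext k K" and \<sigma>: "\<sigma> \<in> embeddings k (normal_closure k K)"
  shows "bij_betw (compose K \<sigma>) (embeddings k K) (embeddings k K)"
  using compose_emb_surj[OF kK _ \<sigma>] emb_image_subset_normal_closure finite_ext_normal_closure(1)[OF kK]
  by (simp add: finite_ext_def)

lemma trace_in_base:
  assumes kK: "finite_ext k K" and x: "x \<in> K"
  shows "(\<Sum>\<tau>\<in>embeddings k K. \<tau> x) \<in> k"
proof (rule in_base_if_fixed[OF finite_ext_normal_closure(1)[OF kK]])
  have L: "is_subfield (normal_closure k K)" using finite_ext_normal_closure(1)[OF kK] by (simp add: finite_ext_def)
  show "(\<Sum>\<tau>\<in>embeddings k K. \<tau> x) \<in> normal_closure k K"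
    using emb_image_subset_normal_closure x by (intro subfield_sum[OF L]) blast
  fix \<sigma> assume \<sigma>: "\<sigma> \<in> embeddings k (normal_closure k K)"
  show "\<sigma> (\<Sum>\<tau>\<in>embeddings k K. \<tau> x) = (\<Sum>\<tau>\<in>embeddings k K. \<tau> x)"
    by (rule sum_embeddings_fixed[OF \<sigma> L compose_normal_closure_bij[OF kK \<sigma>] emb_image_subset_normal_closure x])
qed

text \<open>The norm from K[t] to \<rat>[t].\<close>

definition norm_poly :: "complex set \<Rightarrow> complex poly \<Rightarrow> complex poly" where
  "norm_poly K f = (\<Prod>\<tau>\<in>embeddings \<rat> K. map_poly \<tau> f)"

lemma norm_poly_in_Rats:
  assumes K: "finite_ext \<rat> K" and f: "f \<in> polys K"
  shows "norm_poly K f \<in> polys \<rat>"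
proof -
  define L where "L = normal_closure \<rat> K"
  have QL: "finite_ext \<rat> L" unfolding L_def by (rule finite_ext_normal_closure(1)[OF K])
  have sub: "is_subfield L" "is_subfield K" using QL K by (simp_all add: finite_ext_def)
  have emb: "\<tau> \<in> embeddings \<rat> K \<Longrightarrow> \<tau> \<in> embeddings \<rat> K \<and> \<tau> ` K \<subseteq> L" for \<tau>
    unfolding L_def using emb_image_subset_normal_closure by blast
  have inv: "map_poly \<sigma> (norm_poly K f) = norm_poly K f \<and> norm_poly K f \<in> polys L"
    if "\<sigma> \<in> embeddings \<rat> L" for \<sigma>
    unfolding norm_poly_def
    using prod_embeddings_fixed[OF sub(2) that sub(1) _ emb f] compose_normal_closure_bij[OF K] that
    unfolding L_def by blast
  have L0: "norm_poly K f \<in> polys L"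
    using inv[OF emb_id[OF sub(1)]] Rats_subset_subfield[OF sub(1)] by blast
  have "coeff (norm_poly K f) i \<in> \<rat>" for i
  proof (rule in_base_if_fixed[OF QL])
    show "coeff (norm_poly K f) i \<in> L" using L0 by (simp add: polys_def)
    fix \<sigma> assume "\<sigma> \<in> embeddings \<rat> L"
    then show "\<sigma> (coeff (norm_poly K f) i) = coeff (norm_poly K f) i"
      using arg_cong[OF conjunct1[OF inv], of \<sigma> "\<lambda>p. coeff p i"] emb_0[OF sub(1)]
      by (simp add: coeff_map_poly)
  qed
  then show ?thesis by (simp add: polys_def)
qed

text \<open>The cofactor is the product of the other conjugates of f. Embeddings over K fix the
  inclusion and hence permute the remaining embeddings of K, so this product has coefficients in K.
  It supplies the second polynomial for the Prague theorem.\<close>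

lemma norm_poly_cofactor:
  assumes K: "finite_ext \<rat> K" and f: "f \<in> polys K"
  obtains g where "g \<in> polys K" "norm_poly K f = f * g"
proof -
  define L where "L = normal_closure \<rat> K"
  define \<iota> where "\<iota> = (\<lambda>x\<in>K. x)"
  define A where "A = embeddings \<rat> K - {\<iota>}"
  have QL: "finite_ext \<rat> L" and KL': "K \<subseteq> L" unfolding L_def by (rule finite_ext_normal_closure[OF K])+
  have sub: "is_subfield L" "is_subfield K" and QK: "\<rat> \<subseteq> K" using QL K by (simp_all add: finite_ext_def)
  have KL: "finite_ext K L" by (rule finite_ext_base_change[OF QL sub(2) QK KL'])
  have \<iota>: "\<iota> \<in> embeddings \<rat> K" unfolding \<iota>_def by (rule emb_id[OF sub(2) QK])
  have emb: "\<tau> \<in> A \<Longrightarrow> \<tau> \<in> embeddings \<rat> K \<and> \<tau> ` K \<subseteq> L" for \<tau>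
    unfolding L_def A_def using emb_image_subset_normal_closure by blast
  define g where "g = (\<Prod>\<tau>\<in>A. map_poly \<tau> f)"
  have inv: "map_poly \<sigma> g = g \<and> g \<in> polys L" if \<sigma>: "\<sigma> \<in> embeddings K L" for \<sigma>
  proof -
    have \<sigma>Q: "\<sigma> \<in> embeddings \<rat> L" using \<sigma> emb_base_mono[OF QK] by blast
    have "compose K \<sigma> \<iota> = \<iota>"
      unfolding \<iota>_def using compose_emb_id[OF \<sigma>] emb_base[OF sub(1) \<sigma>] by auto
    moreover have bij: "bij_betw (compose K \<sigma>) (embeddings \<rat> K) (embeddings \<rat> K)"
      using compose_normal_closure_bij[OF K] \<sigma>Q by (simp add: L_def)
    ultimately have "bij_betw (compose K \<sigma>) A A"
      unfolding A_def using bij_betw_DiffI[of "compose K \<sigma>" "embeddings \<rat> K" "embeddings \<rat> K" "{\<iota>}" "{\<iota>}"] \<iota>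
      by (simp add: bij_betw_def)
    then show ?thesis
      unfolding g_def using prod_embeddings_fixed[OF sub(2) \<sigma>Q sub(1) _ emb f] by blast
  qed
  have gL: "g \<in> polys L" using inv[OF emb_id[OF sub(1) KL']] by blast
  have "coeff g i \<in> K" for i
  proof (rule in_base_if_fixed[OF KL])
    show "coeff g i \<in> L" using gL by (simp add: polys_def)
    fix \<sigma> assume "\<sigma> \<in> embeddings K L"
    then show "\<sigma> (coeff g i) = coeff g i"
      using arg_cong[OF conjunct1[OF inv], of \<sigma> "\<lambda>p. coeff p i"] emb_0[OF sub(1)]
      by (simp add: coeff_map_poly)
  qed
  then have "g \<in> polys K" by (simp add: polys_def)
  moreover have "norm_poly K f = f * g"
  proof -
    have "map_poly \<iota> f = f"
      using f emb_0[OF sub(2) \<iota>] by (intro poly_eqI) (auto simp: coeff_map_poly \<iota>_def polys_def)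
    then show ?thesis
      unfolding norm_poly_def g_def A_def
      using prod.remove[OF card_embeddings(1)[OF K] \<iota>, of "\<lambda>\<tau>. map_poly \<tau> f"] by simp
  qed
  ultimately show ?thesis using that by blast
qed

lemma norm_poly_mult:
  assumes K: "finite_ext \<rat> K" and f: "f \<in> polys K" "g \<in> polys K"
  shows "norm_poly K (f * g) = norm_poly K f * norm_poly K g"
proof -
  have sub: "is_subfield K" using K by (simp add: finite_ext_def)
  have "map_poly \<tau> (f * g) = map_poly \<tau> f * map_poly \<tau> g" if "\<tau> \<in> embeddings \<rat> K" for \<tau>
    using map_poly_emb_prod[OF sub that, of UNIV "\<lambda>b. if b then f else g"] f by (simp add: UNIV_bool mult.commute)
  then show ?thesis by (simp add: norm_poly_def prod.distrib)
qed

lemma norm_poly_Rats: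
  assumes K: "finite_ext \<rat> K" and h: "h \<in> polys \<rat>"
  shows "norm_poly K h = h ^ card (embeddings \<rat> K)"
proof -
  have sub: "is_subfield K" using K by (simp add: finite_ext_def)
  have "map_poly \<tau> h = h" if "\<tau> \<in> embeddings \<rat> K" for \<tau>
    using h emb_0[OF sub that] emb_base[OF sub that] by (intro poly_eqI) (simp add: coeff_map_poly polys_def)
  then show ?thesis by (simp add: norm_poly_def)
qed

lemma norm_poly_nonzero:
  assumes K: "finite_ext \<rat> K" and f: "f \<in> polys K" "f \<noteq> 0"
  shows "norm_poly K f \<noteq> 0"
proof -
  have sub: "is_subfield K" using K by (simp add: finite_ext_def)
  have "map_poly \<tau> f \<noteq> 0" if "\<tau> \<in> embeddings \<rat> K" for \<tau>
  proof
    assume "map_poly \<tau> f = 0"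
    then have "\<tau> (lead_coeff f) = 0"
      using emb_0[OF sub that] by (metis coeff_0 coeff_map_poly)
    then show False using emb_eq_0_iff[OF sub that] f by (auto simp: polys_def)
  qed
  then show ?thesis using card_embeddings(1)[OF K] by (simp add: norm_poly_def)
qed

text \<open>Composition with \<sigma> maps injectively into the extensions of the restriction of
  \<sigma> to F, and both sets have [K : F] elements.\<close>

lemma extensions_bij:
  assumes kF: "finite_ext \<rat> F" and FK: "finite_ext F K" and \<sigma>: "\<sigma> \<in> embeddings \<rat> (normal_closure \<rat> K)"
  shows "bij_betw (compose K \<sigma>) (embeddings F K) (extensions F K (restrict \<sigma> F))"
proof -
  have K: "finite_ext \<rat> K" by (rule finite_ext_trans[OF kF FK])
  have sub: "is_subfield K" "is_subfield F" "F \<subseteq> K" "\<rat> \<subseteq> F" "\<rat> \<subseteq> K" using kF FK by (auto simp: finite_ext_def)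
  have L: "is_subfield (normal_closure \<rat> K)" "K \<subseteq> normal_closure \<rat> K"
    using finite_ext_normal_closure[OF K] by (auto simp: finite_ext_def)
  have FQ: "embeddings F K \<subseteq> embeddings \<rat> K" by (rule emb_base_mono[OF sub(4)])
  have img: "\<tau> ` K \<subseteq> normal_closure \<rat> K" if "\<tau> \<in> embeddings F K" for \<tau>
    using that FQ emb_image_subset_normal_closure by blast
  have inj: "inj_on (compose K \<sigma>) (embeddings F K)"
    by (rule compose_emb_inj_on[OF L(1) \<sigma> img]) auto
  have into: "compose K \<sigma> ` embeddings F K \<subseteq> extensions F K (restrict \<sigma> F)"
  proof (rule image_subsetI)
    fix \<tau> assume \<tau>: "\<tau> \<in> embeddings F K"
    have "compose K \<sigma> \<tau> \<in> embeddings \<rat> K"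
      by (rule emb_compose[OF sub(1,5) _ \<sigma> img[OF \<tau>]]) (use FQ \<tau> in blast)
    moreover have "compose K \<sigma> \<tau> x = restrict \<sigma> F x" if "x \<in> F" for x
    proof -
      have "x \<in> K" using that sub by blast
      then show ?thesis using that emb_base[OF sub(1) \<tau> that] by (simp add: compose_eq)
    qed
    ultimately show "compose K \<sigma> \<tau> \<in> extensions F K (restrict \<sigma> F)" by (simp add: extensions_def)
  qed
  have "F \<subseteq> normal_closure \<rat> K" using sub L by blast
  then have \<sigma>F: "restrict \<sigma> F \<in> embeddings \<rat> F" using emb_restrict[OF \<sigma> sub(2) _ sub(4)] by blast
  have "card (compose K \<sigma> ` embeddings F K) = card (extensions F K (restrict \<sigma> F))"
    using card_image[OF inj] card_extensions[OF kF FK \<sigma>F] by simp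
  then have "compose K \<sigma> ` embeddings F K = extensions F K (restrict \<sigma> F)"
    using card_subset_eq[OF card_extensions_le(1)[OF FK \<sigma>F] into] by blast
  then show ?thesis using inj by (simp add: bij_betw_def)
qed

text \<open>Group the embeddings of K by their restriction \<sigma> to F. On one group x contributes
  the constant \<sigma> x, and the sum over y is the conjugate under \<sigma> of the relative trace
  of y.\<close>

lemma field_trace_tower:
  assumes kF: "finite_ext \<rat> F" and FK: "finite_ext F K" and x: "x \<in> F" and y: "y \<in> K"
  shows "field_trace K (x * y) = field_trace F (x * (\<Sum>\<tau>\<in>embeddings F K. \<tau> y))"
proof -
  have K: "finite_ext \<rat> K" by (rule finite_ext_trans[OF kF FK])
  have sub: "is_subfield K" "is_subfield F" "F \<subseteq> K" "\<rat> \<subseteq> F" "\<rat> \<subseteq> K" "is_subfield \<rat>"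
    using kF FK by (auto simp: finite_ext_def)
  define L where "L = normal_closure \<rat> K"
  have QL: "finite_ext \<rat> L" unfolding L_def by (rule finite_ext_normal_closure[OF K])
  have L: "is_subfield L" "K \<subseteq> L" "F \<subseteq> L"
    unfolding L_def using finite_ext_normal_closure[OF K] sub by (auto simp: finite_ext_def)
  have FL: "finite_ext F L" by (rule finite_ext_base_change[OF QL sub(2,4) L(3)])
  define t where "t = (\<Sum>\<tau>\<in>embeddings F K. \<tau> y)"
  have tF: "t \<in> F" unfolding t_def by (rule trace_in_base[OF FK y])
  have img: "\<tau> ` K \<subseteq> L" if "\<tau> \<in> embeddings F K" for \<tau>
    unfolding L_def using that emb_base_mono[OF sub(4)] emb_image_subset_normal_closure by blast
  have "field_trace K (x * y) = (\<Sum>\<tau>\<in>(\<Union>\<sigma>\<in>embeddings \<rat> F. extensions F K \<sigma>). \<tau> (x * y))"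
    unfolding field_trace_def embeddings_eq_Union_extensions[OF sub(6,2,4,3)] ..
  also have "\<dots> = (\<Sum>\<sigma>\<in>embeddings \<rat> F. \<Sum>\<tau>\<in>extensions F K \<sigma>. \<tau> (x * y))"
    using card_extensions_le[OF FK] disjoint_extensions card_embeddings(1)[OF kF]
    by (intro sum.UNION_disjoint) blast+
  also have "\<dots> = (\<Sum>\<sigma>\<in>embeddings \<rat> F. \<sigma> (x * t))"
  proof (rule sum.cong)
    fix \<sigma> assume \<sigma>: "\<sigma> \<in> embeddings \<rat> F"
    obtain \<sigma>' where \<sigma>': "\<sigma>' \<in> embeddings \<rat> L" "\<And>z. z \<in> F \<Longrightarrow> \<sigma>' z = \<sigma> z"
      using ex_extension[OF kF FL \<sigma>] by blast
    have res: "restrict \<sigma>' F = \<sigma>"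
      using \<sigma>'(2) \<sigma> by (intro extensionalityI[of _ F]) (auto simp: embeddings_iff)
    have bij: "bij_betw (compose K \<sigma>') (embeddings F K) (extensions F K \<sigma>)"
      using extensions_bij[OF kF FK] \<sigma>'(1) res unfolding L_def by metis
    have "\<sigma> t = \<sigma>' t" using \<sigma>'(2)[OF tF] by simp
    also have "\<dots> = (\<Sum>\<tau>\<in>extensions F K \<sigma>. \<tau> y)"
      unfolding t_def by (rule sum_embeddings_fixed[OF \<sigma>'(1) L(1) bij img y])
    finally have t: "\<sigma> t = (\<Sum>\<tau>\<in>extensions F K \<sigma>. \<tau> y)" .
    have "(\<Sum>\<tau>\<in>extensions F K \<sigma>. \<tau> (x * y)) = (\<Sum>\<tau>\<in>extensions F K \<sigma>. \<sigma> x * \<tau> y)"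
    proof (rule sum.cong)
      fix \<tau> assume \<tau>: "\<tau> \<in> extensions F K \<sigma>"
      then have "\<tau> \<in> embeddings \<rat> K" by (simp add: extensions_def)
      then have "\<tau> (x * y) = \<tau> x * \<tau> y" by (rule emb_mult[OF sub(1)]) (use x y sub in auto)
      then show "\<tau> (x * y) = \<sigma> x * \<tau> y" using \<tau> x by (simp add: extensions_def)
    qed simp
    also have "\<dots> = \<sigma> x * \<sigma> t" by (simp add: t sum_distrib_left)
    also have "\<dots> = \<sigma> (x * t)" using emb_mult[OF sub(2) \<sigma> x tF] by simp
    finally show "(\<Sum>\<tau>\<in>extensions F K \<sigma>. \<tau> (x * y)) = \<sigma> (x * t)" .
  qed simp
  finally show ?thesis by (simp add: field_trace_def t_def)
qed

lemma norm_poly_tower: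
  assumes kF: "finite_ext \<rat> F" and FK: "finite_ext F K" and f: "f \<in> polys F"
  shows "norm_poly K f = norm_poly F f ^ card (embeddings F K)"
proof -
  have sub: "is_subfield K" "is_subfield F" "F \<subseteq> K" "\<rat> \<subseteq> F" "\<rat> \<subseteq> K" "is_subfield \<rat>"
    using kF FK by (auto simp: finite_ext_def)
  have "norm_poly K f = (\<Prod>\<tau>\<in>(\<Union>\<sigma>\<in>embeddings \<rat> F. extensions F K \<sigma>). map_poly \<tau> f)"
    unfolding norm_poly_def embeddings_eq_Union_extensions[OF sub(6,2,4,3)] ..
  also have "\<dots> = (\<Prod>\<sigma>\<in>embeddings \<rat> F. \<Prod>\<tau>\<in>extensions F K \<sigma>. map_poly \<tau> f)"
    using card_extensions_le[OF FK] disjoint_extensions card_embeddings(1)[OF kF]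
    by (intro prod.UNION_disjoint) blast+
  also have "\<dots> = (\<Prod>\<sigma>\<in>embeddings \<rat> F. map_poly \<sigma> f ^ card (embeddings F K))"
  proof (rule prod.cong)
    fix \<sigma> assume \<sigma>: "\<sigma> \<in> embeddings \<rat> F"
    have "map_poly \<tau> f = map_poly \<sigma> f" if \<tau>: "\<tau> \<in> extensions F K \<sigma>" for \<tau>
    proof (rule poly_eqI)
      fix i
      have "\<tau> 0 = 0" "\<sigma> 0 = 0"
        using emb_0[OF sub(1), of \<tau> \<rat>] emb_0[OF sub(2) \<sigma>] \<tau> by (auto simp: extensions_def)
      then show "coeff (map_poly \<tau> f) i = coeff (map_poly \<sigma> f) i"
        using \<tau> f by (simp add: coeff_map_poly extensions_def polys_def)
    qed
    then show "(\<Prod>\<tau>\<in>extensions F K \<sigma>. map_poly \<tau> f) = map_poly \<sigma> f ^ card (embeddings F K)"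
      using card_extensions[OF kF FK \<sigma>] by simp
  qed simp
  also have "\<dots> = norm_poly F f ^ card (embeddings F K)"
    by (simp add: norm_poly_def prod_power_distrib)
  finally show ?thesis .
qed

subsection \<open>Gram determinants and discriminants\<close>

definition emb_matrix :: "(complex \<Rightarrow> complex) list \<Rightarrow> complex list \<Rightarrow> complex mat" where
  "emb_matrix es ws = mat (length es) (length ws) (\<lambda>(i, j). (es ! i) (ws ! j))"

text \<open>The Gram matrix of the form that sends x and y to the trace of f x y, the trace being
  taken coefficientwise. For f = 1 it is the matrix of \<open>basis_disc\<close>.\<close>

definition gram_poly :: "complex set \<Rightarrow> complex poly \<Rightarrow> complex list \<Rightarrow> complex poly mat" where
  "gram_poly K f ws = mat (length ws) (length ws)
     (\<lambda>(i, j). \<Sum>\<tau>\<in>embeddings \<rat> K. Polynomial.smult (\<tau> (ws ! i * ws ! j)) (map_poly \<tau> f))"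

lemma sum_list_index: "distinct es \<Longrightarrow> (\<Sum>a = 0..<length es. h (es ! a)) = (\<Sum>\<tau>\<in>set es. h \<tau>)"
  for h :: "'b \<Rightarrow> 'c :: comm_monoid_add"
  using sum.reindex_bij_betw[OF bij_betw_nth[of es "{0..<length es}" "set es"], of h]
  by (simp add: lessThan_atLeast0)

lemma prod_list_index: "distinct es \<Longrightarrow> (\<Prod>a = 0..<length es. h (es ! a)) = (\<Prod>\<tau>\<in>set es. h \<tau>)"
  for h :: "'b \<Rightarrow> 'c :: comm_monoid_mult"
  using prod.reindex_bij_betw[OF bij_betw_nth[of es "{0..<length es}" "set es"], of h]
  by (simp add: lessThan_atLeast0)

lemma det_diagonal:
  "det (mat n n (\<lambda>(i, j). if i = j then d i else 0)) = (\<Prod>i = 0..<n. d i)"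
proof -
  have "det (mat n n (\<lambda>(i, j). if i = j then d i else 0)) =
      prod_list (diag_mat (mat n n (\<lambda>(i, j). if i = j then d i else 0)))"
    by (rule det_upper_triangular[of _ n]) (auto simp: upper_triangular_def)
  also have "diag_mat (mat n n (\<lambda>(i, j). if i = j then d i else 0)) = map d [0..<n]"
    by (auto simp: diag_mat_def)
  also have "prod_list (map d [0..<n]) = (\<Prod>i = 0..<n. d i)"
    using prod.distinct_set_conv_list[of "[0..<n]" d] by simp
  finally show ?thesis .
qed

text \<open>Applied with \<open>us = ws\<close> to write a discriminant as a square, and with
  \<open>us\<close> the dual basis, where the right-hand side is the identity matrix.\<close>

lemma gram_matrix_product:
  assumes K: "is_subfield K" and es: "distinct es" "set es = embeddings \<rat> K"
    and ws: "set ws \<subseteq> K" "set us \<subseteq> K" "length us = length ws" "length ws = length es"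
  shows "(emb_matrix es us)\<^sup>T * emb_matrix es ws = mat (length ws) (length ws) (\<lambda>(i, j). field_trace K (us ! i * ws ! j))"
proof (rule eq_matI)
  fix i j assume "i < dim_row (mat (length ws) (length ws) (\<lambda>(i, j). field_trace K (us ! i * ws ! j)))"
    "j < dim_col (mat (length ws) (length ws) (\<lambda>(i, j). field_trace K (us ! i * ws ! j)))"
  then have ij: "i < length ws" "j < length ws" by auto
  then have mem: "us ! i \<in> K" "ws ! j \<in> K" using ws by (auto simp: subset_iff)
  have "((emb_matrix es us)\<^sup>T * emb_matrix es ws) $$ (i, j) = (\<Sum>a = 0..<length es. (es ! a) (us ! i) * (es ! a) (ws ! j))"
    using ij ws by (simp add: emb_matrix_def scalar_prod_def)
  also have "\<dots> = (\<Sum>\<tau>\<in>embeddings \<rat> K. \<tau> (us ! i) * \<tau> (ws ! j))"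
    using sum_list_index[OF es(1), of "\<lambda>\<tau>. \<tau> (us ! i) * \<tau> (ws ! j)"] es(2) by simp
  also have "\<dots> = field_trace K (us ! i * ws ! j)"
    unfolding field_trace_def by (rule sum.cong) (auto simp: emb_mult[OF K _ mem])
  finally show "((emb_matrix es us)\<^sup>T * emb_matrix es ws) $$ (i, j) =
      mat (length ws) (length ws) (\<lambda>(i, j). field_trace K (us ! i * ws ! j)) $$ (i, j)"
    using ij by simp
qed (use ws in \<open>auto simp: emb_matrix_def\<close>)

lemma emb_matrix_carrier: "length ws = length es \<Longrightarrow> emb_matrix es ws \<in> carrier_mat (length ws) (length ws)"
  by (simp add: emb_matrix_def)

lemma basis_disc_eq_square:
  assumes K: "is_subfield K" and es: "distinct es" "set es = embeddings \<rat> K"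
    and ws: "set ws \<subseteq> K" "length ws = length es"
  shows "basis_disc K ws = det (emb_matrix es ws) ^ 2"
  unfolding basis_disc_def gram_matrix_product[OF K es ws(1,1) refl ws(2), symmetric]
  using emb_matrix_carrier[OF ws(2)]
  by (simp add: det_mult[of _ "length ws"] det_transpose power2_eq_square)

interpretation const_poly_hom: comm_ring_hom "\<lambda>c. [:c:] :: 'a :: comm_ring_1 poly"
  by unfold_locales (auto simp: one_pCons)

text \<open>The Gram matrix factors as the transpose of P times D times P, where P holds the
  conjugates of \<open>ws\<close> and D is diagonal with the conjugates of f.\<close>

lemma det_gram_poly:
  assumes K: "is_subfield K" and es: "distinct es" "set es = embeddings \<rat> K"
    and ws: "set ws \<subseteq> K" "length ws = length es"
  shows "det (gram_poly K f ws) = Polynomial.smult (basis_disc K ws) (norm_poly K f)"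
proof -
  define n where "n = length ws"
  define M where "M = emb_matrix es ws"
  define P where "P = map_mat (\<lambda>c. [:c:]) M"
  define D where "D = mat n n (\<lambda>(i, j). if i = j then map_poly (es ! i) f else 0)"
  have M: "M \<in> carrier_mat n n" unfolding M_def n_def by (rule emb_matrix_carrier[OF ws(2)])
  have P: "P \<in> carrier_mat n n" and D: "D \<in> carrier_mat n n" using M by (auto simp: P_def D_def)
  have Pij: "P $$ (a, j) = [:(es ! a) (ws ! j):]" if "a < n" "j < n" for a j
    using that ws by (simp add: P_def M_def emb_matrix_def n_def)
  have DP: "(D * P) $$ (a, j) = map_poly (es ! a) f * P $$ (a, j)" if "a < n" "j < n" for a j
  proof -
    have "(D * P) $$ (a, j) = (\<Sum>b = 0..<n. (if a = b then map_poly (es ! a) f else 0) * P $$ (b, j))"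
      using that P D by (simp add: scalar_prod_def D_def)
    also have "\<dots> = (\<Sum>b = 0..<n. if a = b then map_poly (es ! a) f * P $$ (b, j) else 0)"
      by (rule sum.cong) auto
    also have "\<dots> = map_poly (es ! a) f * P $$ (a, j)" using that by simp
    finally show ?thesis .
  qed
  have "gram_poly K f ws = P\<^sup>T * (D * P)"
  proof (rule eq_matI)
    fix i j assume "i < dim_row (P\<^sup>T * (D * P))" "j < dim_col (P\<^sup>T * (D * P))"
    then have ij: "i < n" "j < n" using P D by auto
    then have mem: "ws ! i \<in> K" "ws ! j \<in> K" using ws by (auto simp: subset_iff n_def)
    have "(P\<^sup>T * (D * P)) $$ (i, j) = (\<Sum>a = 0..<n. P $$ (a, i) * (D * P) $$ (a, j))"
      using ij P D by (simp add: scalar_prod_def)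
    also have "\<dots> = (\<Sum>a = 0..<length es. [:(es ! a) (ws ! i):] * (map_poly (es ! a) f * [:(es ! a) (ws ! j):]))"
      using ij ws by (intro sum.cong) (auto simp: DP Pij n_def)
    also have "\<dots> = (\<Sum>\<tau>\<in>embeddings \<rat> K. [:\<tau> (ws ! i):] * (map_poly \<tau> f * [:\<tau> (ws ! j):]))"
      using sum_list_index[OF es(1), of "\<lambda>\<tau>. [:\<tau> (ws ! i):] * (map_poly \<tau> f * [:\<tau> (ws ! j):])"] es(2) by simp
    also have "\<dots> = (\<Sum>\<tau>\<in>embeddings \<rat> K. Polynomial.smult (\<tau> (ws ! i * ws ! j)) (map_poly \<tau> f))"
      by (rule sum.cong) (auto simp: emb_mult[OF K _ mem] mult.commute)
    finally show "gram_poly K f ws $$ (i, j) = (P\<^sup>T * (D * P)) $$ (i, j)"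
      using ij by (simp add: gram_poly_def n_def)
  qed (use P D in \<open>auto simp: gram_poly_def n_def\<close>)
  then have "det (gram_poly K f ws) = det P * (det D * det P)"
    using P D by (simp add: det_mult[of _ n] det_transpose)
  also have "det P = [:det M:]" unfolding P_def by (rule const_poly_hom.hom_det)
  also have "det D = norm_poly K f"
    unfolding D_def det_diagonal norm_poly_def using prod_list_index[OF es(1), of "\<lambda>\<tau>. map_poly \<tau> f"] es(2) ws(2) n_def
    by simp
  finally show ?thesis
    using basis_disc_eq_square[OF K es ws] by (simp add: M_def power2_eq_square mult.commute)
qed

lemma ex_embedding_list:
  assumes "finite_ext \<rat> K"
  obtains es where "distinct es" "set es = embeddings \<rat> K" "length es = card (embeddings \<rat> K)"
  using finite_distinct_list[OF card_embeddings(1)[OF assms]] distinct_card that by metis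

text \<open>By Lagrange interpolation at the conjugates of a primitive element.\<close>

lemma embeddings_independent:
  assumes K: "finite_ext \<rat> K" and u: "\<And>x. x \<in> K \<Longrightarrow> (\<Sum>\<tau>\<in>embeddings \<rat> K. u \<tau> * \<tau> x) = 0"
    and \<tau>: "\<tau> \<in> embeddings \<rat> K"
  shows "u \<tau> = 0"
proof -
  have sub: "is_subfield K" "\<rat> \<subseteq> K" using K by (simp_all add: finite_ext_def)
  obtain \<theta> m where \<theta>: "\<theta> \<in> K" "K = adjoin \<rat> \<theta>" "min_poly \<rat> \<theta> m" using primitive_element[OF K] .
  have inj: "inj_on (\<lambda>\<tau>. \<tau> \<theta>) (embeddings \<rat> K)"
    using bij_betw_imp_inj_on[OF embeddings_adjoin[OF is_subfield_Rats \<theta>(3)]] \<theta>(2) by simp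
  have fin: "finite (embeddings \<rat> K)" by (rule card_embeddings(1)[OF K])
  have poly: "(\<Sum>\<tau>\<in>embeddings \<rat> K. u \<tau> * poly p (\<tau> \<theta>)) = 0" for p
  proof -
    have "(\<Sum>\<tau>\<in>embeddings \<rat> K. u \<tau> * poly p (\<tau> \<theta>)) =
        (\<Sum>\<tau>\<in>embeddings \<rat> K. \<Sum>i\<le>degree p. coeff p i * (u \<tau> * \<tau> (\<theta> ^ i)))"
      by (intro sum.cong refl) (simp add: poly_altdef sum_distrib_left emb_power[OF sub(1) _ \<theta>(1)] mult_ac)
    also have "\<dots> = (\<Sum>i\<le>degree p. coeff p i * (\<Sum>\<tau>\<in>embeddings \<rat> K. u \<tau> * \<tau> (\<theta> ^ i)))"
      by (subst sum.swap) (simp add: sum_distrib_left)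
    also have "\<dots> = 0" using u subfield_power[OF sub(1) \<theta>(1)] by simp
    finally show ?thesis .
  qed
  define p where "p = (\<Prod>\<tau>'\<in>embeddings \<rat> K - {\<tau>}. [:- \<tau>' \<theta>, 1:])"
  have "poly p (\<tau>' \<theta>) = 0" if "\<tau>' \<in> embeddings \<rat> K - {\<tau>}" for \<tau>'
    using that fin by (auto simp: p_def poly_prod intro!: prod_zero)
  then have "u \<tau> * poly p (\<tau> \<theta>) = 0"
    using poly[of p] sum.remove[OF fin \<tau>, of "\<lambda>\<tau>. u \<tau> * poly p (\<tau> \<theta>)"] by simp
  moreover have "poly p (\<tau> \<theta>) \<noteq> 0"
    using fin inj \<tau> by (auto simp: p_def poly_prod dest: inj_onD)
  ultimately show ?thesis by simp
qed

text \<open>If the determinant vanished, a nontrivial combination of the embeddings would vanish on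
  the basis and hence on K, against their independence.\<close>

lemma basis_disc_nonzero:
  assumes K: "finite_ext \<rat> K" and ws: "is_basis \<rat> K ws"
  shows "basis_disc K ws \<noteq> 0" "length ws = card (embeddings \<rat> K)"
proof -
  have sub: "is_subfield K" "\<rat> \<subseteq> K" using K by (simp_all add: finite_ext_def)
  obtain es where es: "distinct es" "set es = embeddings \<rat> K" "length es = card (embeddings \<rat> K)"
    using ex_embedding_list[OF K] .
  have "degree_eq \<rat> K (length ws)" using finite_ext_basis[OF K] ws by blast
  then show len: "length ws = card (embeddings \<rat> K)" using degree_eq_iff_card_embeddings[OF K] by simp
  have wsK: "set ws \<subseteq> K" using ws by (simp add: is_basis_def)
  define M where "M = emb_matrix es ws"
  define n where "n = length ws"
  have n: "n = length es" using len es by (simp add: n_def)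
  have M: "M \<in> carrier_mat n n" unfolding M_def n_def by (rule emb_matrix_carrier) (simp add: len es)
  have "det M \<noteq> 0"
  proof
    assume "det M = 0"
    then have "det M\<^sup>T = 0" using det_transpose[OF M] by simp
    then obtain v where v: "v \<in> carrier_vec n" "v \<noteq> 0\<^sub>v n" "M\<^sup>T *\<^sub>v v = 0\<^sub>v n"
      using det_0_iff_vec_prod_zero_field[of "M\<^sup>T" n] M by auto
    \<comment> \<open>The vector v is reindexed by the embeddings themselves; as \<open>es\<close>
      is distinct, only one term of the sum survives.\<close>
    define u where "u \<tau> = (\<Sum>a = 0..<n. if es ! a = \<tau> then v $ a else 0)" for \<tau>
    have u: "u (es ! a) = v $ a" if "a < n" for a
    proof -
      have "u (es ! a) = (\<Sum>b = 0..<n. if a = b then v $ b else 0)"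
        unfolding u_def using es(1) that n by (intro sum.cong) (auto simp: nth_eq_iff_index_eq)
      then show ?thesis using that by simp
    qed
    have col: "(\<Sum>\<tau>\<in>embeddings \<rat> K. u \<tau> * \<tau> (ws ! j)) = 0" if j: "j < n" for j
    proof -
      have "0 = (M\<^sup>T *\<^sub>v v) $ j" using v(3) j by simp
      also have "\<dots> = (\<Sum>a = 0..<length es. u (es ! a) * (es ! a) (ws ! j))"
        using M v(1) j n u by (auto simp: scalar_prod_def M_def emb_matrix_def n_def intro!: sum.cong)
      also have "\<dots> = (\<Sum>\<tau>\<in>embeddings \<rat> K. u \<tau> * \<tau> (ws ! j))"
        using sum_list_index[OF es(1), of "\<lambda>\<tau>. u \<tau> * \<tau> (ws ! j)"] es(2) by simp
      finally show ?thesis by simp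
    qed
    have "(\<Sum>\<tau>\<in>embeddings \<rat> K. u \<tau> * \<tau> x) = 0" if x: "x \<in> K" for x
    proof -
      obtain c where c: "\<forall>i. c i \<in> \<rat>" "x = (\<Sum>i<length ws. c i * ws ! i)"
        using ws x unfolding is_basis_def by blast
      have lin: "\<tau> x = (\<Sum>i<n. c i * \<tau> (ws ! i))" if \<tau>: "\<tau> \<in> embeddings \<rat> K" for \<tau>
      proof -
        have ck: "c i \<in> K" for i using c(1) sub(2) by blast
        have wk: "ws ! i \<in> K" if "i < n" for i using wsK that by (auto simp: n_def)
        have "\<tau> x = (\<Sum>i<n. \<tau> (c i * ws ! i))"
          unfolding c(2) n_def[symmetric] by (rule emb_sum[OF sub(1) \<tau>]) (use ck wk in \<open>simp add: subfield_mult[OF sub(1)]\<close>)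
        then show ?thesis using ck wk c(1) by (simp add: emb_mult[OF sub(1) \<tau>] emb_base[OF sub(1) \<tau>])
      qed
      have "(\<Sum>\<tau>\<in>embeddings \<rat> K. u \<tau> * \<tau> x) = (\<Sum>\<tau>\<in>embeddings \<rat> K. \<Sum>i<n. c i * (u \<tau> * \<tau> (ws ! i)))"
      proof (rule sum.cong)
        fix \<tau> assume "\<tau> \<in> embeddings \<rat> K"
        from lin[OF this] show "u \<tau> * \<tau> x = (\<Sum>i<n. c i * (u \<tau> * \<tau> (ws ! i)))"
          by (simp add: sum_distrib_left mult_ac)
      qed simp
      also have "\<dots> = (\<Sum>i<n. c i * (\<Sum>\<tau>\<in>embeddings \<rat> K. u \<tau> * \<tau> (ws ! i)))"
        by (subst sum.swap) (simp add: sum_distrib_left)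
      also have "\<dots> = 0" using col by simp
      finally show ?thesis .
    qed
    then have "u \<tau> = 0" if "\<tau> \<in> embeddings \<rat> K" for \<tau> using embeddings_independent[OF K _ that] by blast
    then have "v $ a = 0" if "a < n" for a using u[OF that] es(2) that n by (metis nth_mem)
    then have "v = 0\<^sub>v n" using v(1) by (intro eq_vecI) auto
    then show False using v(2) by simp
  qed
  then show "basis_disc K ws \<noteq> 0"
    using basis_disc_eq_square[OF sub(1) es(1,2) wsK] len es by (simp add: M_def)
qed

text \<open>The matrix of embeddings kills the coefficient vector of every rational relation, which
  gives independence; the length then gives spanning.\<close>

lemma basis_if_disc_nonzero:
  assumes K: "finite_ext \<rat> K" and ws: "set ws \<subseteq> K" "length ws = card (embeddings \<rat> K)" "basis_disc K ws \<noteq> 0"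
  shows "is_basis \<rat> K ws"
proof -
  have sub: "is_subfield K" "\<rat> \<subseteq> K" using K by (simp_all add: finite_ext_def)
  obtain es where es: "distinct es" "set es = embeddings \<rat> K" "length es = card (embeddings \<rat> K)"
    using ex_embedding_list[OF K] .
  define M where "M = emb_matrix es ws"
  define n where "n = length ws"
  have M: "M \<in> carrier_mat n n" unfolding M_def n_def by (rule emb_matrix_carrier) (simp add: ws es)
  have detM: "det M \<noteq> 0" using basis_disc_eq_square[OF sub(1) es(1,2) ws(1)] ws es by (auto simp: M_def)
  have ind: "ring.independent complex_ring \<rat> ws"
    unfolding independent_iff[OF is_subfield_Rats]
  proof (intro allI impI, elim conjE)
    fix c i assume c: "\<forall>i. c i \<in> \<rat>" "(\<Sum>i<length ws. c i * ws ! i) = 0" and i: "i < length ws"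
    define v where "v = vec n c"
    have "M *\<^sub>v v = 0\<^sub>v n"
    proof (rule eq_vecI)
      fix a assume "a < dim_vec (0\<^sub>v n :: complex vec)"
      then have a: "a < n" by simp
      then have \<tau>: "es ! a \<in> embeddings \<rat> K" using es ws by (metis n_def nth_mem)
      have ck: "c i \<in> K" for i using c(1) sub(2) by blast
      have wk: "ws ! i \<in> K" if "i < n" for i using ws that by (auto simp: n_def)
      have "(M *\<^sub>v v) $ a = (\<Sum>i<n. (es ! a) (ws ! i) * c i)"
        using a M ws es by (simp add: M_def emb_matrix_def v_def scalar_prod_def n_def lessThan_atLeast0)
      also have "\<dots> = (\<Sum>i<n. (es ! a) (c i * ws ! i))"
        using ck wk c(1) by (intro sum.cong) (simp_all add: emb_mult[OF sub(1) \<tau>] emb_base[OF sub(1) \<tau>])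
      also have "\<dots> = (es ! a) (\<Sum>i<n. c i * ws ! i)"
        by (rule emb_sum[OF sub(1) \<tau>, symmetric]) (use ck wk in \<open>simp add: subfield_mult[OF sub(1)]\<close>)
      also have "\<dots> = 0" using c(2) emb_0[OF sub(1) \<tau>] by (simp add: n_def)
      finally show "(M *\<^sub>v v) $ a = 0\<^sub>v n $ a" using a by simp
    qed (use M in auto)
    moreover have "v \<in> carrier_vec n" by (simp add: v_def)
    ultimately have "v = 0\<^sub>v n"
      using detM det_0_iff_vec_prod_zero_field[OF M] by blast
    then show "c i = 0" using i by (metis index_vec index_zero_vec(1) n_def v_def)
  qed
  have "degree_eq \<rat> K (length ws)" using degree_eq_iff_card_embeddings[OF K] ws by simp
  then have "ring.Span complex_ring \<rat> ws = K"
    using ring.independent_length_eq_dimension[OF complex_is_ring is_subfield_Rats _ ind ws(1)] by blast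
  then show ?thesis
    using is_basis_iff[OF is_subfield_Rats subfield_sum_mult[OF sub(1,2)]] ind by blast
qed

subsection \<open>Integral bases\<close>

lemma algebraic_int_embedding:
  assumes K: "is_subfield K" and \<tau>: "\<tau> \<in> embeddings k K" and x: "x \<in> K" "algebraic_int x"
  shows "algebraic_int (\<tau> x)"
proof -
  obtain p where p: "lead_coeff p = 1" "\<forall>i. coeff p i \<in> \<int>" "poly p x = 0"
    using x(2) by (auto elim: algebraic_int.cases)
  have "coeff p i \<in> K \<and> \<tau> (coeff p i) = coeff p i" for i
  proof -
    obtain c where "coeff p i = of_int c" using p(2) by (meson Ints_cases)
    then show ?thesis using emb_of_int[OF K \<tau>] subfield_of_int[OF K] by simp
  qed
  then have "p \<in> polys K" "map_poly \<tau> p = p"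
    using emb_0[OF K \<tau>] by (auto simp: polys_def coeff_map_poly intro!: poly_eqI)
  then have "poly p (\<tau> x) = 0" using emb_poly_map[OF K \<tau> _ x(1), of p] p(3) emb_0[OF K \<tau>] by simp
  then show ?thesis using p by (intro algebraic_int.intros) auto
qed

lemma field_trace_in_Ints:
  assumes K: "finite_ext \<rat> K" and x: "x \<in> K" "algebraic_int x"
  shows "field_trace K x \<in> \<int>"
proof (rule rational_algebraic_int_is_int)
  show "field_trace K x \<in> \<rat>" unfolding field_trace_def by (rule trace_in_base[OF K x(1)])
  show "algebraic_int (field_trace K x)"
    unfolding field_trace_def
    using K algebraic_int_embedding[OF _ _ x] by (intro algebraic_int_sum_complex) (auto simp: finite_ext_def)
qed

lemma ring_of_integers_closed:
  assumes K: "is_subfield K" and x: "x \<in> ring_of_integers K" and y: "y \<in> ring_of_integers K"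
  shows "x * y \<in> ring_of_integers K" "x - y \<in> ring_of_integers K"
  using assms algebraic_int_mult_complex algebraic_int_diff_complex
  by (auto simp: ring_of_integers_def subfield_simps[OF K])

lemma ring_of_integers_of_int_mult:
  "is_subfield K \<Longrightarrow> x \<in> ring_of_integers K \<Longrightarrow> of_int c * x \<in> ring_of_integers K"
  by (rule ring_of_integers_closed) (simp_all add: ring_of_integers_def subfield_of_int)

lemma det_in_Ints:
  fixes A :: "complex mat"
  assumes "A \<in> carrier_mat n n" "\<And>i j. i < n \<Longrightarrow> j < n \<Longrightarrow> A $$ (i, j) \<in> \<int>"
  shows "det A \<in> \<int>"
proof -
  have "signof p * (\<Prod>i = 0..<n. A $$ (i, p i)) \<in> \<int>" if p: "p permutes {0..<n}" for p
  proof (rule Ints_mult)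
    show "signof p \<in> (\<int> :: complex set)" by (simp add: sign_def)
    show "(\<Prod>i = 0..<n. A $$ (i, p i)) \<in> \<int>"
    proof (rule Ints_prod)
      fix i assume i: "i \<in> {0..<n}"
      then have "p i \<in> {0..<n}" using permutes_in_image[OF p] by blast
      then show "A $$ (i, p i) \<in> \<int>" using assms(2) i by simp
    qed
  qed
  then show ?thesis unfolding det_def'[OF assms(1)] by (intro Ints_sum) simp
qed

lemma basis_disc_in_Ints:
  assumes K: "finite_ext \<rat> K" and ws: "set ws \<subseteq> ring_of_integers K"
  shows "basis_disc K ws \<in> \<int>"
proof -
  have sub: "is_subfield K" using K by (simp add: finite_ext_def)
  show ?thesis
    unfolding basis_disc_def
  proof (rule det_in_Ints)
    fix i j assume "i < length ws" "j < length ws"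
    then have "ws ! i * ws ! j \<in> ring_of_integers K"
      using ws by (intro ring_of_integers_closed[OF sub]) (auto simp: subset_iff)
    then show "mat (length ws) (length ws) (\<lambda>(i, j). field_trace K (ws ! i * ws ! j)) $$ (i, j) \<in> \<int>"
      using field_trace_in_Ints[OF K] \<open>i < length ws\<close> \<open>j < length ws\<close> by (simp add: ring_of_integers_def)
  qed simp
qed

lemma ex_integer_multiple:
  assumes K: "finite_ext \<rat> K" and x: "x \<in> K"
  obtains N :: int where "N \<noteq> 0" "of_int N * x \<in> ring_of_integers K"
proof -
  have sub: "is_subfield K" using K by (simp add: finite_ext_def)
  have "algebraic x"
    using finite_ext_algebraic[OF K x] by (auto simp: algebraic_over_def polys_def algebraic_altdef)
  then obtain p where p: "p \<noteq> 0" "poly (map_poly of_int p) x = 0" by (rule algebraicE')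
  define h :: "complex poly" where "h = map_poly of_int p"
  have h: "int_coeffs h" by (simp add: int_coeffs_def h_def coeff_map_poly)
  have "h \<noteq> 0" using p(1) by (simp add: h_def map_poly_eq_0_iff)
  moreover have "lead_coeff h = of_int (lead_coeff p)" by (simp add: h_def coeff_map_poly degree_map_poly)
  ultimately have "algebraic_int (of_int (lead_coeff p) * x)"
    using algebraic_int_lead_coeff_times_root[OF h, of x] p(2) by (simp add: h_def)
  then have "of_int (lead_coeff p) * x \<in> ring_of_integers K"
    using x by (simp add: ring_of_integers_def subfield_simps[OF sub])
  moreover have "lead_coeff p \<noteq> 0" using p(1) by simp
  ultimately show ?thesis using that by blast
qed

lemma ex_integer_multiples:
  assumes K: "finite_ext \<rat> K" and us: "set us \<subseteq> K"
  shows "\<exists>N :: int. N \<noteq> 0 \<and> (\<forall>x\<in>set us. of_int N * x \<in> ring_of_integers K)"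
  using us
proof (induction us)
  case Nil
  show ?case by (rule exI[of _ 1]) simp
next
  case (Cons u us)
  have sub: "is_subfield K" using K by (simp add: finite_ext_def)
  obtain N :: int where N: "N \<noteq> 0" "\<forall>x\<in>set us. of_int N * x \<in> ring_of_integers K" using Cons by auto
  obtain M :: int where M: "M \<noteq> 0" "of_int M * u \<in> ring_of_integers K"
    using ex_integer_multiple[OF K, of u] Cons.prems by auto
  have "of_int (N * M) * u \<in> ring_of_integers K"
    using ring_of_integers_of_int_mult[OF sub M(2), of N] by (simp add: mult_ac)
  moreover have "of_int (N * M) * x \<in> ring_of_integers K" if "x \<in> set us" for x
    using ring_of_integers_of_int_mult[OF sub N(2)[rule_format, OF that], of M] by (simp add: mult_ac)
  ultimately show ?case using N(1) M(1) by (intro exI[of _ "N * M"]) auto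
qed

lemma ex_integral_list:
  assumes K: "finite_ext \<rat> K"
  obtains ws where "set ws \<subseteq> ring_of_integers K" "is_basis \<rat> K ws"
proof -
  have sub: "is_subfield K" "\<rat> \<subseteq> K" using K by (simp_all add: finite_ext_def)
  obtain us where us: "is_basis \<rat> K us"
    using finite_ext_basis[OF K] K unfolding finite_ext_def by blast
  then have usK: "set us \<subseteq> K" by (simp add: is_basis_def)
  obtain N :: int where N: "N \<noteq> 0" "\<forall>x\<in>set us. of_int N * x \<in> ring_of_integers K"
    using ex_integer_multiples[OF K usK] by blast
  define ws where "ws = map ((*) (of_int N)) us"
  have int: "set ws \<subseteq> ring_of_integers K" using N(2) by (auto simp: ws_def)
  have sum: "(\<Sum>i<length ws. c i * ws ! i) = of_int N * (\<Sum>i<length us. c i * us ! i)" for c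
    by (simp add: ws_def sum_distrib_left mult_ac)
  have "is_basis \<rat> K ws"
    unfolding is_basis_def
  proof (intro conjI ballI allI impI; (elim conjE)?)
    show "set ws \<subseteq> K" using int by (auto simp: ring_of_integers_def)
  next
    fix x assume "x \<in> K"
    then obtain c where c: "\<forall>i. c i \<in> \<rat>" "x = (\<Sum>i<length us. c i * us ! i)"
      using us unfolding is_basis_def by blast
    have "of_int N * (\<Sum>i<length us. c i / of_int N * us ! i) = x"
      using N(1) unfolding c(2) sum_distrib_left by (intro sum.cong) (auto simp: field_simps)
    then have "x = (\<Sum>i<length ws. c i / of_int N * ws ! i)" using sum[of "\<lambda>i. c i / of_int N"] by simp
    then show "\<exists>c. (\<forall>i. c i \<in> \<rat>) \<and> x = (\<Sum>i<length ws. c i * ws ! i)"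
      using c(1) by (intro exI[of _ "\<lambda>i. c i / of_int N"]) auto
  next
    fix c i assume c: "\<forall>i. c i \<in> \<rat>" "(\<Sum>i<length ws. c i * ws ! i) = 0" and i: "i < length ws"
    have "of_int N * (\<Sum>i<length us. c i * us ! i) = 0" using c(2) unfolding sum .
    then have "(\<Sum>i<length us. c i * us ! i) = 0" using N(1) by simp
    then have "\<forall>i<length us. c i = 0" using us c(1) unfolding is_basis_def by blast
    then show "c i = 0" using i by (simp add: ws_def)
  qed
  then show ?thesis using that int by blast
qed

text \<open>A basis consisting of integers with discriminant of minimal absolute value is an integral basis:
  otherwise one basis vector could be replaced so that the discriminant is multiplied by the square
  of a number strictly between 0 and 1.\<close>

lemma ex_integral_basis:
  assumes K: "finite_ext \<rat> K"
  shows "\<exists>ws. integral_basis K ws"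
proof -
  have sub: "is_subfield K" "\<rat> \<subseteq> K" using K by (simp_all add: finite_ext_def)
  define P where "P ws \<longleftrightarrow> set ws \<subseteq> ring_of_integers K \<and> is_basis \<rat> K ws" for ws
  \<comment> \<open>The discriminant of a list of integers is a rational integer, so the floor loses
    nothing, and a minimum over natural numbers exists.\<close>
  define \<mu> where "\<mu> ws = nat \<lfloor>cmod (basis_disc K ws)\<rfloor>" for ws
  have \<mu>: "real (\<mu> ws) = cmod (basis_disc K ws)" if "P ws" for ws
  proof -
    have "basis_disc K ws \<in> \<int>" using basis_disc_in_Ints[OF K] \<open>P ws\<close> by (simp add: P_def)
    then obtain z where "basis_disc K ws = of_int z" by (elim Ints_cases)
    then show ?thesis by (simp add: \<mu>_def)
  qed
  obtain ws0 where "set ws0 \<subseteq> ring_of_integers K" "is_basis \<rat> K ws0" by (rule ex_integral_list[OF K])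
  then have ws0: "P ws0" by (simp add: P_def)
  define ws where "ws = arg_min \<mu> P"
  have ws: "P ws" and min: "\<And>vs. P vs \<Longrightarrow> \<mu> ws \<le> \<mu> vs"
    unfolding ws_def using arg_min_natI[of P ws0 \<mu>, OF ws0] arg_min_nat_le[of P _ \<mu>] by blast+
  define n where "n = length ws"
  have wsK: "set ws \<subseteq> K" and ws_int: "set ws \<subseteq> ring_of_integers K" and basis: "is_basis \<rat> K ws"
    using ws by (auto simp: P_def ring_of_integers_def)
  have disc: "basis_disc K ws \<noteq> 0" and n: "n = card (embeddings \<rat> K)"
    using basis_disc_nonzero[OF K basis] by (auto simp: n_def)
  have coeffs: "c i \<in> \<int>" if x: "x \<in> ring_of_integers K" and c: "\<forall>i. c i \<in> \<rat>" "x = (\<Sum>i<n. c i * ws ! i)" and i: "i < n" for x c i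
  proof (rule ccontr)
    assume ni: "c i \<notin> \<int>"
    obtain q where q: "c i = of_rat q" using c(1) by (metis Rats_cases)
    define r where "r = q - of_int \<lfloor>q\<rfloor>"
    have r: "0 < r" "r < 1"
    proof -
      have "q \<noteq> of_int \<lfloor>q\<rfloor>"
      proof
        assume "q = of_int \<lfloor>q\<rfloor>"
        then have "c i = of_int \<lfloor>q\<rfloor>" using q by (metis of_rat_of_int_eq)
        then show False using ni by simp
      qed
      then show "0 < r" "r < 1" unfolding r_def by linarith+
    qed
    \<comment> \<open>The i-th coordinate of w is r, the fractional part of \<open>c i\<close>, and
      the others are those of x. By Cramer's lemma, putting w in place of \<open>ws ! i\<close>
      multiplies the determinant of the embedding matrix by r.\<close>
    define w where "w = x - of_int \<lfloor>q\<rfloor> * ws ! i"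
    define vs where "vs = ws[i := w]"
    define c' where "c' j = (if j = i then of_rat r else c j)" for j
    have w: "w = (\<Sum>j<n. c' j * ws ! j)"
    proof -
      have "(\<Sum>j<n. c' j * ws ! j) = (\<Sum>j<n. c j * ws ! j - (if j = i then of_int \<lfloor>q\<rfloor> * ws ! j else 0))"
        by (rule sum.cong) (auto simp: c'_def r_def q of_rat_diff algebra_simps)
      then show ?thesis using i by (simp add: sum_subtractf w_def c(2))
    qed
    have c'Q: "c' j \<in> \<rat>" for j using c(1) by (simp add: c'_def)
    have w_int: "w \<in> ring_of_integers K"
      unfolding w_def using x ws_int i
      by (intro ring_of_integers_closed[OF sub(1)] ring_of_integers_of_int_mult[OF sub(1)]) (auto simp: n_def)
    have vs_int: "set vs \<subseteq> ring_of_integers K"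
      using set_update_subset_insert[of ws i w] ws_int w_int by (auto simp: vs_def)
    then have vsK: "set vs \<subseteq> K" by (auto simp: ring_of_integers_def)
    obtain es where es: "distinct es" "set es = embeddings \<rat> K" "length es = card (embeddings \<rat> K)"
      using ex_embedding_list[OF K] .
    define M where "M = emb_matrix es ws"
    have M: "M \<in> carrier_mat n n" unfolding M_def n_def by (rule emb_matrix_carrier) (use n es n_def in simp)
    have "emb_matrix es vs = replace_col M (M *\<^sub>v vec n c') i"
    proof (rule eq_matI)
      fix a j assume "a < dim_row (replace_col M (M *\<^sub>v vec n c') i)" "j < dim_col (replace_col M (M *\<^sub>v vec n c') i)"
      then have aj: "a < n" "j < n" using M by (auto simp: replace_col_def)
      have \<tau>: "es ! a \<in> embeddings \<rat> K" using aj es n by (metis nth_mem)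
      have ck: "c' j \<in> K" for j using c'Q sub(2) by blast
      have wk: "ws ! j \<in> K" if "j < n" for j using wsK that by (auto simp: n_def)
      have "(es ! a) w = (\<Sum>j<n. (es ! a) (c' j * ws ! j))"
        unfolding w by (rule emb_sum[OF sub(1) \<tau>]) (use ck wk in \<open>simp add: subfield_mult[OF sub(1)]\<close>)
      also have "\<dots> = (\<Sum>j<n. (es ! a) (ws ! j) * c' j)"
        using ck wk c'Q by (intro sum.cong) (simp_all add: emb_mult[OF sub(1) \<tau>] emb_base[OF sub(1) \<tau>])
      also have "\<dots> = (M *\<^sub>v vec n c') $ a"
        using aj M n es by (simp add: M_def emb_matrix_def scalar_prod_def n_def lessThan_atLeast0)
      finally have "(es ! a) w = (M *\<^sub>v vec n c') $ a" .
      then show "emb_matrix es vs $$ (a, j) = replace_col M (M *\<^sub>v vec n c') i $$ (a, j)"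
        using aj i n es M by (auto simp: emb_matrix_def replace_col_def vs_def n_def M_def nth_list_update)
    qed (use M n es in \<open>auto simp: replace_col_def emb_matrix_def vs_def n_def\<close>)
    then have "det (emb_matrix es vs) = of_rat r * det M"
      using cramer_lemma_mat[OF M _ i, of "vec n c'"] i by (simp add: c'_def)
    then have dvs: "basis_disc K vs = of_rat r ^ 2 * basis_disc K ws"
      using basis_disc_eq_square[OF sub(1) es(1,2) vsK] basis_disc_eq_square[OF sub(1) es(1,2) wsK] n es
      by (simp add: M_def vs_def n_def power_mult_distrib)
    then have "basis_disc K vs \<noteq> 0" using disc r by simp
    then have "is_basis \<rat> K vs" using vsK n by (intro basis_if_disc_nonzero[OF K]) (simp_all add: vs_def n_def)
    then have Pvs: "P vs" using vs_int by (simp add: P_def)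
    obtain a b where ab: "quotient_of r = (a, b)" by fastforce
    have "r = of_int a / of_int b" using quotient_of_div[OF ab] .
    then have "(of_rat r :: complex) = of_real (real_of_rat r)" by (simp add: of_rat_divide)
    then have "cmod (of_rat r) = real_of_rat r" using r by simp
    then have "cmod (basis_disc K vs) = real_of_rat r ^ 2 * cmod (basis_disc K ws)"
      using dvs by (simp add: norm_mult norm_power)
    moreover have "real_of_rat r ^ 2 < 1" using r by (simp add: power_less_one_iff abs_square_less_1)
    ultimately have "cmod (basis_disc K vs) < cmod (basis_disc K ws)" using disc by simp
    then show False using min[OF Pvs] \<mu>[OF ws] \<mu>[OF Pvs] by linarith
  qed
  have "integral_basis K ws"
    unfolding integral_basis_def
  proof (intro conjI ballI ws_int)
    fix x assume x: "x \<in> ring_of_integers K"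
    then obtain c where c: "\<forall>i. c i \<in> \<rat>" "x = (\<Sum>i<n. c i * ws ! i)"
      using basis unfolding is_basis_def n_def ring_of_integers_def by blast
    have "\<exists>z. c i = of_int z" if "i < n" for i using coeffs[OF x c that] by (auto elim: Ints_cases)
    then obtain z :: "nat \<Rightarrow> int" where z: "\<And>i. i < n \<Longrightarrow> c i = of_int (z i)" by metis
    show "\<exists>!cs :: int list. length cs = length ws \<and> x = (\<Sum>i<length ws. of_int (cs ! i) * ws ! i)"
    proof (rule ex1I[of _ "map z [0..<n]"])
      show "length (map z [0..<n]) = length ws \<and> x = (\<Sum>i<length ws. of_int (map z [0..<n] ! i) * ws ! i)"
        using z c(2) by (simp add: n_def)
      fix cs :: "int list" assume cs: "length cs = length ws \<and> x = (\<Sum>i<length ws. of_int (cs ! i) * ws ! i)"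
      define d where "d i = (if i < n then of_int (cs ! i) - c i else 0)" for i
      have "\<forall>i. d i \<in> \<rat>" using c(1) by (simp add: d_def)
      moreover have "(\<Sum>i<length ws. d i * ws ! i) = 0"
        using cs c(2) by (simp add: d_def n_def left_diff_distrib sum_subtractf)
      ultimately have "\<forall>i<n. d i = 0" using basis unfolding is_basis_def n_def by blast
      then have "of_int (cs ! i) = (of_int (z i) :: complex)" if "i < n" for i using that z[OF that] by (simp add: d_def)
      then show "cs = map z [0..<n]" using cs by (intro nth_equalityI) (auto simp: n_def)
    qed
  qed
  then show ?thesis by blast
qed

lemma ex_common_denominator:
  fixes c :: "nat \<Rightarrow> complex"
  assumes "\<forall>i. c i \<in> \<rat>"
  shows "\<exists>N :: int. N \<noteq> 0 \<and> (\<forall>i<n. of_int N * c i \<in> \<int>)"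
proof (induction n)
  case 0
  show ?case by (rule exI[of _ 1]) simp
next
  case (Suc n)
  then obtain N :: int where N: "N \<noteq> 0" "\<forall>i<n. of_int N * c i \<in> \<int>" by blast
  obtain a b where b: "b > 0" "c n = of_int a / of_int b" using assms by (metis Rats_cases')
  have "of_int (N * b) * c i \<in> \<int>" if "i < Suc n" for i
  proof (cases "i = n")
    case True
    have "of_int (N * b) * c n = of_int (N * a)" using b by simp
    then show ?thesis using True by (metis Ints_of_int)
  next
    case False
    then have "of_int N * c i \<in> \<int>" using N(2) that by auto
    then have "of_int b * (of_int N * c i) \<in> \<int>" by (rule Ints_mult[OF Ints_of_int])
    then show ?thesis by (simp add: mult_ac)
  qed
  then show ?case using N(1) b(1) by (intro exI[of _ "N * b"]) auto
qed

text \<open>\<open>Disc\<close> picks an integral basis by choice, so only its definition is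
  available. Clearing denominators reduces a rational relation to an integral one, where uniqueness
  of the coordinates of 0 applies.\<close>

lemma integral_basis_is_basis:
  assumes K: "finite_ext \<rat> K" and ws: "integral_basis K ws"
  shows "is_basis \<rat> K ws"
  unfolding is_basis_def
proof (intro conjI ballI allI impI; (elim conjE)?)
  have sub: "is_subfield K" "\<rat> \<subseteq> K" using K by (simp_all add: finite_ext_def)
  show "set ws \<subseteq> K" using ws by (auto simp: integral_basis_def ring_of_integers_def)
  fix x assume x: "x \<in> K"
  obtain N :: int where N: "N \<noteq> 0" "of_int N * x \<in> ring_of_integers K"
    using ex_integer_multiple[OF K x] .
  obtain cs :: "int list" where "of_int N * x = (\<Sum>i<length ws. of_int (cs ! i) * ws ! i)"
    using ws N(2) unfolding integral_basis_def by blast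
  then have "x = (\<Sum>i<length ws. of_int (cs ! i) * ws ! i) / of_int N"
    using N(1) by (simp add: field_simps)
  then have "x = (\<Sum>i<length ws. of_int (cs ! i) / of_int N * ws ! i)"
    by (simp add: sum_divide_distrib)
  then show "\<exists>c. (\<forall>i. c i \<in> \<rat>) \<and> x = (\<Sum>i<length ws. c i * ws ! i)"
    by (intro exI[of _ "\<lambda>i. of_int (cs ! i) / of_int N"]) auto
next
  fix c i assume c: "\<forall>i. c i \<in> \<rat>" "(\<Sum>i<length ws. c i * ws ! i) = 0" and i: "i < length ws"
  obtain N :: int where N: "N \<noteq> 0" "\<forall>i<length ws. of_int N * c i \<in> \<int>"
    using ex_common_denominator[OF c(1)] by blast
  have "\<exists>z. of_int N * c i = of_int z" if "i < length ws" for i using N(2) that by (auto elim: Ints_cases)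
  then obtain z :: "nat \<Rightarrow> int" where z: "\<And>i. i < length ws \<Longrightarrow> of_int N * c i = of_int (z i)" by metis
  have "0 = of_int N * (\<Sum>i<length ws. c i * ws ! i)" using c(2) by simp
  also have "\<dots> = (\<Sum>i<length ws. of_int (map z [0..<length ws] ! i) * ws ! i)"
    using z by (simp add: sum_distrib_left flip: mult.assoc)
  finally have 1: "0 = (\<Sum>i<length ws. of_int (map z [0..<length ws] ! i) * ws ! i)" .
  have "(0 :: complex) \<in> ring_of_integers K"
    using K by (simp add: ring_of_integers_def subfield_0 finite_ext_def)
  then have "\<exists>!cs :: int list. length cs = length ws \<and> 0 = (\<Sum>i<length ws. of_int (cs ! i) * ws ! i)"
    using ws unfolding integral_basis_def by blast
  moreover have "length (replicate (length ws) 0) = length ws \<and>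
      0 = (\<Sum>i<length ws. of_int (replicate (length ws) (0 :: int) ! i) * ws ! i)" by simp
  moreover have "length (map z [0..<length ws]) = length ws" by simp
  ultimately have "map z [0..<length ws] = replicate (length ws) 0" using 1 by blast
  then have "map z [0..<length ws] ! i = replicate (length ws) 0 ! i" by simp
  then have "z i = 0" using i by simp
  then show "c i = 0" using z[OF i] N(1) by simp
qed

lemma Disc_basis:
  assumes K: "finite_ext \<rat> K"
  obtains ws where "integral_basis K ws" "Disc K = basis_disc K ws"
  using someI_ex[OF ex_integral_basis[OF K]] that by (simp add: Disc_def)

subsection \<open>The discriminant in towers\<close>

lemma Disc_nonzero_int:
  assumes K: "finite_ext \<rat> K"
  obtains z :: int where "Disc K = of_int z" "z \<noteq> 0"
proof -
  obtain ws where ws: "integral_basis K ws" "Disc K = basis_disc K ws" using Disc_basis[OF K] .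
  have "Disc K \<in> \<int>"
    unfolding ws(2) using ws(1) by (intro basis_disc_in_Ints[OF K]) (simp add: integral_basis_def)
  moreover have "Disc K \<noteq> 0"
    unfolding ws(2) by (rule basis_disc_nonzero(1)[OF K integral_basis_is_basis[OF K ws(1)]])
  ultimately show ?thesis using that by (metis Ints_cases of_int_0)
qed

lemma abs_Disc_ge_1:
  assumes "finite_ext \<rat> K" shows "abs_Disc K \<ge> 1"
proof -
  obtain z :: int where "Disc K = of_int z" "z \<noteq> 0" using Disc_nonzero_int[OF assms] .
  then show ?thesis by simp
qed

lemma field_trace_lincomb:
  assumes K: "is_subfield K" and c: "\<And>i. i \<in> I \<Longrightarrow> c i \<in> \<rat>" and y: "\<And>i. i \<in> I \<Longrightarrow> y i \<in> K"
  shows "field_trace K (\<Sum>i\<in>I. c i * y i) = (\<Sum>i\<in>I. c i * field_trace K (y i))"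
proof -
  have cK: "c i \<in> K" if "i \<in> I" for i using c[OF that] Rats_subset_subfield[OF K] by blast
  have "field_trace K (\<Sum>i\<in>I. c i * y i) = (\<Sum>\<tau>\<in>embeddings \<rat> K. \<Sum>i\<in>I. c i * \<tau> (y i))"
    unfolding field_trace_def
  proof (rule sum.cong)
    fix \<tau> assume \<tau>: "\<tau> \<in> embeddings \<rat> K"
    have "\<tau> (\<Sum>i\<in>I. c i * y i) = (\<Sum>i\<in>I. \<tau> (c i * y i))"
      by (rule emb_sum[OF K \<tau>]) (simp add: subfield_mult[OF K] cK y)
    also have "\<dots> = (\<Sum>i\<in>I. c i * \<tau> (y i))"
      by (rule sum.cong) (simp_all add: emb_mult[OF K \<tau>] cK y emb_base[OF K \<tau>] c)
    finally show "\<tau> (\<Sum>i\<in>I. c i * y i) = (\<Sum>i\<in>I. c i * \<tau> (y i))" .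
  qed simp
  also have "\<dots> = (\<Sum>i\<in>I. c i * field_trace K (y i))"
    by (subst sum.swap) (simp add: field_trace_def sum_distrib_left)
  finally show ?thesis .
qed

text \<open>The coordinates are the rows of the inverse of the trace matrix T, written as the
  adjugate divided by det T; this determinant is the discriminant and so is nonzero.\<close>

lemma ex_dual_basis:
  assumes K: "finite_ext \<rat> K" and ws: "set ws \<subseteq> ring_of_integers K" "is_basis \<rat> K ws"
  obtains us where "length us = length ws" "set us \<subseteq> K"
    "\<And>i j. i < length ws \<Longrightarrow> j < length ws \<Longrightarrow> field_trace K (us ! i * ws ! j) = (if i = j then 1 else 0)"
proof -
  have sub: "is_subfield K" using K by (simp add: finite_ext_def)
  define n where "n = length ws"
  have wi: "ws ! i \<in> ring_of_integers K" if "i < n" for i using ws(1) that by (auto simp: n_def)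
  have "field_trace K (ws ! i * ws ! j) \<in> \<int>" if "i < n" "j < n" for i j
    using field_trace_in_Ints[OF K] ring_of_integers_closed(1)[OF sub wi[OF that(1)] wi[OF that(2)]]
    by (simp add: ring_of_integers_def)
  then have "\<exists>z. field_trace K (ws ! i * ws ! j) = of_int z" if "i < n" "j < n" for i j
    using that by (meson Ints_cases)
  then obtain t :: "nat \<Rightarrow> nat \<Rightarrow> int" where t: "\<And>i j. i < n \<Longrightarrow> j < n \<Longrightarrow> field_trace K (ws ! i * ws ! j) = of_int (t i j)"
    by metis
  define T where "T = mat n n (\<lambda>(i, j). t i j)"
  have T: "T \<in> carrier_mat n n" by (simp add: T_def)
  define D where "D = det T"
  have "map_mat of_int T = mat n n (\<lambda>(i, j). field_trace K (ws ! i * ws ! j))"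
    by (rule eq_matI) (auto simp: T_def t)
  then have "basis_disc K ws = of_int D"
    unfolding basis_disc_def n_def[symmetric] D_def by (metis of_int_hom.hom_det)
  then have D: "D \<noteq> 0" using basis_disc_nonzero(1)[OF K ws(2)] by auto
  define A where "A = adj_mat T"
  have A: "A \<in> carrier_mat n n" "A * T = D \<cdot>\<^sub>m 1\<^sub>m n" using adj_mat[OF T] by (auto simp: A_def D_def)
  have AT: "(\<Sum>k<n. A $$ (i, k) * t k j) = (if i = j then D else 0)" if "i < n" "j < n" for i j
  proof -
    have "(\<Sum>k<n. A $$ (i, k) * t k j) = (A * T) $$ (i, j)"
      using that A(1) T by (simp add: scalar_prod_def lessThan_atLeast0 T_def)
    then show ?thesis using that unfolding A(2) by simp
  qed
  define u where "u i = (\<Sum>k<n. (of_int (A $$ (i, k)) / of_int D) * ws ! k)" for i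
  show ?thesis
  proof (rule that[of "map u [0..<n]"])
    show "length (map u [0..<n]) = length ws" by (simp add: n_def)
    have "u i \<in> K" for i
      unfolding u_def using wi by (intro subfield_sum[OF sub]) (auto simp: subfield_simps[OF sub] ring_of_integers_def)
    then show "set (map u [0..<n]) \<subseteq> K" by auto
    fix i j assume "i < length ws" "j < length ws"
    then have ij: "i < n" "j < n" by (simp_all add: n_def)
    have "u i * ws ! j = (\<Sum>k<n. (of_int (A $$ (i, k)) / of_int D) * (ws ! k * ws ! j))"
      by (simp add: u_def sum_distrib_right mult.assoc)
    then have "field_trace K (u i * ws ! j) = (\<Sum>k<n. (of_int (A $$ (i, k)) / of_int D) * field_trace K (ws ! k * ws ! j))"
      using wi ij by (simp only:) (intro field_trace_lincomb[OF sub], auto simp: subfield_mult[OF sub] ring_of_integers_def)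
    also have "\<dots> = of_int (\<Sum>k<n. A $$ (i, k) * t k j) / of_int D"
      using ij by (simp add: t sum_divide_distrib)
    also have "\<dots> = (if i = j then 1 else 0)" using AT[OF ij] D by simp
    finally show "field_trace K (map u [0..<n] ! i * ws ! j) = (if i = j then 1 else 0)" using ij by simp
  qed
qed

text \<open>The dual basis lies in the complementary module of the ring of integers, as seen by
  expanding y in the integral basis.\<close>

lemma trace_dual_in_Ints:
  assumes K: "finite_ext \<rat> K" and ws: "integral_basis K ws" and us: "length us = length ws" "set us \<subseteq> K"
    "\<And>i j. i < length ws \<Longrightarrow> j < length ws \<Longrightarrow> field_trace K (us ! i * ws ! j) = (if i = j then 1 else 0)"
    and y: "y \<in> ring_of_integers K" and l: "l < length ws"
  shows "field_trace K (us ! l * y) \<in> \<int>"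
proof -
  have sub: "is_subfield K" using K by (simp add: finite_ext_def)
  obtain cs :: "int list" where cs: "y = (\<Sum>i<length ws. of_int (cs ! i) * ws ! i)"
    using ws y unfolding integral_basis_def by blast
  have wsK: "set ws \<subseteq> K" using ws by (auto simp: integral_basis_def ring_of_integers_def)
  have "us ! l * y = (\<Sum>i<length ws. of_int (cs ! i) * (us ! l * ws ! i))"
    by (simp add: cs sum_distrib_left mult_ac)
  then have "field_trace K (us ! l * y) = (\<Sum>i<length ws. of_int (cs ! i) * field_trace K (us ! l * ws ! i))"
    using us(1,2) wsK l by (simp only:) (intro field_trace_lincomb[OF sub], auto simp: subfield_mult[OF sub] subset_iff)
  also have "\<dots> \<in> \<int>" using us(3)[OF l] by (intro Ints_sum Ints_mult) auto
  finally show ?thesis .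
qed

lemma gram_poly_carrier: "gram_poly K f ws \<in> carrier_mat (length ws) (length ws)"
  by (simp add: gram_poly_def)

lemma coeff_gram_poly:
  assumes K: "is_subfield K" and f: "f \<in> polys K" and ws: "set ws \<subseteq> K" and ij: "i < length ws" "j < length ws"
  shows "coeff (gram_poly K f ws $$ (i, j)) l = field_trace K (coeff f l * (ws ! i * ws ! j))"
proof -
  have mem: "ws ! i * ws ! j \<in> K" using ws ij by (intro subfield_mult[OF K]) auto
  have fl: "coeff f l \<in> K" using f by (simp add: polys_def)
  have "coeff (gram_poly K f ws $$ (i, j)) l = (\<Sum>\<tau>\<in>embeddings \<rat> K. \<tau> (ws ! i * ws ! j) * \<tau> (coeff f l))"
    using ij emb_0[OF K] by (simp add: gram_poly_def coeff_sum coeff_map_poly)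
  also have "\<dots> = field_trace K (coeff f l * (ws ! i * ws ! j))"
    unfolding field_trace_def by (rule sum.cong) (simp_all add: emb_mult[OF K _ fl mem] mult.commute)
  finally show ?thesis .
qed

section \<open>Integer polynomials and their contents\<close>

lemma comm_ring_hom_of_int_poly: "comm_ring_hom (map_poly of_int :: int poly \<Rightarrow> complex poly)"
  by unfold_locales (simp_all add: of_int_poly_hom.hom_add of_int_poly_hom.hom_mult)

lemma ex_int_poly_det:
  fixes A :: "complex poly mat"
  assumes A: "A \<in> carrier_mat n n" and int: "\<And>i j l. i < n \<Longrightarrow> j < n \<Longrightarrow> coeff (A $$ (i, j)) l \<in> \<int>"
  obtains q :: "int poly" where "det A = map_poly of_int q"
proof -
  have "\<exists>q :: int poly. A $$ (i, j) = map_poly of_int q" if "i < n" "j < n" for i j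
    using intpolyE[of "A $$ (i, j)"] int[OF that] by metis
  then obtain b :: "nat \<Rightarrow> nat \<Rightarrow> int poly" where b: "\<And>i j. i < n \<Longrightarrow> j < n \<Longrightarrow> A $$ (i, j) = map_poly of_int (b i j)"
    by metis
  have "A = map_mat (map_poly of_int) (mat n n (\<lambda>(i, j). b i j))"
    by (rule eq_matI) (use A in \<open>auto simp: b\<close>)
  then have "det A = map_poly of_int (det (mat n n (\<lambda>(i, j). b i j)))"
    by (simp add: comm_ring_hom.hom_det[OF comm_ring_hom_of_int_poly])
  then show ?thesis using that by blast
qed

lemma ex_primitive_multiple:
  assumes p: "p \<in> polys \<rat>" "p \<noteq> 0"
  obtains c :: complex and h :: "int poly" where "c \<in> \<rat>" "c \<noteq> 0" "content h = 1" "p = Polynomial.smult c (map_poly of_int h)"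
proof -
  obtain N :: int where N: "N \<noteq> 0" "\<forall>i<Suc (degree p). of_int N * coeff p i \<in> \<int>"
    using ex_common_denominator[of "coeff p" "Suc (degree p)"] p(1) by (auto simp: polys_def)
  have "coeff (Polynomial.smult (of_int N) p) i \<in> \<int>" for i
    using N(2) by (cases "i < Suc (degree p)") (auto simp: coeff_eq_0)
  then obtain q :: "int poly" where q: "Polynomial.smult (of_int N) p = map_poly of_int q" by (rule intpolyE)
  have q0: "q \<noteq> 0" using q N(1) p(2) by auto
  define c where "c = (of_int (content q) / of_int N :: complex)"
  have "q = Polynomial.smult (content q) (primitive_part q)" by simp
  then have "map_poly of_int q = Polynomial.smult (of_int (content q)) (map_poly of_int (primitive_part q) :: complex poly)"
    by (metis map_poly_smult of_int_0 of_int_mult)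
  then have "p = Polynomial.smult c (map_poly of_int (primitive_part q))"
    using N(1) arg_cong[OF q, of "Polynomial.smult (1 / of_int N)"] by (simp add: c_def)
  moreover have "c \<in> \<rat>" "c \<noteq> 0" using q0 N(1) by (auto simp: c_def)
  ultimately show ?thesis using that[of c "primitive_part q"] q0 by (simp add: content_primitive_part)
qed

lemma content_power: "content (p ^ n) = content p ^ n"
  for p :: "int poly"
  by (induction n) (simp_all add: content_mult)

lemma of_int_poly_eq_iff: "map_poly of_int p = (map_poly of_int q :: complex poly) \<longleftrightarrow> p = q"
  for p q :: "int poly"
  by (metis (no_types, lifting) coeff_map_poly of_int_0 of_int_eq_iff poly_eqI)

text \<open>With \<open>f\<close> a polynomial whose coefficients generate the dual of the ring of integers of \<open>F\<close>, the Gram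
  determinants of the trace form twisted by \<open>f\<close> are \<open>Disc F\<close> times the norm of \<open>f\<close>, and similarly for \<open>K\<close>.
  By the Prague theorem the one for \<open>F\<close> divides a power of a primitive polynomial,
  so it is itself primitive.\<close>

lemma primitive_twisted_discriminant:
  assumes F: "finite_ext \<rat> F"
  obtains f and r :: "int poly" where "f \<in> polys F" "content r = 1"
    "map_poly of_int r = Polynomial.smult (Disc F) (norm_poly F f)"
    "\<And>l y. y \<in> ring_of_integers F \<Longrightarrow> field_trace F (coeff f l * y) \<in> \<int>"
proof -
  have sub: "is_subfield F" "\<rat> \<subseteq> F" using F by (simp_all add: finite_ext_def)
  obtain ws where ws: "integral_basis F ws" "Disc F = basis_disc F ws" using Disc_basis[OF F] .
  have ws_int: "set ws \<subseteq> ring_of_integers F" using ws(1) by (simp add: integral_basis_def)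
  then have wsF: "set ws \<subseteq> F" by (auto simp: ring_of_integers_def)
  have basis: "is_basis \<rat> F ws" by (rule integral_basis_is_basis[OF F ws(1)])
  obtain us where us: "length us = length ws" "set us \<subseteq> F"
    "\<And>i j. i < length ws \<Longrightarrow> j < length ws \<Longrightarrow> field_trace F (us ! i * ws ! j) = (if i = j then 1 else 0)"
    using ex_dual_basis[OF F ws_int basis] by blast
  define n where "n = length ws"
  have n: "n = card (embeddings \<rat> F)" using basis_disc_nonzero(2)[OF F basis] by (simp add: n_def)
  have npos: "n > 0" using card_embeddings_pos[OF F] n by simp
  obtain es where es: "distinct es" "set es = embeddings \<rat> F" "length es = card (embeddings \<rat> F)"
    using ex_embedding_list[OF F] .
  have disc_dual: "basis_disc F ws * basis_disc F us = 1"
  proof -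
    have "(emb_matrix es us)\<^sup>T * emb_matrix es ws = mat n n (\<lambda>(i, j). field_trace F (us ! i * ws ! j))"
      using gram_matrix_product[OF sub(1) es(1,2) wsF us(2,1)] n es by (simp add: n_def)
    also have "\<dots> = 1\<^sub>m n" by (rule eq_matI) (auto simp: us(3) n_def)
    finally have "det ((emb_matrix es us)\<^sup>T * emb_matrix es ws) = 1" by simp
    moreover have "emb_matrix es us \<in> carrier_mat n n" "emb_matrix es ws \<in> carrier_mat n n"
      using n es us by (auto simp: emb_matrix_def n_def)
    ultimately have "det (emb_matrix es us) * det (emb_matrix es ws) = 1"
      by (simp add: det_mult[of _ n] det_transpose)
    then have "(det (emb_matrix es ws) * det (emb_matrix es us))\<^sup>2 = 1" by (simp add: mult.commute)
    then show ?thesis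
      using basis_disc_eq_square[OF sub(1) es(1,2) wsF] basis_disc_eq_square[OF sub(1) es(1,2) us(2)] n es us
      by (simp add: n_def power_mult_distrib)
  qed
  \<comment> \<open>The powers of the variable only keep the dual basis elements apart, in the
    manner of Kronecker's representation of ideals by polynomials.\<close>
  define f where "f = (\<Sum>i<n. monom (us ! i) i)"
  have cf: "coeff f l = (if l < n then us ! l else 0)" for l by (simp add: f_def coeff_sum)
  have f: "f \<in> polys F" using us subfield_0[OF sub(1)] by (auto simp: polys_def cf n_def)
  have trace_f: "field_trace F (coeff f l * y) \<in> \<int>" if "y \<in> ring_of_integers F" for l y
  proof (cases "l < n")
    case True
    then show ?thesis using trace_dual_in_Ints[OF F ws(1) us that] by (simp add: cf n_def)
  next
    case False
    then show ?thesis using emb_0[OF sub(1)] by (simp add: cf field_trace_def)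
  qed
  have "us ! 0 \<noteq> 0"
  proof
    assume "us ! 0 = 0"
    then have "field_trace F (us ! 0 * ws ! 0) = 0" using emb_0[OF sub(1)] by (simp add: field_trace_def)
    then show False using us(3)[of 0 0] npos by (simp add: n_def)
  qed
  then have "coeff f 0 \<noteq> 0" using npos by (simp add: cf)
  then have f0: "f \<noteq> 0" by auto
  obtain g where g: "g \<in> polys F" "norm_poly F f = f * g" using norm_poly_cofactor[OF F f] .
  obtain c and h :: "int poly" where c: "c \<in> \<rat>" "c \<noteq> 0" "content h = 1" "norm_poly F f = Polynomial.smult c (map_poly of_int h)"
    using ex_primitive_multiple[OF norm_poly_in_Rats[OF F f] norm_poly_nonzero[OF F f f0]] .
  \<comment> \<open>Scaling makes f * g' equal to the primitive h. The coefficients of f need not be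
    integral, but by the Prague theorem their products with those of g' are.\<close>
  define g' where "g' = Polynomial.smult (1 / c) g"
  have g': "g' \<in> polys F" unfolding g'_def using g(1) c(1) sub
    by (intro polys_smult subfield_divide) (auto intro: subfield_1)
  have "f * g = Polynomial.smult c (map_poly of_int h)" using g(2) c(4) by simp
  then have fg': "f * g' = map_poly of_int h" by (simp add: g'_def c(2))
  have prague: "algebraic_int (coeff f i * coeff g' j)" for i j
    by (rule algebraic_int_coeff_times_coeff) (simp add: fg' int_coeffs_def coeff_map_poly)
  have len: "length ws = length es" "length us = length es" using n es us by (simp_all add: n_def)
  have "coeff (gram_poly F f ws $$ (i, j)) l \<in> \<int>" if "i < n" "j < n" for i j l
    using coeff_gram_poly[OF sub(1) f wsF] that trace_f ws_int ring_of_integers_closed(1)[OF sub(1)]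
    by (simp add: n_def subset_iff)
  then obtain r :: "int poly" where r: "det (gram_poly F f ws) = map_poly of_int r"
    using ex_int_poly_det[OF gram_poly_carrier] by (metis n_def)
  \<comment> \<open>An entry is the trace of \<open>us ! j\<close> times the product of
    \<open>us ! i\<close> with a coefficient of g'. That product is an integer, and
    \<open>us ! j\<close> pairs integers into \<int>.\<close>
  have "coeff (gram_poly F g' us $$ (i, j)) l \<in> \<int>" if ij: "i < n" "j < n" for i j l
  proof -
    have "us ! i = coeff f i" using ij by (simp add: cf)
    moreover have "us ! i \<in> F" "coeff g' l \<in> F" using us ij g' by (auto simp: n_def polys_def)
    ultimately have "us ! i * coeff g' l \<in> ring_of_integers F"
      using prague[of i l] by (simp add: ring_of_integers_def subfield_mult[OF sub(1)])
    from trace_f[OF this, of j] have "field_trace F (coeff g' l * (us ! i * us ! j)) \<in> \<int>"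
      using ij by (simp add: cf mult_ac)
    then show ?thesis using coeff_gram_poly[OF sub(1) g' us(2)] ij us(1) by (simp add: n_def)
  qed
  then obtain q :: "int poly" where q: "det (gram_poly F g' us) = map_poly of_int q"
    using ex_int_poly_det[OF gram_poly_carrier] by (metis n_def us(1))
  \<comment> \<open>The discriminants of the two dual bases cancel, and what is left is the norm of
    f * g' = h, that is h^n. Its content is 1, so r has content 1 as well.\<close>
  have "map_poly of_int (r * q) = det (gram_poly F f ws) * det (gram_poly F g' us)"
    by (simp add: r q of_int_poly_hom.hom_mult)
  also have "\<dots> = Polynomial.smult (basis_disc F ws * basis_disc F us) (norm_poly F f * norm_poly F g')"
    unfolding det_gram_poly[OF sub(1) es(1,2) wsF len(1)] det_gram_poly[OF sub(1) es(1,2) us(2) len(2)]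
    by (simp add: mult.commute)
  also have "\<dots> = norm_poly F (f * g')" using disc_dual norm_poly_mult[OF F f g'] by simp
  also have "\<dots> = (map_poly of_int h :: complex poly) ^ n"
    unfolding fg' n by (rule norm_poly_Rats[OF F]) (simp add: polys_def coeff_map_poly)
  also have "\<dots> = map_poly of_int (h ^ n)" by (simp add: of_int_poly_hom.hom_power)
  finally have "r * q = h ^ n" by (simp only: of_int_poly_eq_iff)
  then have "content r * content q = 1" using c(3) by (simp add: content_power flip: content_mult)
  then have "is_unit (content r)" by (metis dvd_triv_left)
  then have "content r = 1" using is_unit_content_iff by blast
  moreover have "map_poly of_int r = Polynomial.smult (Disc F) (norm_poly F f)"
    using r det_gram_poly[OF sub(1) es(1,2) wsF len(1)] ws(2) by simp
  ultimately show ?thesis using that f trace_f by blast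
qed

lemma abs_Disc_tower:
  assumes F: "finite_ext \<rat> F" and FK: "finite_ext F K"
  shows "abs_Disc F ^ card (embeddings F K) \<le> abs_Disc K"
proof -
  have K: "finite_ext \<rat> K" by (rule finite_ext_trans[OF F FK])
  have sub: "is_subfield F" "is_subfield K" "F \<subseteq> K" using FK by (simp_all add: finite_ext_def)
  obtain f and r :: "int poly" where f: "f \<in> polys F" and r: "content r = 1"
    "map_poly of_int r = Polynomial.smult (Disc F) (norm_poly F f)"
    and trace_f: "\<And>l y. y \<in> ring_of_integers F \<Longrightarrow> field_trace F (coeff f l * y) \<in> \<int>"
    using primitive_twisted_discriminant[OF F] by blast
  obtain vs where vs: "integral_basis K vs" "Disc K = basis_disc K vs" using Disc_basis[OF K] .
  have vs_int: "set vs \<subseteq> ring_of_integers K" using vs(1) by (simp add: integral_basis_def)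
  then have vsK: "set vs \<subseteq> K" by (auto simp: ring_of_integers_def)
  have basis: "is_basis \<rat> K vs" by (rule integral_basis_is_basis[OF K vs(1)])
  obtain es where es: "distinct es" "set es = embeddings \<rat> K" "length es = card (embeddings \<rat> K)"
    using ex_embedding_list[OF K] .
  have len: "length vs = length es" using basis_disc_nonzero(2)[OF K basis] es by simp
  have fK: "f \<in> polys K" using f polys_mono[OF sub(3)] by blast
  define n where "n = card (embeddings F K)"
  have "coeff (gram_poly K f vs $$ (i, j)) l \<in> \<int>" if ij: "i < length vs" "j < length vs" for i j l
  proof -
    have y: "vs ! i * vs ! j \<in> ring_of_integers K"
      using vs_int ij by (intro ring_of_integers_closed[OF sub(2)]) auto
    then have yK: "vs ! i * vs ! j \<in> K" "algebraic_int (vs ! i * vs ! j)" by (auto simp: ring_of_integers_def)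
    \<comment> \<open>The relative trace of an integer of K is an integer of F, and the coefficients
      of f pair those into \<int>.\<close>
    have "(\<Sum>\<tau>\<in>embeddings F K. \<tau> (vs ! i * vs ! j)) \<in> ring_of_integers F"
      unfolding ring_of_integers_def
      using trace_in_base[OF FK yK(1)] algebraic_int_embedding[OF sub(2) _ yK]
      by (auto intro: algebraic_int_sum_complex)
    from trace_f[OF this] have "field_trace K (coeff f l * (vs ! i * vs ! j)) \<in> \<int>"
      using field_trace_tower[OF F FK _ yK(1), of "coeff f l"] f by (simp add: polys_def)
    then show ?thesis using coeff_gram_poly[OF sub(2) fK vsK ij] by simp
  qed
  then obtain v :: "int poly" where v: "det (gram_poly K f vs) = map_poly of_int v"
    using ex_int_poly_det[OF gram_poly_carrier] by metis
  obtain zF :: int where zF: "Disc F = of_int zF" "zF \<noteq> 0" using Disc_nonzero_int[OF F] .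
  obtain zK :: int where zK: "Disc K = of_int zK" "zK \<noteq> 0" using Disc_nonzero_int[OF K] .
  have v': "map_poly of_int v = Polynomial.smult (of_int zK) (norm_poly F f ^ n)"
    using v det_gram_poly[OF sub(2) es(1,2) vsK len] vs(2) zK(1) norm_poly_tower[OF F FK f] by (simp add: n_def)
  have smult: "map_poly of_int (Polynomial.smult c p) = Polynomial.smult (of_int c) (map_poly of_int p :: complex poly)" for c and p :: "int poly"
    by (rule map_poly_smult) simp_all
  \<comment> \<open>The norm of f has rational coefficients only, so the n-th power of Disc F is
    multiplied in to turn it into r, which is integral of content 1. The contents of the two sides
    then compare v with Disc K.\<close>
  have "map_poly of_int (Polynomial.smult (zF ^ n) v) = Polynomial.smult (of_int zK) (Polynomial.smult (of_int zF) (norm_poly F f) ^ n)"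
    unfolding smult v' by (simp add: smult_power mult.commute)
  also have "\<dots> = map_poly of_int (Polynomial.smult zK (r ^ n))"
    unfolding smult using r(2) zF(1) by (simp add: of_int_poly_hom.hom_power)
  finally have eq: "Polynomial.smult (zF ^ n) v = Polynomial.smult zK (r ^ n)" by (simp only: of_int_poly_eq_iff)
  have "\<bar>zF ^ n\<bar> * content v = \<bar>zK\<bar>"
    using arg_cong[OF eq, of content] r(1) by (simp add: content_power)
  moreover have "v \<noteq> 0" using eq zK(2) r(1) by auto
  then have "content v > 0" by (metis abs_ge_zero content_eq_zero_iff normalize_content normalize_int_def order_less_le)
  then have "\<bar>zF ^ n\<bar> * 1 \<le> \<bar>zF ^ n\<bar> * content v" by (intro mult_left_mono) auto
  ultimately have "\<bar>zF\<bar> ^ n \<le> \<bar>zK\<bar>" by (simp add: power_abs)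
  then have "real_of_int (\<bar>zF\<bar> ^ n) \<le> real_of_int \<bar>zK\<bar>" by (simp only: of_int_le_iff)
  then show ?thesis using zF zK by (simp add: n_def)
qed

subsection \<open>Number fields of every degree\<close>

lemma algebraic_int_power_complex: "algebraic_int x \<Longrightarrow> algebraic_int (x ^ n)" for x :: complex
  by (induction n) (simp_all add: algebraic_int_mult_complex int_imp_algebraic_int)

text \<open>In a relation \<open>z 0 + z 1 \<alpha> + \<dots> = 0\<close> between powers of \<open>\<alpha>\<close>, an \<open>N\<close>-th root of 2, the number \<open>z 0\<close>
  is even, being divisible by \<open>\<alpha>\<close>. Dividing by \<open>\<alpha>\<close> shifts the coefficients cyclically.\<close>

lemma root_2_relation_shift:
  assumes \<alpha>: "\<alpha> ^ Suc n = (2 :: complex)" and z: "(\<Sum>i<Suc n. of_int (z i) * \<alpha> ^ i) = 0"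
  shows "even (z 0)" "(\<Sum>i<Suc n. of_int (if i < n then z (Suc i) else z 0 div 2) * \<alpha> ^ i) = 0"
proof -
  have int: "algebraic_int \<alpha>"
    using algebraic_int_root[of 2 "monom 1 (Suc n)" \<alpha>] \<alpha> int_imp_algebraic_int[of 2]
    by (simp add: poly_monom degree_monom_eq)
  define \<beta> where "\<beta> = (\<Sum>i<n. of_int (z (Suc i)) * \<alpha> ^ i)"
  have \<beta>: "algebraic_int \<beta>"
    unfolding \<beta>_def using algebraic_int_power_complex[OF int]
    by (intro algebraic_int_sum_complex algebraic_int_mult_complex) simp_all
  have rel: "of_int (z 0) + \<alpha> * \<beta> = 0"
    using z unfolding sum.lessThan_Suc_shift \<beta>_def by (simp add: sum_distrib_left mult_ac)
  then have "of_int (z 0) = - (\<alpha> * \<beta>)" by (simp add: eq_neg_iff_add_eq_0)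
  \<comment> \<open>Up to sign, the (n+1)-st power of \<open>z 0\<close> is 2 times that of \<beta>.
    Half of it is therefore a rational algebraic integer, hence an integer.\<close>
  then have "of_int (z 0) ^ Suc n = (- 1) ^ Suc n * \<alpha> ^ Suc n * \<beta> ^ Suc n"
    by (simp only: power_minus[of "\<alpha> * \<beta>"] power_mult_distrib mult.assoc)
  then have half: "(- 1) ^ Suc n * \<beta> ^ Suc n = of_int (z 0 ^ Suc n) / 2"
    unfolding \<alpha> by (simp only: of_int_power) simp
  have "algebraic_int ((- 1) ^ Suc n * \<beta> ^ Suc n)"
    by (rule algebraic_int_mult_complex[OF algebraic_int_power_complex[OF int_imp_algebraic_int]
          algebraic_int_power_complex[OF \<beta>]]) simp
  then have "algebraic_int (of_int (z 0 ^ Suc n) / 2 :: complex)" unfolding half .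
  moreover have "of_int (z 0 ^ Suc n) / 2 \<in> (\<rat> :: complex set)" by (simp del: power_Suc of_int_power)
  ultimately have "of_int (z 0 ^ Suc n) / 2 \<in> (\<int> :: complex set)"
    by (rule rational_algebraic_int_is_int)
  then obtain w where "of_int (z 0 ^ Suc n) / 2 = (of_int w :: complex)" by (elim Ints_cases)
  then have "of_int (z 0 ^ Suc n) = (of_int (2 * w) :: complex)" by (simp del: power_Suc of_int_power)
  then have "z 0 ^ Suc n = 2 * w" by (simp only: of_int_eq_iff)
  then have "even (z 0 ^ Suc n)" by simp
  then show ev: "even (z 0)" by (simp only: even_power)
  have "\<alpha> \<noteq> 0" using \<alpha> by auto
  obtain w where w: "z 0 = 2 * w" using ev by (elim evenE)
  have "\<alpha> * (\<Sum>i<Suc n. of_int (if i < n then z (Suc i) else z 0 div 2) * \<alpha> ^ i) = \<alpha> * \<beta> + of_int w * \<alpha> ^ Suc n"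
    by (simp add: \<beta>_def w algebra_simps)
  also have "\<dots> = 0" using rel w unfolding \<alpha> by (simp add: algebra_simps)
  finally show "(\<Sum>i<Suc n. of_int (if i < n then z (Suc i) else z 0 div 2) * \<alpha> ^ i) = 0"
    using \<open>\<alpha> \<noteq> 0\<close> by simp
qed

text \<open>After i cyclic shifts the coefficient \<open>z i\<close> has reached position 0.\<close>

lemma root_2_relation_even:
  assumes \<alpha>: "\<alpha> ^ Suc n = (2 :: complex)" and "i < Suc n" "(\<Sum>i<Suc n. of_int (z i) * \<alpha> ^ i) = 0"
  shows "even (z i)"
  using assms(2,3)
proof (induction i arbitrary: z)
  case 0
  then show ?case using root_2_relation_shift(1)[OF \<alpha>] by blast
next
  case (Suc i)
  then have "even (if i < n then z (Suc i) else z 0 div 2)"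
    using Suc.IH[of "\<lambda>i. if i < n then z (Suc i) else z 0 div 2"] root_2_relation_shift(2)[OF \<alpha>, of z] by simp
  then show ?case using Suc.prems by simp
qed

text \<open>Infinite descent: all coefficients of a relation are even, and halving them gives a
  relation with a smaller sum of absolute values.\<close>

lemma root_2_independent:
  assumes \<alpha>: "\<alpha> ^ Suc n = (2 :: complex)" and "(\<Sum>i<Suc n. of_int (z i) * \<alpha> ^ i) = 0" and "i < Suc n"
  shows "z i = 0"
proof -
  have "\<forall>i<Suc n. z i = 0"
    using assms(2)
  proof (induction "\<Sum>i<Suc n. nat \<bar>z i\<bar>" arbitrary: z rule: less_induct)
    case less
    have ev: "z i = 2 * (z i div 2)" if "i < Suc n" for i
      using root_2_relation_even[OF \<alpha> that less.prems] by simp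
    show ?case
    proof (rule ccontr)
      assume "\<not> (\<forall>i<Suc n. z i = 0)"
      then obtain i where i: "i < Suc n" "z i \<noteq> 0" by blast
      have le: "nat \<bar>z j div 2\<bar> \<le> nat \<bar>z j\<bar>" if "j < Suc n" for j using ev[OF that] by linarith
      have lt: "nat \<bar>z i div 2\<bar> < nat \<bar>z i\<bar>" using ev[OF i(1)] i(2) by linarith
      have "(\<Sum>i<Suc n. nat \<bar>z i div 2\<bar>) < (\<Sum>i<Suc n. nat \<bar>z i\<bar>)"
        using le lt i(1) by (intro sum_strict_mono_ex1) auto
      moreover have "2 * (\<Sum>i<Suc n. of_int (z i div 2) * \<alpha> ^ i) = (\<Sum>i<Suc n. of_int (2 * (z i div 2)) * \<alpha> ^ i)"
        by (simp only: sum_distrib_left of_int_mult of_int_numeral mult.assoc)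
      then have "2 * (\<Sum>i<Suc n. of_int (z i div 2) * \<alpha> ^ i) = (\<Sum>i<Suc n. of_int (z i) * \<alpha> ^ i)"
        using ev by simp
      then have "2 * (\<Sum>i<Suc n. of_int (z i div 2) * \<alpha> ^ i) = 0" unfolding less.prems .
      then have "(\<Sum>i<Suc n. of_int (z i div 2) * \<alpha> ^ i) = 0" by (simp del: sum.lessThan_Suc)
      ultimately have "\<forall>i<Suc n. z i div 2 = 0" by (rule less.hyps)
      then show False using ev[OF i(1)] i by simp
    qed
  qed
  then show ?thesis using assms(3) by blast
qed

text \<open>Generated by the N-th root of 2. A minimal polynomial of degree below N would, with
  denominators cleared, be an integer relation between the powers up to N - 1 in which the leading
  coefficient survives.\<close>

lemma ex_number_field_of_degree:
  assumes "N \<ge> 1"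
  obtains K where "finite_ext \<rat> K" "degree_eq \<rat> K N"
proof -
  define n where "n = N - 1"
  have N: "N = Suc n" using assms by (simp add: n_def)
  define \<alpha> where "\<alpha> = complex_of_real (root N 2)"
  have \<alpha>: "\<alpha> ^ Suc n = 2"
    unfolding \<alpha>_def N[symmetric] of_real_power[symmetric] using assms by (simp add: real_root_pow_pos2)
  define p where "p = monom 1 N - [:2 :: complex:]"
  have p: "p \<in> polys \<rat>" by (auto simp: p_def polys_def coeff_pCons split: nat.split)
  have cN: "coeff p N = 1" by (simp add: p_def N)
  then have p0: "p \<noteq> 0" by auto
  have "poly p \<alpha> = 0" using \<alpha> by (simp add: p_def poly_monom N del: power_Suc)
  then have "algebraic_over \<rat> \<alpha>" using p p0 by (auto simp: algebraic_over_def)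
  then obtain m where m: "min_poly \<rat> \<alpha> m" using ex_min_poly[OF is_subfield_Rats] by blast
  have "degree m \<le> degree p" using m p p0 \<open>poly p \<alpha> = 0\<close> by (auto simp: min_poly_def)
  also have "degree p \<le> N" by (rule degree_le) (auto simp: p_def coeff_pCons N split: nat.split)
  finally have le: "degree m \<le> N" .
  have "\<not> degree m < N"
  proof
    assume lt: "degree m < N"
    have mQ: "\<forall>i. coeff m i \<in> \<rat>" and lc: "lead_coeff m = 1" and root: "poly m \<alpha> = 0" using m by (auto simp: min_poly_def polys_def)
    obtain M :: int where M: "M \<noteq> 0" "\<forall>i<N. of_int M * coeff m i \<in> \<int>" using ex_common_denominator[OF mQ] by blast
    then have "\<exists>w. of_int M * coeff m i = of_int w" if "i < N" for i using that by (meson Ints_cases)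
    then obtain z :: "nat \<Rightarrow> int" where z: "\<And>i. i < N \<Longrightarrow> of_int M * coeff m i = of_int (z i)" by metis
    have "poly m \<alpha> = (\<Sum>i\<le>degree m. coeff m i * \<alpha> ^ i)" by (rule poly_altdef)
    also have "\<dots> = (\<Sum>i<N. coeff m i * \<alpha> ^ i)"
      using lt by (intro sum.mono_neutral_left) (auto simp: coeff_eq_0)
    finally have "(\<Sum>i<N. coeff m i * \<alpha> ^ i) = 0" using root by simp
    then have "(\<Sum>i<N. (of_int M * coeff m i) * \<alpha> ^ i) = 0"
      unfolding mult.assoc sum_distrib_left[symmetric] by simp
    then have "(\<Sum>i<Suc n. of_int (z i) * \<alpha> ^ i) = 0" using z by (simp add: N)
    then have "z (degree m) = 0" using root_2_independent[OF \<alpha>] lt N by blast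
    then show False using z[OF lt] M(1) lc by simp
  qed
  then have "degree m = N" using le by simp
  then show ?thesis using that adjoin_finite_ext[OF is_subfield_Rats m] by blast
qed

section \<open>Counting fields in towers\<close>

lemma one_minus_powr_le:
  fixes p s :: real
  assumes "p \<ge> 1" "0 < s" "s \<le> 1"
  shows "1 - s powr p \<le> p * (1 - s)"
proof -
  \<comment> \<open>The function \<open>x powr p - p * x\<close> is nonincreasing up to 1, since p
    \<ge> 1.\<close>
  have "1 powr p - p * 1 \<le> s powr p - p * s"
  proof (rule DERIV_nonpos_imp_nonincreasing[OF assms(3)])
    fix x assume x: "s \<le> x" "x \<le> 1"
    have "x powr (p - 1) \<le> 1"
      using x assms by (intro powr_le1) auto
    then have "p * x powr (p - 1) - p * 1 \<le> 0"
      using assms by simp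
    moreover have "((\<lambda>x. x powr p - p * x) has_real_derivative p * x powr (p - 1) - p * 1) (at x)"
      using x assms by (auto intro!: derivative_eq_intros has_real_derivative_powr)
    ultimately show "\<exists>y. ((\<lambda>x. x powr p - p * x) has_real_derivative y) (at x) \<and> y \<le> 0"
      by blast
  qed
  then show ?thesis by (simp add: algebra_simps)
qed

text \<open>The left side is at most the integral of b t^(-3/2) from u to v, since t^(b-1/2) is
  smallest at u; this is the source of the factor 2 * b. After scaling by u, with s = (v/u)^(-1/2),
  the claim becomes \<open>one_minus_powr_le\<close> with exponent 2 * b.\<close>

lemma powr_ratio_bound:
  fixes b u v :: real
  assumes "2 * b \<ge> 1" "0 < u" "u \<le> v"
  shows "u powr (b - 1 / 2) * (u powr (- b) - v powr (- b)) \<le> 2 * b * (u powr (- 1 / 2) - v powr (- 1 / 2))"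
proof -
  define s where "s = (v / u) powr (- 1 / 2)"
  have v: "v > 0" using assms by simp
  have s: "0 < s" "s \<le> 1"
    using assms v by (auto simp: s_def powr_minus_divide ge_one_powr_ge_zero)
  have vs: "v powr (- 1 / 2) = u powr (- 1 / 2) * s"
    using assms v by (simp add: s_def powr_divide)
  have "s powr (2 * b) = (v / u) powr (- b)"
    by (simp add: s_def powr_powr)
  then have vb: "v powr (- b) = u powr (- b) * s powr (2 * b)"
    using assms v by (simp add: powr_divide)
  have ub: "u powr (b - 1 / 2) * u powr (- b) = u powr (- 1 / 2)"
    by (simp flip: powr_add)
  have "1 - s powr (2 * b) \<le> 2 * b * (1 - s)"
    using assms s by (intro one_minus_powr_le) auto
  then have "u powr (- 1 / 2) * (1 - s powr (2 * b)) \<le> u powr (- 1 / 2) * (2 * b * (1 - s))"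
    by (intro mult_left_mono) auto
  moreover have "u powr (b - 1 / 2) * (u powr (- b) - u powr (- b) * s powr (2 * b)) =
      (u powr (b - 1 / 2) * u powr (- b)) * (1 - s powr (2 * b))"
    by (simp only: right_diff_distrib mult_1_right mult.assoc)
  ultimately show ?thesis
    unfolding vs vb ub by (simp add: right_diff_distrib mult_ac)
qed

text \<open>Abel summation over the values of D in increasing order: by
  \<open>powr_ratio_bound\<close> each gap between consecutive values contributes a term of a
  telescoping sum.\<close>

lemma sum_powr_le_of_count:
  fixes D :: "'a \<Rightarrow> real" and b c Y :: real
  assumes fin: "finite A" and b: "2 * b \<ge> 1" and c: "c \<ge> 0"
    and Y: "Y > 0" and D: "\<And>x. x \<in> A \<Longrightarrow> Y \<le> D x"
    and count: "\<And>x. x \<in> A \<Longrightarrow> real (card {y \<in> A. D y \<le> D x}) \<le> c * D x powr (b - 1 / 2)"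
  shows "(\<Sum>x\<in>A. D x powr (- b)) \<le> 2 * b * c * Y powr (- 1 / 2)"
proof -
  \<comment> \<open>The invariant has a boundary term at the largest value and a telescoped part.
    The elements are inserted in nondecreasing order of D, so each new one becomes the
    maximum.\<close>
  have "A = {} \<or> (\<Sum>x\<in>A. D x powr (- b)) \<le> 
     real (card A) * Max (D ` A) powr (- b) + 2 * b * c * (Y powr (- 1 / 2) - Max (D ` A) powr (- 1 / 2))"
    using fin D count
  proof (induction rule: finite_ranking_induct[where f = D])
    case empty
    then show ?case by simp
  next
    case (insert x S)
    have xS: "x \<notin> S \<or> insert x S = S" by auto
    show ?case
    proof (cases "x \<in> S \<or> S = {}")
      case True
      then show ?thesis
      proof
        assume "x \<in> S"
        then have "insert x S = S" by auto
        then show ?thesis using insert by auto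
      next
        assume S: "S = {}"
        have "Y powr (- 1 / 2) \<ge> D x powr (- 1 / 2)"
          using insert.prems(1)[of x] Y by (intro powr_mono2') auto
        then show ?thesis using S b c by simp
      qed
    next
      case False
      then have x: "x \<notin> S" and S: "S \<noteq> {}" by auto
      define u where "u = Max (D ` S)"
      have u: "u \<in> D ` S" unfolding u_def using insert.hyps S by (intro Max_in) auto
      then obtain z where z: "z \<in> S" "u = D z" by auto
      have ux: "u \<le> D x" using z insert.hyps by simp
      have maxx: "Max (D ` insert x S) = D x"
        using insert.hyps by (intro Max_eqI) auto
      have u0: "0 < u" using z insert.prems(1)[of z] Y by auto
      have cardS: "real (card S) \<le> c * u powr (b - 1 / 2)"
      proof -
        have "S \<subseteq> {y \<in> insert x S. D y \<le> D z}"
          using insert.hyps(1) unfolding z(2)[symmetric] by (auto simp: u_def)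
        then have "card S \<le> card {y \<in> insert x S. D y \<le> D z}"
          using insert.hyps(1) by (intro card_mono) auto
        then show ?thesis using insert.prems(2)[of z] z by simp
      qed
      have countS: "real (card {y \<in> S. D y \<le> D w}) \<le> c * D w powr (b - 1 / 2)" if "w \<in> S" for w
      proof -
        have "card {y \<in> S. D y \<le> D w} \<le> card {y \<in> insert x S. D y \<le> D w}"
          using insert.hyps(1) by (intro card_mono) auto
        then show ?thesis using insert.prems(2)[of w] that by simp
      qed
      have IH: "(\<Sum>x\<in>S. D x powr (- b)) \<le> real (card S) * u powr (- b) + 2 * b * c * (Y powr (- 1 / 2) - u powr (- 1 / 2))"
        using insert.IH[OF _ countS] insert.prems(1) S by (auto simp: u_def)
      have nonneg: "u powr (- b) - D x powr (- b) \<ge> 0"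
        using u0 ux b by (simp add: powr_mono2')
      have "real (card S) * (u powr (- b) - D x powr (- b)) \<le> c * u powr (b - 1 / 2) * (u powr (- b) - D x powr (- b))"
        using cardS nonneg by (intro mult_right_mono)
      also have "\<dots> \<le> c * (2 * b * (u powr (- 1 / 2) - D x powr (- 1 / 2)))"
        unfolding mult.assoc using powr_ratio_bound[OF b u0 ux] c by (intro mult_left_mono) (auto simp: mult.assoc)
      finally have "real (card S) * (u powr (- b) - D x powr (- b)) \<le> c * (2 * b * (u powr (- 1 / 2) - D x powr (- 1 / 2)))" .
      with IH show ?thesis
        using x insert.hyps(1) unfolding maxx by (simp add: algebra_simps)
    qed
  qed
  then show ?thesis
  proof
    assume "A = {}"
    then show ?thesis using b c by simp
  next
    assume *: "(\<Sum>x\<in>A. D x powr (- b)) \<le> 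
     real (card A) * Max (D ` A) powr (- b) + 2 * b * c * (Y powr (- 1 / 2) - Max (D ` A) powr (- 1 / 2))"
    show ?thesis
    proof (cases "A = {}")
      case True
      then show ?thesis using b c by simp
    next
      case False
      define u where "u = Max (D ` A)"
      have u: "u \<in> D ` A" unfolding u_def using fin False by (intro Max_in) auto
      then obtain z where z: "z \<in> A" "u = D z" by auto
      have "A = {y \<in> A. D y \<le> D z}"
        using fin unfolding z(2)[symmetric] by (auto simp: u_def)
      then have "real (card A) \<le> c * u powr (b - 1 / 2)"
        using count[OF z(1)] z by simp
      \<comment> \<open>The boundary term is at most c * u^(-1/2), which the subtracted part of the
        telescoped sum absorbs because 2 * b \<ge> 1.\<close>
      then have "real (card A) * u powr (- b) \<le> c * u powr (b - 1 / 2) * u powr (- b)"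
        by (intro mult_right_mono) auto
      also have "\<dots> = c * u powr (- 1 / 2)"
        unfolding mult.assoc by (simp flip: powr_add)
      also have "\<dots> \<le> 2 * b * (c * u powr (- 1 / 2))"
        using mult_right_mono[OF b, of "c * u powr (- 1 / 2)"] c by simp
      finally show ?thesis
        using * unfolding u_def by (simp add: algebra_simps)
    qed
  qed
qed

section \<open>Sizes of sets, and the fields on each level of a tower\<close>

lemma number_field_iff: "number_field k \<longleftrightarrow> finite_ext \<rat> k"
  using is_subfield_Rats Rats_subset_subfield
  by (auto simp: number_field_def finite_ext_def ring.finite_dimension_def[OF complex_is_ring])

lemma size_le_mono: "A \<subseteq> B \<Longrightarrow> size_le B r \<Longrightarrow> r \<le> s \<Longrightarrow> size_le A s"
  unfolding size_le_def by (meson card_mono finite_subset of_nat_le_iff order_trans)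

lemma size_le_UN:
  assumes "finite A" "\<And>x. x \<in> A \<Longrightarrow> size_le (B x) (f x)"
  shows "size_le (\<Union>x\<in>A. B x) (\<Sum>x\<in>A. f x)"
proof -
  have "real (card (\<Union>x\<in>A. B x)) \<le> real (\<Sum>x\<in>A. card (B x))"
    using card_UN_le[OF assms(1)] by (simp only: of_nat_le_iff)
  also have "\<dots> = (\<Sum>x\<in>A. real (card (B x)))" by simp
  also have "\<dots> \<le> (\<Sum>x\<in>A. f x)" using assms(2) by (intro sum_mono) (simp add: size_le_def)
  finally show ?thesis using assms by (simp add: size_le_def)
qed

text \<open>Unlike \<open>G_extensions\<close> this carries no bound on the discriminant, so towers
  are described once and cut off afterwards at whatever bound is wanted.\<close>

definition G_step :: "nat \<Rightarrow> 'b set \<Rightarrow> ('b \<Rightarrow> 'b) set \<Rightarrow> complex set \<Rightarrow> complex set \<Rightarrow> bool" where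
  "G_step n S H F K \<longleftrightarrow> finite_ext F K \<and> card (embeddings F K) = n \<and>
     perm_isomorphic (embeddings F K) (Gal_perm_group F K) S H"

lemma G_step_in_G_extensions:
  "G_step n S H F K \<Longrightarrow> abs_Disc K \<le> x \<Longrightarrow> K \<in> G_extensions n F x S H"
  using degree_eq_iff_card_embeddings[of F K n] by (simp add: G_step_def G_extensions_def finite_ext_def)

text \<open>A pair \<open>(l, K)\<close> stands for the field \<open>K = F l\<close> of a tower \<open>F l \<supseteq> \<dots> \<supseteq> F m = k\<close>.\<close>

inductive_set tower_fields :: "(nat \<Rightarrow> nat) \<Rightarrow> (nat \<Rightarrow> 'b set) \<Rightarrow> (nat \<Rightarrow> ('b \<Rightarrow> 'b) set) \<Rightarrow> complex set \<Rightarrow> nat \<Rightarrow> (nat \<times> complex set) set"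
  for ns S H k m where
  base: "(m, k) \<in> tower_fields ns S H k m"
| step: "(Suc l, F) \<in> tower_fields ns S H k m \<Longrightarrow> G_step (ns (Suc l)) (S (Suc l)) (H (Suc l)) F K \<Longrightarrow>
    (l, K) \<in> tower_fields ns S H k m"

lemma tower_fields_le: "(l, K) \<in> tower_fields ns S H k m \<Longrightarrow> l \<le> m"
  by (induction rule: tower_fields.induct) auto

lemma tower_fields_ext:
  assumes "is_subfield k" "(l, K) \<in> tower_fields ns S H k m"
  shows "finite_ext k K \<and> card (embeddings k K) = (\<Prod>j = l + 1..m. ns j)"
  using assms(2)
proof (induction rule: tower_fields.induct)
  case base
  have id: "(\<lambda>x\<in>k. x) \<in> embeddings k k" by (rule emb_id[OF assms(1) order_refl])
  have "\<tau> = (\<lambda>x\<in>k. x)" if \<tau>: "\<tau> \<in> embeddings k k" for \<tau>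
    by (rule emb_ext[OF \<tau> id]) (simp add: emb_base[OF assms(1) \<tau>])
  then have "embeddings k k = {\<lambda>x\<in>k. x}" using id by blast
  then show ?case using finite_ext_refl[OF assms(1)] by simp
next
  case (step l F K)
  then have FK: "finite_ext F K" "card (embeddings F K) = ns (Suc l)" by (simp_all add: G_step_def)
  have kF: "finite_ext k F" using step by simp
  have "card (embeddings k K) = (\<Prod>j = Suc l + 1..m. ns j) * ns (Suc l)"
    using card_embeddings_mult[OF kF FK(1)] step FK(2) by simp
  also have "\<dots> = (\<Prod>j = l + 1..m. ns j)"
    using tower_fields_le[OF step(1)] by (simp add: prod.atLeast_Suc_atMost[of "Suc l" m] mult.commute)
  finally show ?case using finite_ext_trans[OF kF FK(1)] by simp
qed

text \<open>Replaces an exponent \<alpha> by \<beta> at the price of y^p: if \<alpha> exceeds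
  \<beta>, the excess is at most p, and D is at most y.\<close>

lemma powr_count_transfer:
  fixes D y \<alpha> \<beta> p :: real
  assumes "1 \<le> D" "D \<le> y" "0 \<le> p" "\<alpha> - \<beta> \<le> p"
  shows "D powr \<alpha> \<le> y powr p * D powr \<beta>"
proof -
  have "D powr \<alpha> = D powr (\<alpha> - \<beta>) * D powr \<beta>" by (simp flip: powr_add)
  also have "D powr (\<alpha> - \<beta>) \<le> D powr p" using assms by (intro powr_mono) auto
  also have "D powr p \<le> y powr p" using assms by (intro powr_mono2) auto
  finally show ?thesis by (simp add: mult_right_mono)
qed

text \<open>The fields on level l are counted, with l descending from m - 1, where the claim is the
  assumed bound for i = m. The variable x stays arbitrary in the induction: the step uses the count
  below every discriminant that occurs, not only below one bound.\<close>

lemma count_tower_fields: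
  fixes S :: "nat \<Rightarrow> 'b set" and H :: "nat \<Rightarrow> ('b \<Rightarrow> 'b) set" and C :: "nat \<Rightarrow> nat \<Rightarrow> real"
    and a b :: "nat \<Rightarrow> real" and ns :: "nat \<Rightarrow> nat"
  assumes m: "m \<ge> 1" and ns: "\<And>i. i \<in> {1..m} \<Longrightarrow> ns i \<ge> 1"
    and bound: "\<And>i d k x. \<lbrakk>i \<in> {1..m}; number_field k; degree_eq \<rat> k d; x \<ge> 1\<rbrakk> \<Longrightarrow>
           size_le (G_extensions (ns i) k x (S i) (H i)) (C i d * x powr a i * abs_Disc k powr (- b i))"
    and ab: "\<And>i. i \<in> {1..m - 1} \<Longrightarrow> b i \<ge> a i + 1 / 2" and a: "\<And>i. i \<in> {1..m} \<Longrightarrow> a i > 0"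
    and C: "\<And>i d. i \<in> {1..m} \<Longrightarrow> d \<ge> 1 \<Longrightarrow> C i d \<ge> 0"
    and k: "finite_ext \<rat> k" and d: "card (embeddings \<rat> k) = d"
    and l: "l \<le> m - 1" and x: "x \<ge> 1"
  shows "size_le {K. (l, K) \<in> tower_fields ns S H k m \<and> abs_Disc K \<le> x}
     (2 ^ (m - 1 - l) * (\<Prod>i = l + 1..m - 1. b i) * (\<Prod>i = l + 1..m. C i (d * (\<Prod>j = i + 1..m. ns j)))
        * x powr Max (a ` {l + 1..m}) * abs_Disc k powr (- b m - 1 / 2 * (\<Sum>i<m - 1 - l. \<Prod>j = m - i..m. real (ns j))))"
  using l x
proof (induction arbitrary: x rule: inc_induct)
  case base
  have "{K. (m - 1, K) \<in> tower_fields ns S H k m \<and> abs_Disc K \<le> x} \<subseteq> G_extensions (ns m) k x (S m) (H m)"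
  proof clarify
    fix K assume K: "(m - 1, K) \<in> tower_fields ns S H k m" "abs_Disc K \<le> x"
    from K(1) show "K \<in> G_extensions (ns m) k x (S m) (H m)"
    proof cases
      case (step F)
      have "(m, F) \<in> tower_fields ns S H k m" using step(1) m by simp
      then have "F = k" by cases (auto dest: tower_fields_le)
      then show ?thesis using step(2) K(2) m G_step_in_G_extensions by simp
    qed (use m in auto)
  qed
  moreover have "size_le (G_extensions (ns m) k x (S m) (H m)) (C m d * x powr a m * abs_Disc k powr (- b m))"
    using bound[of m k d x] m k base degree_eq_iff_card_embeddings[OF k] d by (simp add: number_field_iff)
  ultimately have "size_le {K. (m - 1, K) \<in> tower_fields ns S H k m \<and> abs_Disc K \<le> x}
      (C m d * x powr a m * abs_Disc k powr (- b m))"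
    by (rule size_le_mono) simp
  then show ?case using m by (cases m) simp_all
next
  case (step n)
  \<comment> \<open>The step passes from level l to level n = l - 1; the group, the degree and the
    constants with index l belong to the extension of F l by F (l - 1).\<close>
  define l where "l = Suc n"
  have lm: "l \<in> {1..m - 1}" "l \<in> {1..m}" "l + 1 \<le> m" using step.hyps by (auto simp: l_def)
  define c0 where "c0 = 2 ^ (m - 1 - l) * (\<Prod>i = l + 1..m - 1. b i) * (\<Prod>i = l + 1..m. C i (d * (\<Prod>j = i + 1..m. ns j)))"
  define D where "D = abs_Disc k"
  define \<beta> where "\<beta> = 1 / 2 * (\<Sum>i<m - 1 - l. \<Prod>j = m - i..m. real (ns j))"
  define A' where "A' = Max (a ` {l + 1..m})"
  define e where "e = (\<Prod>j = l + 1..m. ns j)"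
  define dl where "dl = d * e"
  define y where "y = x powr (1 / ns l)"
  define M where "M = max (a l) A'"
  define T where "T = {F. (l, F) \<in> tower_fields ns S H k m \<and> abs_Disc F \<le> y}"
  define B where "B = c0 * D powr (- b m - \<beta>)"
  have D1: "D \<ge> 1" unfolding D_def by (rule abs_Disc_ge_1[OF k])
  have ksub: "is_subfield k" using k by (simp add: finite_ext_def)
  have d1: "d \<ge> 1" using card_embeddings_pos[OF k] d by simp
  have nsl: "ns l \<ge> 1" using ns lm by blast
  have IH: "size_le {F. (l, F) \<in> tower_fields ns S H k m \<and> abs_Disc F \<le> t} (B * t powr A')" if "t \<ge> 1" for t
    using step.IH[OF that] by (simp add: l_def c0_def B_def \<beta>_def A'_def D_def mult_ac)
  have bpos: "b i > 0" if i: "i \<in> {1..m - 1}" for i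
  proof -
    have "i \<in> {1..m}" using i by auto
    then show ?thesis using ab[OF i] a[of i] by linarith
  qed
  have Cpos: "C i (d * (\<Prod>j = i + 1..m. ns j)) \<ge> 0" if "i \<in> {1..m}" for i
  proof -
    have "(\<Prod>j = i + 1..m. ns j) \<ge> 1" using ns by (intro prod_ge_1) auto
    then show ?thesis using d1 that by (intro C) (simp_all add: Suc_le_eq)
  qed
  have "c0 \<ge> 0" unfolding c0_def using bpos Cpos lm by (intro mult_nonneg_nonneg prod_nonneg) (auto simp: less_imp_le)
  then have B0: "B \<ge> 0" by (simp add: B_def)
  have y1: "y \<ge> 1" using step.prems by (simp add: y_def ge_one_powr_ge_zero)
  have finT: "finite T" using IH[OF y1] by (simp add: T_def size_le_def)
  have T: "finite_ext k F" "card (embeddings k F) = e" "finite_ext \<rat> F" "degree_eq \<rat> F dl" "D ^ e \<le> abs_Disc F" "1 \<le> abs_Disc F"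
    if "F \<in> T" for F
  proof -
    have tF: "(l, F) \<in> tower_fields ns S H k m" using that by (simp add: T_def)
    then show kF: "finite_ext k F" and e: "card (embeddings k F) = e"
      using tower_fields_ext[OF ksub tF] by (simp_all add: e_def)
    show QF: "finite_ext \<rat> F" by (rule finite_ext_trans[OF k kF])
    show "degree_eq \<rat> F dl"
      using card_embeddings_mult[OF k kF] d e degree_eq_iff_card_embeddings[OF QF] by (simp add: dl_def)
    show "D ^ e \<le> abs_Disc F" using abs_Disc_tower[OF k kF] e by (simp add: D_def)
    show "1 \<le> abs_Disc F" by (rule abs_Disc_ge_1[OF QF])
  qed
  have sub: "{K. (n, K) \<in> tower_fields ns S H k m \<and> abs_Disc K \<le> x} \<subseteq> (\<Union>F\<in>T. G_extensions (ns l) F x (S l) (H l))"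
  proof clarify
    fix K assume K: "(n, K) \<in> tower_fields ns S H k m" "abs_Disc K \<le> x"
    from K(1) obtain F where F: "(l, F) \<in> tower_fields ns S H k m" "G_step (ns l) (S l) (H l) F K"
      by cases (use step.hyps in \<open>auto simp: l_def\<close>)
    have kF: "finite_ext k F" using tower_fields_ext[OF ksub F(1)] by blast
    have QF: "finite_ext \<rat> F" by (rule finite_ext_trans[OF k kF])
    have "abs_Disc F ^ ns l \<le> abs_Disc K"
      using abs_Disc_tower[OF QF, of K] F(2) by (simp add: G_step_def)
    then have "abs_Disc F ^ ns l \<le> x" using K(2) by simp
    then have "(abs_Disc F ^ ns l) powr (1 / ns l) \<le> y" unfolding y_def by (intro powr_mono2) auto
    moreover have "(abs_Disc F ^ ns l) powr (1 / ns l) = abs_Disc F"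
    proof -
      have pos: "abs_Disc F > 0" using abs_Disc_ge_1[OF QF] by linarith
      then show ?thesis using nsl unfolding powr_realpow[OF pos, symmetric] by (simp add: powr_powr)
    qed
    ultimately have "F \<in> T" using F(1) by (simp add: T_def)
    then show "K \<in> (\<Union>F\<in>T. G_extensions (ns l) F x (S l) (H l))"
      using G_step_in_G_extensions[OF F(2) K(2)] by blast
  qed
  have C_l: "C l dl \<ge> 0" using Cpos[OF lm(2)] by (simp add: dl_def e_def)
  have count: "size_le (\<Union>F\<in>T. G_extensions (ns l) F x (S l) (H l)) (\<Sum>F\<in>T. C l dl * x powr a l * abs_Disc F powr (- b l))"
    using bound[OF lm(2) _ T(4)] T(3) step.prems by (intro size_le_UN[OF finT]) (simp add: number_field_iff)
  have De: "D ^ e \<ge> 1" using D1 by simp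
  \<comment> \<open>The exponent \<open>ns l * (M - a l)\<close> is chosen so that the power of y
    becomes \<open>x powr (M - a l)\<close>, which completes \<open>x powr a l\<close> to
    \<open>x powr M\<close>.\<close>
  have "(\<Sum>F\<in>T. abs_Disc F powr (- b l)) \<le> 2 * b l * (B * y powr (ns l * (M - a l))) * (D ^ e) powr (- 1 / 2)"
  proof (rule sum_powr_le_of_count[OF finT])
    show "2 * b l \<ge> 1" using ab[OF lm(1)] a[OF lm(2)] by simp
    show "B * y powr (ns l * (M - a l)) \<ge> 0" using B0 by simp
    show "D ^ e > 0" using De by simp
    show "D ^ e \<le> abs_Disc F" if "F \<in> T" for F using T(5)[OF that] .
    fix F assume F: "F \<in> T"
    have "{F' \<in> T. abs_Disc F' \<le> abs_Disc F} \<subseteq> {F'. (l, F') \<in> tower_fields ns S H k m \<and> abs_Disc F' \<le> abs_Disc F}"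
      by (auto simp: T_def)
    then have "size_le {F' \<in> T. abs_Disc F' \<le> abs_Disc F} (B * abs_Disc F powr A')"
      using IH[OF T(6)[OF F]] size_le_mono by blast
    then have "real (card {F' \<in> T. abs_Disc F' \<le> abs_Disc F}) \<le> B * abs_Disc F powr A'" by (simp add: size_le_def)
    also have "\<dots> \<le> B * (y powr (ns l * (M - a l)) * abs_Disc F powr (b l - 1 / 2))"
    proof (intro mult_left_mono powr_count_transfer B0)
      show "1 \<le> abs_Disc F" "abs_Disc F \<le> y" using T(6)[OF F] F by (auto simp: T_def)
      have "M - a l \<ge> 0" by (simp add: M_def)
      then show "0 \<le> ns l * (M - a l)" by simp
      \<comment> \<open>Here A' \<le> M, and \<open>b l - 1 / 2\<close> is at least
        \<open>a l\<close>.\<close>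
      have "A' - (b l - 1 / 2) \<le> M - a l" using ab[OF lm(1)] by (simp add: M_def)
      also have "\<dots> \<le> ns l * (M - a l)" using \<open>M - a l \<ge> 0\<close> nsl mult_right_mono[of 1 "real (ns l)" "M - a l"] by simp
      finally show "A' - (b l - 1 / 2) \<le> ns l * (M - a l)" .
    qed
    finally show "real (card {F' \<in> T. abs_Disc F' \<le> abs_Disc F}) \<le> B * y powr (ns l * (M - a l)) * abs_Disc F powr (b l - 1 / 2)"
      by (simp add: mult_ac)
  qed
  then have "(\<Sum>F\<in>T. C l dl * x powr a l * abs_Disc F powr (- b l)) \<le>
      C l dl * x powr a l * (2 * b l * (B * y powr (ns l * (M - a l))) * (D ^ e) powr (- 1 / 2))"
    unfolding sum_distrib_left[symmetric] using C_l by (intro mult_left_mono) auto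
  also have "y powr (ns l * (M - a l)) = x powr (M - a l)"
    using nsl by (simp add: y_def powr_powr)
  \<comment> \<open>The number e is the degree of F l over k; this power of the lower bound yields
    the summand e / 2 that \<beta> gains in the present step.\<close>
  also have "(D ^ e) powr (- 1 / 2) = D powr (- (real e / 2))"
  proof -
    have pos: "D > 0" using D1 by linarith
    then show ?thesis unfolding powr_realpow[OF pos, symmetric] by (simp add: powr_powr)
  qed
  also have "C l dl * x powr a l * (2 * b l * (B * x powr (M - a l)) * D powr (- (real e / 2))) =
      2 * b l * C l dl * c0 * (x powr a l * x powr (M - a l)) * (D powr (- b m - \<beta>) * D powr (- (real e / 2)))"
    by (simp add: B_def mult_ac)
  also have "x powr a l * x powr (M - a l) = x powr M" by (simp flip: powr_add)
  also have "D powr (- b m - \<beta>) * D powr (- (real e / 2)) = D powr (- b m - (\<beta> + real e / 2))"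
    by (simp add: algebra_simps flip: powr_add)
  finally have le: "(\<Sum>F\<in>T. C l dl * x powr a l * abs_Disc F powr (- b l)) \<le>
      2 * b l * C l dl * c0 * x powr M * D powr (- b m - (\<beta> + real e / 2))" .
  have M: "M = Max (a ` {n + 1..m})"
  proof -
    have "{n + 1..m} = insert l {l + 1..m}" using lm by (auto simp: l_def)
    moreover have "Max (insert (a l) (a ` {l + 1..m})) = max (a l) A'" unfolding A'_def using lm by (intro Max_insert) auto
    ultimately show ?thesis by (simp add: M_def)
  qed
  have beta: "\<beta> + real e / 2 = 1 / 2 * (\<Sum>i<m - 1 - n. \<Prod>j = m - i..m. real (ns j))"
  proof -
    \<comment> \<open>The sum gains the index i = m - 1 - l, whose product starts at m - i = l + 1
      and therefore equals e.\<close>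
    have "m - 1 - n = Suc (m - 1 - l)" "m - (m - 1 - l) = l + 1" using lm by (auto simp: l_def)
    then show ?thesis by (simp add: \<beta>_def e_def algebra_simps)
  qed
  have coeff: "2 * b l * C l dl * c0 =
      2 ^ (m - 1 - n) * (\<Prod>i = n + 1..m - 1. b i) * (\<Prod>i = n + 1..m. C i (d * (\<Prod>j = i + 1..m. ns j)))"
  proof -
    have "m - 1 - n = Suc (m - 1 - l)" using lm by (auto simp: l_def)
    moreover have "(\<Prod>i = n + 1..m - 1. b i) = b l * (\<Prod>i = l + 1..m - 1. b i)"
      using lm by (simp add: l_def prod.atLeast_Suc_atMost[of "Suc n"])
    moreover have "(\<Prod>i = n + 1..m. C i (d * (\<Prod>j = i + 1..m. ns j))) = C l dl * (\<Prod>i = l + 1..m. C i (d * (\<Prod>j = i + 1..m. ns j)))"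
      using lm by (simp add: l_def dl_def e_def prod.atLeast_Suc_atMost[of "Suc n" m])
    ultimately show ?thesis by (simp add: c0_def mult_ac)
  qed
  show ?case
    using size_le_mono[OF sub count le] unfolding M beta coeff D_def .
qed

text \<open>Gives \<open>ns i \<ge> 1\<close> from the block systems alone, so it is available
  whether or not there is any extension to be counted.\<close>

lemma tower_type_card:
  assumes "\<Omega> \<noteq> {}" "tower_type \<Omega> G m S H" "i \<in> {1..m}"
  shows "2 \<le> card (S i)"
proof -
  obtain \<Delta> where nested: "nested_block_systems \<Omega> G m \<Delta>"
    and iso: "\<And>B. B \<in> \<Delta> i \<Longrightarrow> perm_isomorphic (subblocks \<Delta> i B)
       (induced_perm_group G B (subblocks \<Delta> i B)) (S i) (H i)"
    using assms(2,3) unfolding tower_type_def by blast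
  have "block_system \<Omega> G (\<Delta> i)"
    using nested assms(3) by (simp add: nested_block_systems_def)
  then have "\<Union> (\<Delta> i) = \<Omega>" by (simp add: block_system_def partition_on_def)
  then obtain B where B: "B \<in> \<Delta> i" using assms(1) by blast
  have "2 \<le> card (subblocks \<Delta> i B)"
    using nested assms(3) B unfolding nested_block_systems_def by blast
  also have "\<dots> = card (S i)"
    using iso[OF B] by (elim perm_isomorphicE) (rule bij_betw_same_card)
  finally show ?thesis .
qed

lemma G_extensions_subset_tower_fields:
  assumes k: "is_subfield k" and G: "perm_group \<Omega> G" and tower: "tower_type \<Omega> G m S H"
    and ns: "\<And>i. i \<in> {1..m} \<Longrightarrow> ns i = card (S i)"
  shows "G_extensions n k x \<Omega> G \<subseteq> {K. (0, K) \<in> tower_fields ns S H k m \<and> abs_Disc K \<le> x}"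
proof clarify
  fix K assume K: "K \<in> G_extensions n k x \<Omega> G"
  then have K': "is_subfield K" "k \<subseteq> K" "degree_eq k K n" and x: "abs_Disc K \<le> x"
    and iso: "perm_isomorphic (embeddings k K) (Gal_perm_group k K) \<Omega> G"
    by (simp_all add: G_extensions_def)
  have kK: "finite_ext k K" using k K' unfolding finite_ext_def by blast
  obtain F where F: "F 0 = K" "F m = k"
    "\<And>i. i \<in> {1..m} \<Longrightarrow> finite_ext (F i) (F (i - 1)) \<and> card (embeddings (F i) (F (i - 1))) = card (S i) \<and>
       perm_isomorphic (embeddings (F i) (F (i - 1))) (Gal_perm_group (F i) (F (i - 1))) (S i) (H i)"
    by (rule tower_of_fields[OF kK G tower iso]) blast
  have "(l, F l) \<in> tower_fields ns S H k m" if "l \<le> m" for l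
    using that
  proof (induction rule: inc_induct)
    case base
    show ?case unfolding F(2) by (rule tower_fields.base)
  next
    case (step l)
    then have "G_step (ns (Suc l)) (S (Suc l)) (H (Suc l)) (F (Suc l)) (F l)"
      using F(3)[of "Suc l"] ns[of "Suc l"] by (simp add: G_step_def)
    then show ?case by (rule tower_fields.step[OF step.IH])
  qed
  from this[of 0] show "(0, K) \<in> tower_fields ns S H k m \<and> abs_Disc K \<le> x"
    using F(1) x by simp
qed

theorem proposition2p18:
  fixes \<Omega> :: "'a set" and G :: "('a \<Rightarrow> 'a) set"
    and S :: "nat \<Rightarrow> 'b set" and H :: "nat \<Rightarrow> ('b \<Rightarrow> 'b) set"
    and n m :: nat and ns :: "nat \<Rightarrow> nat"
    and a b :: "nat \<Rightarrow> real" and C :: "nat \<Rightarrow> nat \<Rightarrow> real"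
  assumes "transitive_perm_group \<Omega> G" and "card \<Omega> = n"
    and "m \<ge> 1" and "tower_type \<Omega> G m S H"
    and "\<And>i. i \<in> {1..m} \<Longrightarrow> ns i = card (S i)"
    and "\<And>i. i \<in> {1..m} \<Longrightarrow> a i > 0 \<and> b i > 0"
    and "\<And>i d k x. \<lbrakk>i \<in> {1..m}; number_field k; degree_eq \<rat> k d; x \<ge> 1\<rbrakk> \<Longrightarrow>
           size_le (G_extensions (ns i) k x (S i) (H i))
             (C i d * x powr a i * abs_Disc k powr (- b i))"
    and "\<And>i. i \<in> {1..m - 1} \<Longrightarrow> b i \<ge> a i + 1 / 2"
    and "\<And>i. \<lbrakk>i \<in> {1..m - 1}; a i < a (i + 1); a (i + 1) < a i + 1 / (2 * real (ns i))\<rbrakk> \<Longrightarrow>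
           b i \<ge> a i + 1 / 2 + 1 / (2 * real (ns i))"
  shows "\<forall>d k x. number_field k \<longrightarrow> degree_eq \<rat> k d \<longrightarrow> x \<ge> 1 \<longrightarrow>
           (let \<beta> = 1 / 2 * (\<Sum>i<m - 1. \<Prod>j = m - i..m. real (ns j)) in
            size_le (G_extensions n k x \<Omega> G)
              (2 ^ (m - 1) * (\<Prod>i = 1..m - 1. b i) * (\<Prod>i = 1..m. C i (d * (\<Prod>j = i + 1..m. ns j)))
                * x powr Max (a ` {1..m}) * abs_Disc k powr (- b m - \<beta>)))"
proof (intro allI impI)
  fix d k and x :: real
  assume k: "number_field k" and d: "degree_eq \<rat> k d" and x: "x \<ge> 1"
  have kQ: "finite_ext \<rat> k" using k by (simp add: number_field_iff)
  have ksub: "is_subfield k" using k by (simp add: number_field_def)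
  have d': "card (embeddings \<rat> k) = d" using degree_eq_iff_card_embeddings[OF kQ] d by simp
  have G: "perm_group \<Omega> G" and \<Omega>: "\<Omega> \<noteq> {}" using assms(1) by (auto simp: transitive_perm_group_def)
  have ns: "ns i \<ge> 1" if "i \<in> {1..m}" for i
    using tower_type_card[OF \<Omega> assms(4) that] assms(5)[OF that] by simp
  \<comment> \<open>A cardinality is nonnegative, so the assumed bound at x = 1 over any number
    field of degree N determines the sign of \<open>C i N\<close>.\<close>
  have C: "C i N \<ge> 0" if i: "i \<in> {1..m}" and N: "N \<ge> 1" for i N
  proof -
    obtain K where K: "finite_ext \<rat> K" "degree_eq \<rat> K N" using ex_number_field_of_degree[OF N] .
    have "size_le (G_extensions (ns i) K 1 (S i) (H i)) (C i N * 1 powr a i * abs_Disc K powr (- b i))"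
      using K by (intro assms(7)[OF i]) (simp_all add: number_field_iff)
    then have "0 \<le> C i N * abs_Disc K powr (- b i)" by (simp add: size_le_def)
    moreover have "abs_Disc K > 0" using abs_Disc_ge_1[OF K(1)] by linarith
    then have "abs_Disc K powr (- b i) > 0" by simp
    ultimately show ?thesis by (simp add: zero_le_mult_iff)
  qed
  have "size_le {K. (0, K) \<in> tower_fields ns S H k m \<and> abs_Disc K \<le> x}
     (2 ^ (m - 1 - 0) * (\<Prod>i = 0 + 1..m - 1. b i) * (\<Prod>i = 0 + 1..m. C i (d * (\<Prod>j = i + 1..m. ns j)))
        * x powr Max (a ` {0 + 1..m}) * abs_Disc k powr (- b m - 1 / 2 * (\<Sum>i<m - 1 - 0. \<Prod>j = m - i..m. real (ns j))))"
    using assms(3,6-8) ns C kQ d' x by (intro count_tower_fields) simp_all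
  then show "let \<beta> = 1 / 2 * (\<Sum>i<m - 1. \<Prod>j = m - i..m. real (ns j)) in
            size_le (G_extensions n k x \<Omega> G)
              (2 ^ (m - 1) * (\<Prod>i = 1..m - 1. b i) * (\<Prod>i = 1..m. C i (d * (\<Prod>j = i + 1..m. ns j)))
                * x powr Max (a ` {1..m}) * abs_Disc k powr (- b m - \<beta>))"
    using size_le_mono[OF G_extensions_subset_tower_fields[OF ksub G assms(4,5), of n x]] by (simp add: Let_def)
qed

end
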